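(* Let $\Sigma^{(1)},\Sigma^{(2)}:[0,\infty)\to\mathbb R$ be deterministic measurable functions of time such that $\int_0^t(\Sigma^{(i)}_s)^2\,\mathrm ds<\infty$ for $i=1,2$ and all $t\ge0$, such that $|\Sigma^{(1)}_s|>0$ and $|\Sigma^{(2)}_s|>0$ for all $s\ge0$, and such that $$A^{I}_t:=\int_0^t\left(|\Sigma^{(1)}_s|-|\Sigma^{(2)}_s|\right)^2\mathrm ds\nearrow\infty,\qquad A^{II}_t:=\int_0^t\left(|\Sigma^{(1)}_s|+|\Sigma^{(2)}_s|\right)^2\mathrm ds\nearrow\infty\qquad\text{as } t\nearrow\infty.$$ Let $r\le0$ and, for $V\in\mathcal V$, let $$R_t(V):=r+\int_0^t\Sigma^{(1)}_s\,\mathrm dB_s-\int_0^t\Sigma^{(2)}_s\,\mathrm dV_s,\qquad \tau_0^+(R(V)):=\inf\{t\ge0: R_t(V)>0\}\quad(\inf\emptyset=\infty).$$ Let $$V^{I}_t:=\int_0^t\operatorname{sgn}\left(\Sigma^{(1)}_s\Sigma^{(2)}_s\right)\mathrm dB_s,\qquad V^{II}_t:=-V^I_t.$$ Then, for every $T>0$ and every $V\in\mathcal V$, $$\mathsf P_r\left[\tau_0^+(R(V^{II}))>T\right]\le\mathsf P_r\left[\tau_0^+(R(V))>T\right]\le\mathsf P_r\left[\tau_0^+(R(V^{I}))>T\right].$$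
   Context: $(\Omega,(\mathcal F_t)_{t\ge0},\mathcal F,\mathsf P)$ is a filtered probability space supporting a standard $(\mathcal F_t)$-Brownian motion $B$; $\mathcal V$ is the set of all $(\mathcal F_t)$-Brownian motions $V=(V_t)_{t\ge0}$ on this space with $V_0=0$. $\mathsf P_r$ indicates that the process $R(V)$ starts at $R_0(V)=r$. $\operatorname{sgn}(x)=1$ if $x>0$ and $\operatorname{sgn}(x)=-1$ if $x<0$. *)

theory Defs
  imports "HOL-Probability.Probability"
begin

(* Time is the half-line [0, \<infinity>) inside type real: nothing is required of filtrations,
   processes or integrands at negative times. The usual conditions are not assumed. *)

definition filtered_prob_space :: "'a measure \<Rightarrow> (real \<Rightarrow> 'a measure) \<Rightarrow> bool" where
  "filtered_prob_space M F \<longleftrightarrow>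
     prob_space M \<and>
     (\<forall>t\<ge>0. subalgebra M (F t)) \<and>
     (\<forall>s t. 0 \<le> s \<and> s \<le> t \<longrightarrow> subalgebra (F t) (F s))"

definition brownian_motion ::
  "'a measure \<Rightarrow> (real \<Rightarrow> 'a measure) \<Rightarrow> (real \<Rightarrow> 'a \<Rightarrow> real) \<Rightarrow> bool" where
  "brownian_motion M F W \<longleftrightarrow>
     (\<forall>t\<ge>0. W t \<in> borel_measurable (F t)) \<and>
     (AE x in M. W 0 x = 0) \<and>
     (AE x in M. continuous_on {0..} (\<lambda>t. W t x)) \<and>
     (\<forall>s t. 0 \<le> s \<and> s < t \<longrightarrow>
        distributed M lborel (\<lambda>x. W t x - W s x) (normal_density 0 (sqrt (t - s))) \<and>
        prob_space.indep_set M (sets (F s))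
          {(\<lambda>x. W t x - W s x) -` A \<inter> space M | A. A \<in> sets borel})"

definition partition_of :: "real \<Rightarrow> nat \<Rightarrow> (nat \<Rightarrow> real) \<Rightarrow> bool" where
  "partition_of t n p \<longleftrightarrow> 0 \<le> p 0 \<and> (\<forall>i<n. p i \<le> p (Suc i)) \<and> p n \<le> t"

definition step_fun :: "nat \<Rightarrow> (nat \<Rightarrow> real) \<Rightarrow> (nat \<Rightarrow> real) \<Rightarrow> real \<Rightarrow> real" where
  "step_fun n p c s = (\<Sum>i<n. c i * indicator {p i<..p (Suc i)} s)"

definition step_integral ::
  "(real \<Rightarrow> 'a \<Rightarrow> real) \<Rightarrow> nat \<Rightarrow> (nat \<Rightarrow> real) \<Rightarrow> (nat \<Rightarrow> real) \<Rightarrow> 'a \<Rightarrow> real" where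
  "step_integral W n p c x = (\<Sum>i<n. c i * (W (p (Suc i)) x - W (p i) x))"

(* The Ito integral of a deterministic integrand f against a Brownian motion W. It is only
   determined up to indistinguishability, so this is a predicate: "I is a continuous version
   of the process t \<mapsto> \<integral>\<^sub>0\<^sup>t f dW". For every t, I t is the L2(M)-limit of the integrals of
   step functions converging to f in L2([0,t]); by the Ito isometry the choice of the step
   functions is immaterial. Paths are continuous everywhere and not just almost surely, so
   that hitting times of I are measurable although M need not be complete. *)
definition stochastic_integral ::
  "'a measure \<Rightarrow> (real \<Rightarrow> 'a \<Rightarrow> real) \<Rightarrow> (real \<Rightarrow> real) \<Rightarrow> (real \<Rightarrow> 'a \<Rightarrow> real) \<Rightarrow> bool" where
  "stochastic_integral M W f I \<longleftrightarrow>
     (\<forall>t\<ge>0. I t \<in> borel_measurable M) \<and>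
     (\<forall>x\<in>space M. continuous_on {0..} (\<lambda>t. I t x)) \<and>
     (\<forall>t\<ge>0. \<exists>n p c.
        (\<forall>k. partition_of t (n k) (p k)) \<and>
        (\<lambda>k. \<integral>\<^sup>+s\<in>{0..t}. ennreal ((f s - step_fun (n k) (p k) (c k) s)\<^sup>2) \<partial>lborel)
          \<longlonglongrightarrow> 0 \<and>
        (\<lambda>k. \<integral>\<^sup>+x. ennreal ((I t x - step_integral W (n k) (p k) (c k) x)\<^sup>2) \<partial>M)
          \<longlonglongrightarrow> 0)"

(* A version of R = r + \<integral> S1 dB - \<integral> S2 dV, with continuous paths. *)
definition is_R ::
  "'a measure \<Rightarrow> (real \<Rightarrow> 'a \<Rightarrow> real) \<Rightarrow> (real \<Rightarrow> real) \<Rightarrow> (real \<Rightarrow> real) \<Rightarrow> real \<Rightarrow>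
   (real \<Rightarrow> 'a \<Rightarrow> real) \<Rightarrow> (real \<Rightarrow> 'a \<Rightarrow> real) \<Rightarrow> bool" where
  "is_R M B S1 S2 r V R \<longleftrightarrow>
     (\<exists>X Y. stochastic_integral M B S1 X \<and> stochastic_integral M V S2 Y \<and>
        (\<forall>t\<ge>0. \<forall>x\<in>space M. R t x = r + X t x - Y t x))"

(* In ereal the infimum of the empty set is \<infinity>. *)
definition tau0plus :: "(real \<Rightarrow> 'a \<Rightarrow> real) \<Rightarrow> 'a \<Rightarrow> ereal" where
  "tau0plus R x = Inf {ereal t | t. 0 \<le> t \<and> R t x > 0}"

end

theory Submission imports Defs begin

text \<open>
  Write \<open>f\<close> and \<open>g\<close> for the two integrands. Over a short time, \<open>R\<close> moves by an increment \<open>D\<close>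
  with conditional mean zero, and whatever the dependence between the two Brownian motions, the
  conditional variance of \<open>D\<close> lies between the integrals of \<open>(\<bar>f\<bar> - \<bar>g\<bar>)\<^sup>2\<close> and \<open>(\<bar>f\<bar> + \<bar>g\<bar>)\<^sup>2\<close>. The
  two couplings of the theorem attain these deterministic bounds exactly. A process that fluctuates
  less is less likely to have crossed \<open>0\<close>.
  
  The last step is usually done by a time change to Brownian motion. Here it is done by a
  Lindeberg argument. The survival probability of a Brownian motion below level \<open>0\<close> is, up to a
  constant factor, the function \<open>barrier v x\<close> of the remaining variance \<open>v\<close> and the position \<open>x\<close>; it
  solves the heat equation and is concave on \<open>x \<le> 0\<close>. Let a process run below the barrier while \<open>v\<close>
  decreases along a deterministic clock \<open>A\<close>. By Taylor's formula the expectation of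
  \<open>barrier v R\<close>, restricted to survival, changes in each step by half of the expected curvature times
  (conditional variance minus clock increment). The curvature is negative, so this expectation
  decreases if the conditional variance dominates the clock, and increases if the clock dominates
  it. Hence the survival probability is bounded by the barrier function from above in the first
  case and from below in the second one (\<open>survives_upper\<close>, \<open>survives_lower\<close>). Two processes that are
  separated by a common clock can therefore be compared (\<open>tau0plus_comparison\<close>); the lower clock
  separates \<open>R(V)\<close> from \<open>R(V\<^sup>I)\<close> and the upper clock separates it from \<open>R(V\<^sup>I\<^sup>I)\<close>.
  
  The probabilistic input is a bound for the first, second and fourth moments of the increments of
  \<open>R\<close>. For integrals of step functions these are computed from the independence of Brownian
  increments (\<open>pair_step_integral\<close>, \<open>step_integral_fourth\<close>), and they pass to the mean square limit
  (\<open>wiener_integral_pair_moments\<close>, \<open>wiener_integral_fourth\<close>). An associativity law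
  (\<open>wiener_integral_assoc\<close>) turns the two extremal processes into integrals against \<open>B\<close> alone.
\<close>

section \<open>The barrier profile\<close>

definition Phi :: "real \<Rightarrow> real" where
  "Phi = cdf std_normal_distribution"

abbreviation phi :: "real \<Rightarrow> real" where
  "phi \<equiv> std_normal_density"

lemma Phi_eq_integral: "a \<le> x \<Longrightarrow> Phi x = Phi a + integral {a..x} phi"
proof -
  assume le: "a \<le> x"
  interpret real_distribution std_normal_distribution by (rule real_dist_normal_dist)
  have cont: "continuous_on {a..x} phi"
    unfolding normal_density_def by (intro continuous_intros) auto
  have "Phi x - Phi a = measure std_normal_distribution {a<..x}"
    unfolding Phi_def using le cdf_diff_eq[of a x] by (cases "a = x") auto
  also have "\<dots> = (LINT y|lborel. phi y * indicator {a<..x} y)"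
    by (subst measure_def, subst emeasure_density) (auto simp: integral_eq_nn_integral ennreal_mult' ennreal_indicator)
  also have "\<dots> = (LINT y|lborel. phi y * indicator {a..x} y)"
    by (rule integral_cong_AE) (auto intro!: AE_I[where N="{a}"] simp: indicator_def)
  also have "\<dots> = (LINT y:{a..x}|lborel. phi y)"
    by (simp add: set_lebesgue_integral_def mult.commute)
  also have "\<dots> = integral {a..x} phi"
    by (intro set_borel_integral_eq_integral borel_integrable_atLeastAtMost') (rule cont)
  finally show ?thesis by simp
qed

lemma Phi_has_derivative [derivative_intros]: "(Phi has_real_derivative phi x) (at x)"
proof -
  have cont: "continuous_on {x - 1..x + 1} phi"
    unfolding normal_density_def by (intro continuous_intros) auto
  have "((\<lambda>u. integral {x - 1..u} phi) has_real_derivative phi x) (at x within {x - 1..x + 1})"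
    by (rule integral_has_real_derivative[OF cont]) auto
  then have "((\<lambda>u. Phi (x - 1) + integral {x - 1..u} phi) has_real_derivative phi x) (at x within {x - 1..x + 1})"
    by (auto intro!: derivative_eq_intros)
  then have "(Phi has_real_derivative phi x) (at x within {x - 1..x + 1})"
    by (rule has_field_derivative_transform_within[where d=1]) (auto simp: Phi_eq_integral)
  then show ?thesis
    by (subst (asm) at_within_interior) (auto simp: interior_cbox)
qed

lemma phi_has_derivative: "(phi has_real_derivative - y * phi y) (at y)"
  unfolding std_normal_density_def
  by (auto intro!: derivative_eq_intros simp: field_simps power2_eq_square)

lemma Phi_bounds: "0 \<le> Phi y" "Phi y \<le> 1"
proof -
  interpret real_distribution std_normal_distribution by (rule real_dist_normal_dist)
  show "0 \<le> Phi y" "Phi y \<le> 1"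
    unfolding Phi_def by (auto simp: cdf_nonneg cdf_bounded_prob)
qed

lemma phi_pos: "phi y > 0" by (rule normal_density_pos) simp

lemma Phi_strict_mono: "x < y \<Longrightarrow> Phi x < Phi y"
  by (rule DERIV_pos_imp_increasing[of x y Phi]) (use Phi_has_derivative phi_pos in blast)+

lemma Phi_pos: "Phi y > 0"
  using Phi_strict_mono[of "y - 1" y] Phi_bounds(1)[of "y - 1"] by simp

lemma Phi_at_bot: "(Phi \<longlongrightarrow> 0) at_bot"
proof -
  interpret real_distribution std_normal_distribution by (rule real_dist_normal_dist)
  show ?thesis unfolding Phi_def by (rule cdf_lim_at_bot)
qed

text \<open>
  The derivatives of \<open>Phi\<close> up to order three, and those of \<open>Phi (x / sqrt v)\<close> in \<open>v\<close> up to order two,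
  are polynomials in the argument times \<open>phi\<close> (and powers of \<open>v\<close>), so these bounds control all of
  them. They come from \<open>exp u \<ge> 1 + u + u\<^sup>2 / 2\<close> at \<open>u = y\<^sup>2 / 2\<close>.
\<close>

lemma phi_weighted_bounds: "phi y \<le> 1" "y^2 * phi y \<le> 2" "y^4 * phi y \<le> 8"
proof -
  define u where "u = y^2 / 2"
  have u0: "u \<ge> 0" by (simp add: u_def)
  have c: "1 / sqrt (2 * pi) \<le> 1" using pi_gt3 by (simp add: real_le_rsqrt)
  have le: "phi y \<le> exp (- u)"
    unfolding std_normal_density_def u_def using mult_right_mono[OF c, of "exp (- y\<^sup>2 / 2)"] by simp
  have e: "1 + u + u^2 / 2 \<le> exp u" using exp_lower_Taylor_quadratic[OF u0] by simp
  have b: "w * phi y \<le> K" if "0 \<le> w" "w \<le> K * exp u" for w K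
  proof -
    have "w * phi y \<le> K * exp u * exp (- u)"
      using that le by (meson mult_mono mult_left_mono mult_right_mono exp_ge_zero order_trans)
    then show ?thesis by (simp add: mult.assoc flip: exp_add)
  qed
  show "phi y \<le> 1" using b[of 1 1] u0 by simp
  have "u \<le> exp u" using e u0 zero_le_power2[of u] by linarith
  then have "y^2 \<le> 2 * exp u" by (simp add: u_def)
  then show "y^2 * phi y \<le> 2" by (intro b) auto
  have "y^4 = 4 * u^2" by (simp add: u_def power2_eq_square power4_eq_xxxx)
  then have "y^4 \<le> 8 * exp u" using e u0 by (smt (verit) zero_le_power2 field_sum_of_halves)
  then show "y^4 * phi y \<le> 8" by (intro b) auto
qed

text \<open>
  By the reflection principle, a Brownian motion started in \<open>x \<le> 0\<close> stays below \<open>0\<close> up to time \<open>v\<close>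
  with probability \<open>1 - 2 Phi (x / sqrt v)\<close>; as \<open>Phi 0 = 1/2\<close>, this is twice this function. For
  \<open>x > 0\<close> it is the odd extension, so that it solves the heat equation on the whole line and is
  negative above the barrier.
\<close>

definition barrier :: "real \<Rightarrow> real \<Rightarrow> real" where
  "barrier v x = Phi 0 - Phi (x / sqrt v)"

definition barrier_x :: "real \<Rightarrow> real \<Rightarrow> real" where
  "barrier_x v x = - phi (x / sqrt v) / sqrt v"

text \<open>
  The second space derivative of \<open>barrier\<close>. Because of the heat equation it is also twice the
  derivative in \<open>v\<close>, and \<open>barrier_time_Taylor\<close> uses it in that role.
\<close>

definition barrier_xx :: "real \<Rightarrow> real \<Rightarrow> real" where
  "barrier_xx v x = (x / sqrt v) * phi (x / sqrt v) / v"

lemma barrier_measurable [measurable]: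
  "barrier v \<in> borel_measurable borel" "barrier_x v \<in> borel_measurable borel"
  "barrier_xx v \<in> borel_measurable borel"
proof -
  have [measurable]: "Phi \<in> borel_measurable borel"
    by (rule borel_measurable_continuous_onI)
      (meson DERIV_isCont Phi_has_derivative continuous_at_imp_continuous_on)
  show "barrier v \<in> borel_measurable borel" "barrier_x v \<in> borel_measurable borel"
    "barrier_xx v \<in> borel_measurable borel"
    unfolding barrier_def barrier_x_def barrier_xx_def by measurable
qed

lemma barrier_le: "barrier v x \<le> Phi 0"
  using Phi_bounds(1) by (simp add: barrier_def)

lemma barrier_abs_le: "\<bar>barrier v x\<bar> \<le> 1"
  using Phi_bounds[of 0] Phi_bounds[of "x / sqrt v"] by (auto simp: barrier_def)

lemma Phi_mono: "x \<le> y \<Longrightarrow> Phi x \<le> Phi y"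
  using Phi_strict_mono by (cases "x = y") (auto simp: less_le)

lemma barrier_antimono: "v > 0 \<Longrightarrow> x \<le> y \<Longrightarrow> barrier v y \<le> barrier v x"
  unfolding barrier_def by (auto intro!: Phi_mono divide_right_mono)

lemma barrier_nonneg: "v > 0 \<Longrightarrow> x \<le> 0 \<Longrightarrow> 0 \<le> barrier v x"
  using barrier_antimono[of v x 0] by (simp add: barrier_def)

lemma barrier_nonpos: "v > 0 \<Longrightarrow> 0 \<le> x \<Longrightarrow> barrier v x \<le> 0"
  using barrier_antimono[of v 0 x] by (simp add: barrier_def)

lemma barrier_xx_nonpos: "v > 0 \<Longrightarrow> x \<le> 0 \<Longrightarrow> barrier_xx v x \<le> 0"
  unfolding barrier_xx_def
  by (intro divide_nonpos_nonneg mult_nonpos_nonneg) auto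

lemma barrier_x_bounded:
  assumes "v > 0"
  shows "\<bar>barrier_x v x\<bar> \<le> 1 / sqrt v"
  using assms phi_weighted_bounds(1)[of "x / sqrt v"]
  by (simp add: barrier_x_def abs_mult abs_divide divide_right_mono)

lemma abs_times_phi_bounded: "\<bar>y\<bar> * phi y \<le> 3"
proof -
  have "\<bar>y\<bar> \<le> 1 + y^2" using zero_le_power2[of "\<bar>y\<bar> - 1"] by (simp add: power2_eq_square algebra_simps) 
  then have "\<bar>y\<bar> * phi y \<le> (1 + y^2) * phi y" by (intro mult_right_mono) auto
  then show ?thesis using phi_weighted_bounds[of y] by (simp add: distrib_right)
qed

lemma barrier_xx_bounded:
  assumes "v > 0"
  shows "\<bar>barrier_xx v x\<bar> \<le> 3 / v"
  using divide_right_mono[OF abs_times_phi_bounded[of "x / sqrt v"], of v] assms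
  by (simp add: barrier_xx_def abs_mult)

text \<open>
  As the remaining variance tends to zero, the profile becomes a multiple of the indicator of
  \<open>x < 0\<close>; this is how probabilities are recovered from expectations of the smooth function.
\<close>

lemma barrier_tendsto_initial:
  assumes "x < 0"
  shows "((\<lambda>v. barrier v x) \<longlongrightarrow> Phi 0) (at_right 0)"
proof -
  have "filterlim (\<lambda>v. x / sqrt v) at_bot (at_right 0)"
  proof -
    have "filterlim (\<lambda>v. inverse (sqrt v)) at_top (at_right 0)"
    proof (rule filterlim_compose[OF filterlim_inverse_at_top_right])
      show "filterlim sqrt (at_right 0) (at_right 0)"
        unfolding filterlim_at
        by (auto intro!: tendsto_eq_intros simp: eventually_at_filter)
    qed
    from filterlim_tendsto_neg_mult_at_bot[OF tendsto_const assms this]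
    show ?thesis by (simp add: field_simps)
  qed
  from filterlim_compose[OF Phi_at_bot this]
  have "((\<lambda>v. Phi 0 - Phi (x / sqrt v)) \<longlongrightarrow> Phi 0 - 0) (at_right 0)"
    by (intro tendsto_intros)
  then show ?thesis by (simp add: barrier_def)
qed

text \<open>
  The third derivative of \<open>Phi\<close> is \<open>(y\<^sup>2 - 1) phi y\<close>, which is at most \<open>3\<close> in absolute value.
\<close>

lemma Phi_Taylor: "\<bar>Phi (y + e) - Phi y - phi y * e + y * phi y * e^2 / 2\<bar> \<le> \<bar>e\<bar>^3"
proof -
  define diff where "diff = (\<lambda>m t. if m = (0::nat) then Phi (y + t) else if m = 1 then phi (y + t)
      else if m = 2 then - (y + t) * phi (y + t) else ((y + t)^2 - 1) * phi (y + t))"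
  have P: "((\<lambda>t. Phi (y + t)) has_real_derivative phi (y + t)) (at t)" for t
    using DERIV_shift[of Phi "phi (y + t)" t y] Phi_has_derivative[of "y + t"] by (simp add: add.commute)
  have p: "((\<lambda>t. phi (y + t)) has_real_derivative - (y + t) * phi (y + t)) (at t)" for t
    using DERIV_shift[of phi "- (y + t) * phi (y + t)" t y] phi_has_derivative[of "y + t"]
    by (simp add: add.commute)
  have D: "\<forall>m t. m < 3 \<and> \<bar>t\<bar> \<le> \<bar>e\<bar> \<longrightarrow> (diff m has_real_derivative diff (Suc m) t) (at t)"
  proof (intro allI impI)
    fix m :: nat and t :: real assume "m < 3 \<and> \<bar>t\<bar> \<le> \<bar>e\<bar>"
    then consider "m = 0" | "m = 1" | "m = 2" by linarith
    then show "(diff m has_real_derivative diff (Suc m) t) (at t)"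
    proof cases
      case 3
      have "((\<lambda>t. - (y + t) * phi (y + t)) has_real_derivative ((y + t)^2 - 1) * phi (y + t)) (at t)"
        by (rule derivative_eq_intros refl p | simp add: power2_eq_square algebra_simps)+
      with 3 show ?thesis by (simp add: diff_def)
    qed (use P p in \<open>simp_all add: diff_def\<close>)
  qed
  obtain t where t: "Phi (y + e) = (\<Sum>m<3. diff m 0 / fact m * e^m) + diff 3 t / fact 3 * e^3"
    using Maclaurin_bi_le[of diff "\<lambda>t. Phi (y + t)" 3 e, OF _ D] by (auto simp: diff_def)
  have "\<bar>diff 3 t\<bar> \<le> 3"
  proof -
    have "\<bar>(y + t)^2 - 1\<bar> \<le> (y + t)^2 + 1" by (simp add: abs_le_iff) 
    then have "\<bar>diff 3 t\<bar> \<le> ((y + t)^2 + 1) * phi (y + t)"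
      by (simp add: diff_def abs_mult mult_right_mono)
    also have "\<dots> \<le> 3" using phi_weighted_bounds[of "y + t"] by (simp add: distrib_right)
    finally show ?thesis .
  qed
  then have "\<bar>diff 3 t / 6 * e^3\<bar> \<le> 1 * \<bar>e^3\<bar>"
    unfolding abs_mult by (intro mult_right_mono) auto
  moreover have "Phi (y + e) - Phi y - phi y * e + y * phi y * e^2 / 2 = diff 3 t / 6 * e^3"
    unfolding t by (simp add: diff_def eval_nat_numeral)
  ultimately show ?thesis by (simp add: power_abs)
qed

lemma barrier_space_Taylor:
  assumes "v > 0"
  shows "\<bar>barrier v (x + d) - barrier v x - barrier_x v x * d - barrier_xx v x * d^2 / 2\<bar>
    \<le> \<bar>d\<bar>^3 / sqrt v ^ 3"
proof -
  have s: "sqrt v > 0" "sqrt v ^ 2 = v" using assms by auto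
  have "barrier v (x + d) - barrier v x - barrier_x v x * d - barrier_xx v x * d^2 / 2
    = - (Phi (x / sqrt v + d / sqrt v) - Phi (x / sqrt v) - phi (x / sqrt v) * (d / sqrt v)
        + (x / sqrt v) * phi (x / sqrt v) * (d / sqrt v)^2 / 2)"
    using s by (simp add: barrier_def barrier_x_def barrier_xx_def add_divide_distrib power_divide)
  then show ?thesis
    using Phi_Taylor[of "x / sqrt v" "d / sqrt v"] s by (simp add: power_divide)
qed

lemma barrier_time_Taylor:
  assumes "v > 0" "a \<ge> 0"
  shows "\<bar>barrier (v + a) x - barrier v x - a * barrier_xx v x / 2\<bar> \<le> 4 * a^2 / v^2"
proof (cases "a = 0")
  case False
  with assms have a: "a > 0" by simp
  define diff where "diff = (\<lambda>m t. if m = (0::nat) then barrier (v + t) x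
      else if m = 1 then barrier_xx (v + t) x / 2
      else phi (x / sqrt (v + t)) * ((x / sqrt (v + t))^3 - 3 * (x / sqrt (v + t))) / (4 * (v + t)^2))"
  have s: "((\<lambda>t. x / sqrt (v + t)) has_real_derivative - (x / sqrt (v + t)) / (2 * (v + t))) (at t)"
    if "0 \<le> t" for t
  proof -
    have "sqrt (v + t) > 0" "sqrt (v + t)^2 = v + t" using that assms by auto
    then show ?thesis using that assms
      by (auto intro!: derivative_eq_intros simp: field_simps power2_eq_square)
  qed
  have p: "((\<lambda>t. phi (x / sqrt (v + t))) has_real_derivative
      - (x / sqrt (v + t)) * phi (x / sqrt (v + t)) * (- (x / sqrt (v + t)) / (2 * (v + t)))) (at t)"
    if "0 \<le> t" for t
    by (rule DERIV_chain2[OF phi_has_derivative s[OF that]])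
  have D0: "(diff 0 has_real_derivative diff 1 t) (at t)" if "0 \<le> t" for t
  proof -
    have "((\<lambda>t. Phi 0 - Phi (x / sqrt (v + t))) has_real_derivative
        0 - phi (x / sqrt (v + t)) * (- (x / sqrt (v + t)) / (2 * (v + t)))) (at t)"
      by (intro DERIV_diff DERIV_const DERIV_chain2[OF Phi_has_derivative s[OF that]])
    then show ?thesis by (simp add: diff_def barrier_def barrier_xx_def algebra_simps)
  qed
  have D1: "(diff 1 has_real_derivative diff 2 t) (at t)" if "0 \<le> t" for t
  proof -
    define y where "y = x / sqrt (v + t)"
    have nz: "v + t \<noteq> 0" using that assms by simp
    have lin: "((\<lambda>t. v + t) has_real_derivative 1) (at t)"
      by (auto intro!: derivative_eq_intros)
    have "((\<lambda>t. (x / sqrt (v + t)) * phi (x / sqrt (v + t)) / (v + t) / 2) has_real_derivative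
      (((- y / (2 * (v + t))) * phi y + (- y * phi y * (- y / (2 * (v + t)))) * y) * (v + t)
        - y * phi y * 1) / ((v + t) * (v + t)) / 2) (at t)"
      unfolding y_def
      by (intro DERIV_cdivide DERIV_divide DERIV_mult s p lin that nz)
    moreover have "(((- y / (2 * (v + t))) * phi y + (- y * phi y * (- y / (2 * (v + t)))) * y) * (v + t)
        - y * phi y * 1) / ((v + t) * (v + t)) / 2 = diff 2 t"
    proof -
      have "((- y / (2 * (v + t))) * phi y + (- y * phi y * (- y / (2 * (v + t)))) * y) * (v + t)
        = (- y * phi y + y^3 * phi y) / 2"
      proof -
        obtain w where w: "v + t = w" by blast
        show ?thesis using nz unfolding w by (simp add: field_simps power3_eq_cube)
      qed
      moreover have "(- y * phi y + y^3 * phi y) / 2 - y * phi y * 1 = phi y * (y^3 - 3 * y) / 2"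
        by (simp add: field_simps)
      ultimately show ?thesis unfolding diff_def y_def[symmetric]
        by (simp only:) (simp add: power2_eq_square mult_ac)
    qed
    ultimately show ?thesis by (simp add: diff_def barrier_xx_def)
  qed
  have D: "\<forall>m t. m < 2 \<and> 0 \<le> t \<and> t \<le> a \<longrightarrow> (diff m has_real_derivative diff (Suc m) t) (at t)"
    using D0 D1 by (auto simp: less_Suc_eq numeral_2_eq_2)
  obtain t where t: "0 < t" "barrier (v + a) x = (\<Sum>m<2. diff m 0 / fact m * a^m) + diff 2 t / fact 2 * a^2"
    using Maclaurin2[of a diff "\<lambda>t. barrier (v + t) x" 2, OF a _ D] by (auto simp: diff_def)
  define y where "y = x / sqrt (v + t)"
  have yb: "\<bar>y^3 - 3 * y\<bar> \<le> 4 + 4 * y^2 + y^4"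
  proof -
    have a1: "\<bar>y\<bar> \<le> 1 + y^2" using zero_le_power2[of "\<bar>y\<bar> - 1"]
      by (simp add: power2_eq_square algebra_simps)
    have "\<bar>y^3\<bar> = \<bar>y\<bar> * y^2" by (simp add: power3_eq_cube power2_eq_square abs_mult)
    also have "\<dots> \<le> (1 + y^2) * y^2" using a1 by (intro mult_right_mono) auto
    also have "\<dots> = y^2 + y^4" by (simp add: algebra_simps power2_eq_square power4_eq_xxxx)
    finally have "\<bar>y^3\<bar> \<le> y^2 + y^4" .
    then show ?thesis using a1 by (smt (verit) zero_le_power2)
  qed
  have "phi y * \<bar>y^3 - 3 * y\<bar> \<le> (4 + 4 * y^2 + y^4) * phi y"
    using yb by (subst mult.commute) (intro mult_right_mono, auto)
  also have "\<dots> \<le> 32" using phi_weighted_bounds[of y] by (simp add: distrib_right)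
  finally have n: "phi y * \<bar>y^3 - 3 * y\<bar> \<le> 32" .
  have "\<bar>diff 2 t\<bar> = phi y * \<bar>y^3 - 3 * y\<bar> / (4 * (v + t)^2)"
    unfolding diff_def y_def by (simp add: abs_mult)
  also have "\<dots> \<le> 32 / (4 * v^2)"
    using n t assms by (intro frac_le) (auto intro!: power_mono)
  finally have "\<bar>diff 2 t / 2 * a^2\<bar> \<le> 4 / v^2 * a^2"
    unfolding abs_mult by (intro mult_mono) auto
  moreover have "barrier (v + a) x - barrier v x - a * barrier_xx v x / 2 = diff 2 t / 2 * a^2"
    unfolding t by (simp add: diff_def eval_nat_numeral)
  ultimately show ?thesis by simp
qed simp

text \<open>
  The joint expansion in space and time. By the heat equation the first-order term in time has the
  same coefficient as the second-order term in space, so the two combine to \<open>d\<^sup>2 - a\<close>: a centred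
  step of variance \<open>a\<close> leaves the expectation unchanged up to the error on the right. The constant
  depends on a positive lower bound \<open>e\<close> for the remaining variance.
\<close>

definition taylor_constant :: "real \<Rightarrow> real \<Rightarrow> bool" where
  "taylor_constant e C \<longleftrightarrow> 0 \<le> C \<and> (\<forall>v a x d. e \<le> v \<longrightarrow> 0 \<le> a \<longrightarrow>
    \<bar>barrier v (x + d) - barrier (v + a) x - barrier_x v x * d - barrier_xx v x * (d^2 - a) / 2\<bar>
      \<le> C * (\<bar>d\<bar>^3 + a^2))"

lemma taylor_constantD:
  assumes "taylor_constant e C"
  shows "0 \<le> C" "e \<le> v \<Longrightarrow> 0 \<le> a \<Longrightarrow>
    \<bar>barrier v (x + d) - barrier (v + a) x - barrier_x v x * d - barrier_xx v x * (d^2 - a) / 2\<bar>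
      \<le> C * (\<bar>d\<bar>^3 + a^2)"
  using assms unfolding taylor_constant_def by blast+

lemma barrier_Taylor:
  assumes "e > 0"
  shows "\<exists>C. taylor_constant e C"
  unfolding taylor_constant_def
proof (intro exI conjI allI impI)
  let ?C = "1 / sqrt e ^ 3 + 4 / e^2"
  show "?C \<ge> 0" using assms by simp
  fix v a x d :: real assume v: "v \<ge> e" and a: "a \<ge> 0"
  have v0: "v > 0" using v assms by simp
  have s: "\<bar>d\<bar>^3 / sqrt v ^ 3 \<le> 1 / sqrt e ^ 3 * \<bar>d\<bar>^3"
    using v assms by (simp, intro divide_left_mono power_mono) auto
  have t: "4 * a^2 / v^2 \<le> 4 / e^2 * a^2"
    using v assms by (simp, intro divide_left_mono power_mono) auto
  have "\<bar>barrier v (x + d) - barrier (v + a) x - barrier_x v x * d - barrier_xx v x * (d^2 - a) / 2\<bar>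
    \<le> \<bar>d\<bar>^3 / sqrt v ^ 3 + 4 * a^2 / v^2"
    using barrier_space_Taylor[OF v0, of x d] barrier_time_Taylor[OF v0 a, of x]
    by (simp add: right_diff_distrib diff_divide_distrib mult.commute abs_le_iff)
  also have "\<dots> \<le> 1 / sqrt e ^ 3 * \<bar>d\<bar>^3 + 4 / e^2 * a^2" using s t by simp
  also have "\<dots> \<le> ?C * (\<bar>d\<bar>^3 + a^2)"
    using assms by (simp add: algebra_simps)
  finally show "\<bar>barrier v (x + d) - barrier (v + a) x - barrier_x v x * d - barrier_xx v x * (d^2 - a) / 2\<bar>
      \<le> ?C * (\<bar>d\<bar>^3 + a^2)" .
qed

section \<open>One step of a walk below the barrier\<close>

text \<open>
  Conditional moments of an increment \<open>D\<close> given \<open>G\<close> are expressed by testing against bounded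
  \<open>G\<close>-measurable weights. In this form they can be read off from independence and are stable
  under mean square limits.
\<close>

definition martingale_diff :: "'a measure \<Rightarrow> 'a measure \<Rightarrow> ('a \<Rightarrow> real) \<Rightarrow> bool" where
  "martingale_diff M G D \<longleftrightarrow> D \<in> borel_measurable M \<and> integrable M (\<lambda>x. D x ^ 4) \<and>
    (\<forall>Z K. Z \<in> borel_measurable G \<longrightarrow> (\<forall>x\<in>space M. \<bar>Z x\<bar> \<le> K) \<longrightarrow> (\<integral>x. Z x * D x \<partial>M) = 0)"

definition var_ge :: "'a measure \<Rightarrow> 'a measure \<Rightarrow> ('a \<Rightarrow> real) \<Rightarrow> real \<Rightarrow> bool" where
  "var_ge M G D a \<longleftrightarrow> (\<forall>Z K. Z \<in> borel_measurable G \<longrightarrow> (\<forall>x\<in>space M. 0 \<le> Z x \<and> Z x \<le> K) \<longrightarrow>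
    a * (\<integral>x. Z x \<partial>M) \<le> (\<integral>x. Z x * (D x)^2 \<partial>M))"

definition var_le :: "'a measure \<Rightarrow> 'a measure \<Rightarrow> ('a \<Rightarrow> real) \<Rightarrow> real \<Rightarrow> bool" where
  "var_le M G D a \<longleftrightarrow> (\<forall>Z K. Z \<in> borel_measurable G \<longrightarrow> (\<forall>x\<in>space M. 0 \<le> Z x \<and> Z x \<le> K) \<longrightarrow>
    (\<integral>x. Z x * (D x)^2 \<partial>M) \<le> a * (\<integral>x. Z x \<partial>M))"

lemma (in prob_space) integrable_powers_of_fourth:
  fixes D :: "'a \<Rightarrow> real"
  assumes [measurable]: "D \<in> borel_measurable M" and 4: "integrable M (\<lambda>x. D x ^ 4)"
  shows "integrable M D" "integrable M (\<lambda>x. (D x)^2)" "integrable M (\<lambda>x. \<bar>D x\<bar>^3)"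
    "integrable M (\<lambda>x. (D x)^3)"
proof -
  have int: "integrable M (\<lambda>x. 1 + D x ^ 4)" using 4 by simp
  have b: "\<bar>D x\<bar>^k \<le> 1 + D x ^ 4" if "k \<le> 4" for k x
  proof (cases "\<bar>D x\<bar> \<le> 1")
    case True
    then have "\<bar>D x\<bar>^k \<le> 1" by (simp add: power_le_one)
    moreover have "D x ^ 4 \<ge> 0" by simp
    ultimately show ?thesis by linarith
  next
    case False
    then have "\<bar>D x\<bar>^k \<le> \<bar>D x\<bar>^4" using that by (intro power_increasing) auto
    then show ?thesis by simp
  qed
  show "integrable M D" "integrable M (\<lambda>x. (D x)^2)" "integrable M (\<lambda>x. \<bar>D x\<bar>^3)"
    "integrable M (\<lambda>x. (D x)^3)"
    by (rule Bochner_Integration.integrable_bound[OF int];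
        use b[of 1] b[of 2] b[of 3] in \<open>simp add: power_abs\<close>)+
qed

lemma (in prob_space) integrable_bounded_mult:
  fixes Z X :: "'a \<Rightarrow> real"
  assumes "integrable M X" "Z \<in> borel_measurable M" "\<And>x. x \<in> space M \<Longrightarrow> \<bar>Z x\<bar> \<le> K"
  shows "integrable M (\<lambda>x. Z x * X x)"
proof (rule Bochner_Integration.integrable_bound)
  show "integrable M (\<lambda>x. K * X x)" using assms(1) by simp
  show "(\<lambda>x. Z x * X x) \<in> borel_measurable M" using assms by measurable
  show "AE x in M. norm (Z x * X x) \<le> norm (K * X x)"
    using assms(3) by (intro AE_I2) (auto simp: abs_mult intro!: mult_right_mono intro: order_trans[OF _ abs_ge_self])
qed

lemma (in prob_space) integrable_bounded:
  fixes Z :: "'a \<Rightarrow> real"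
  assumes "Z \<in> borel_measurable M" "\<And>x. x \<in> space M \<Longrightarrow> \<bar>Z x\<bar> \<le> K"
  shows "integrable M Z"
  using integrable_bounded_mult[of "\<lambda>_. 1" Z K] assms by simp

text \<open>
  One time step: \<open>X\<close> is the current position relative to the barrier, \<open>D\<close> the next increment, \<open>J\<close> the
  indicator of survival so far, and the remaining variance falls from \<open>v + a\<close> to \<open>v\<close>.
\<close>

locale step = prob_space M for M :: "'a measure" +
  fixes G :: "'a measure" and X D J :: "'a \<Rightarrow> real" and e v a C :: real
  assumes sub: "subalgebra M G"
    and X: "X \<in> borel_measurable G"
    and J: "J \<in> borel_measurable G"
    and J01: "\<And>x. x \<in> space M \<Longrightarrow> 0 \<le> J x \<and> J x \<le> 1"
    and XJ: "\<And>x. x \<in> space M \<Longrightarrow> J x \<noteq> 0 \<Longrightarrow> X x \<le> 0"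
    and D: "martingale_diff M G D"
    and e: "0 < e" "e \<le> v" and a: "0 \<le> a"
    and C: "taylor_constant e C"
begin

definition err :: real where "err = C * ((\<integral>x. \<bar>D x\<bar>^3 \<partial>M) + a^2)"

lemma meas [measurable]:
  "X \<in> borel_measurable M" "J \<in> borel_measurable M" "D \<in> borel_measurable M"
  using X J sub D by (auto simp: martingale_diff_def intro: measurable_from_subalg)

text \<open>
  The linear term of the expansion integrates to zero because \<open>D\<close> is centred. What remains is
  the curvature term, and everything else goes into \<open>err\<close>.
\<close>

lemma step_estimate:
  "\<bar>(\<integral>x. J x * barrier v (X x + D x) \<partial>M) - (\<integral>x. J x * barrier (v + a) (X x) \<partial>M)
     - ((\<integral>x. J x * barrier_xx v (X x) * (D x)^2 \<partial>M) - a * (\<integral>x. J x * barrier_xx v (X x) \<partial>M)) / 2\<bar> \<le> err"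
proof -
  have v: "v > 0" using e by simp
  have J1: "\<bar>J x\<bar> \<le> 1" if "x \<in> space M" for x using J01[OF that] by auto
  have D4: "integrable M (\<lambda>x. D x ^ 4)" using D by (simp add: martingale_diff_def)
  note Dint = integrable_powers_of_fourth[OF _ D4]
  have bx: "\<bar>J x * barrier_x v (X x)\<bar> \<le> 1 / sqrt v" if "x \<in> space M" for x
    using mult_mono[OF J1[OF that] barrier_x_bounded[OF v, of "X x"]] by (simp add: abs_mult)
  have bxx: "\<bar>J x * barrier_xx v (X x)\<bar> \<le> 3 / v" if "x \<in> space M" for x
    using mult_mono[OF J1[OF that] barrier_xx_bounded[OF v, of "X x"]] by (simp add: abs_mult)
  have b: "\<bar>J x * barrier w y\<bar> \<le> 1" if "x \<in> space M" for x w y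
    using mult_mono[OF J1[OF that] barrier_abs_le[of w y]] by (simp add: abs_mult)
  have z: "(\<integral>x. J x * barrier_x v (X x) * D x \<partial>M) = 0"
  proof -
    have "(\<lambda>x. J x * barrier_x v (X x)) \<in> borel_measurable G"
      using X J by measurable
    then show ?thesis using D bx unfolding martingale_diff_def by blast
  qed
  have i1: "integrable M (\<lambda>x. J x * barrier v (X x + D x))"
    by (rule integrable_bounded[where K=1]) (measurable, rule b)
  have i2: "integrable M (\<lambda>x. J x * barrier (v + a) (X x))"
    by (rule integrable_bounded[where K=1]) (measurable, rule b)
  have i3: "integrable M (\<lambda>x. J x * barrier_x v (X x) * D x)"
    by (rule integrable_bounded_mult[OF Dint(1)]) (simp, measurable, rule bx)
  have i4: "integrable M (\<lambda>x. J x * barrier_xx v (X x) * (D x)^2)"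
    by (rule integrable_bounded_mult[OF Dint(2)]) (simp, measurable, rule bxx)
  have i5: "integrable M (\<lambda>x. J x * barrier_xx v (X x))"
    by (rule integrable_bounded[where K="3/v"]) (measurable, rule bxx)
  have i6: "integrable M (\<lambda>x. C * (\<bar>D x\<bar>^3 + a^2))" using Dint(3) by simp
  have lin: "(\<integral>x. f1 x - f2 x - f3 x - (f4 x - a * f5 x) / 2 \<partial>M)
      = (\<integral>x. f1 x \<partial>M) - (\<integral>x. f2 x \<partial>M) - (\<integral>x. f3 x \<partial>M) - ((\<integral>x. f4 x \<partial>M) - a * (\<integral>x. f5 x \<partial>M)) / 2"
    if "integrable M f1" "integrable M f2" "integrable M f3" "integrable M f4" "integrable M f5"
    for f1 f2 f3 f4 f5 :: "'a \<Rightarrow> real"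
    using that by simp
  let ?f = "\<lambda>x. J x * barrier v (X x + D x) - J x * barrier (v + a) (X x) - J x * barrier_x v (X x) * D x
      - (J x * barrier_xx v (X x) * (D x)^2 - a * (J x * barrier_xx v (X x))) / 2"
  have "(\<integral>x. J x * barrier v (X x + D x) \<partial>M) - (\<integral>x. J x * barrier (v + a) (X x) \<partial>M)
     - ((\<integral>x. J x * barrier_xx v (X x) * (D x)^2 \<partial>M) - a * (\<integral>x. J x * barrier_xx v (X x) \<partial>M)) / 2
    = (\<integral>x. ?f x \<partial>M)" (is "?lhs = _")
    by (simp only: lin[OF i1 i2 i3 i4 i5] z diff_0_right)
  moreover have "\<bar>\<integral>x. ?f x \<partial>M\<bar> \<le> (\<integral>x. C * (\<bar>D x\<bar>^3 + a^2) \<partial>M)"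
  proof (rule integral_abs_bound[THEN order_trans], rule integral_mono)
    fix x assume x: "x \<in> space M"
    let ?g = "barrier v (X x + D x) - barrier (v + a) (X x) - barrier_x v (X x) * D x
        - barrier_xx v (X x) * ((D x)^2 - a) / 2"
    have "?f x = J x * ?g" by (simp add: algebra_simps)
    then have "\<bar>?f x\<bar> = \<bar>J x\<bar> * \<bar>?g\<bar>" by (simp only: abs_mult)
    also have "\<dots> \<le> 1 * \<bar>?g\<bar>" by (rule mult_right_mono[OF J1[OF x]]) simp
    also have "\<dots> \<le> C * (\<bar>D x\<bar>^3 + a^2)"
      unfolding mult_1 by (rule taylor_constantD(2)[OF C e(2) a])
    finally show "\<bar>?f x\<bar> \<le> C * (\<bar>D x\<bar>^3 + a^2)" .
  next
    show "integrable M (\<lambda>x. \<bar>?f x\<bar>)"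
      using i1 i2 i3 i4 i5 by (intro Bochner_Integration.integrable_abs Bochner_Integration.integrable_diff
          integrable_divide integrable_mult_right)
  qed (rule i6)
  moreover have "(\<integral>x. C * (\<bar>D x\<bar>^3 + a^2) \<partial>M) = err"
    using Dint(3) by (simp add: err_def prob_space)
  ultimately show ?thesis by (simp only:)
qed

text \<open>
  Survival means \<open>X \<le> 0\<close>, where the profile is concave. So minus the curvature is an admissible
  nonnegative weight for \<open>var_ge\<close> and \<open>var_le\<close>.
\<close>

lemma minus_curvature:
  "(\<lambda>x. - (J x * barrier_xx v (X x))) \<in> borel_measurable G"
  "\<forall>x\<in>space M. 0 \<le> - (J x * barrier_xx v (X x)) \<and> - (J x * barrier_xx v (X x)) \<le> 3 / v"
proof -
  show "(\<lambda>x. - (J x * barrier_xx v (X x))) \<in> borel_measurable G" using X J by measurable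
  show "\<forall>x\<in>space M. 0 \<le> - (J x * barrier_xx v (X x)) \<and> - (J x * barrier_xx v (X x)) \<le> 3 / v"
  proof
    fix x assume x: "x \<in> space M"
    have v: "v > 0" using e by simp
    have "J x * barrier_xx v (X x) \<le> 0"
      using J01[OF x] XJ[OF x] barrier_xx_nonpos[OF v, of "X x"]
      by (cases "J x = 0") (auto intro: mult_nonneg_nonpos)
    moreover have "\<bar>J x * barrier_xx v (X x)\<bar> \<le> 1 * (3 / v)"
      unfolding abs_mult using J01[OF x] barrier_xx_bounded[OF v, of "X x"] by (intro mult_mono) auto
    ultimately show "0 \<le> - (J x * barrier_xx v (X x)) \<and> - (J x * barrier_xx v (X x)) \<le> 3 / v"
      by auto
  qed
qed

lemma step_upper:
  assumes "var_ge M G D a"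
  shows "(\<integral>x. J x * barrier v (X x + D x) \<partial>M) \<le> (\<integral>x. J x * barrier (v + a) (X x) \<partial>M) + err"
proof -
  have "a * (\<integral>x. - (J x * barrier_xx v (X x)) \<partial>M) \<le> (\<integral>x. - (J x * barrier_xx v (X x)) * (D x)^2 \<partial>M)"
    using assms minus_curvature unfolding var_ge_def by blast
  then show ?thesis using step_estimate unfolding abs_le_iff by (simp add: field_simps)
qed

lemma step_lower:
  assumes "var_le M G D a"
  shows "(\<integral>x. J x * barrier (v + a) (X x) \<partial>M) \<le> (\<integral>x. J x * barrier v (X x + D x) \<partial>M) + err"
proof -
  have "(\<integral>x. - (J x * barrier_xx v (X x)) * (D x)^2 \<partial>M) \<le> a * (\<integral>x. - (J x * barrier_xx v (X x)) \<partial>M)"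
    using assms minus_curvature unfolding var_le_def by blast
  then show ?thesis using step_estimate unfolding abs_le_iff by (simp add: field_simps)
qed

end

section \<open>Survival of a discrete walk\<close>

text \<open>
  A walk \<open>R\<close> together with a clock: \<open>v k\<close> is the variance that remains after \<open>k\<close> steps.
\<close>

locale discrete_walk = prob_space M for M :: "'a measure" +
  fixes F :: "nat \<Rightarrow> 'a measure" and R :: "nat \<Rightarrow> 'a \<Rightarrow> real" and n :: nat and r :: real
    and v :: "nat \<Rightarrow> real" and e C :: real
  assumes sub: "\<And>k. k \<le> n \<Longrightarrow> subalgebra M (F k)"
    and filt: "\<And>k. k < n \<Longrightarrow> subalgebra (F (Suc k)) (F k)"
    and R: "\<And>k. k \<le> n \<Longrightarrow> R k \<in> borel_measurable (F k)"
    and D: "\<And>k. k < n \<Longrightarrow> martingale_diff M (F k) (\<lambda>x. R (Suc k) x - R k x)"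
    and R0: "AE x in M. R 0 x = r"
    and v: "0 < e" "\<And>k. k \<le> n \<Longrightarrow> e \<le> v k" "\<And>k. k < n \<Longrightarrow> v (Suc k) \<le> v k"
    and C: "taylor_constant e C"
begin

definition J :: "real \<Rightarrow> nat \<Rightarrow> 'a \<Rightarrow> real" where
  "J b k x = (if \<forall>j\<le>k. R j x \<le> b then 1 else 0)"

lemma J_Suc: "J b (Suc k) x = J b k x * (if R (Suc k) x \<le> b then 1 else 0)"
  by (auto simp: J_def le_Suc_eq)

lemma J_measurable: "k \<le> n \<Longrightarrow> J b k \<in> borel_measurable (F k)"
proof (induction k)
  case 0
  have "J b 0 = (\<lambda>x. if R 0 x \<le> b then 1 else 0)" by (auto simp: J_def)
  then show ?case using R[of 0] by simp
next
  case (Suc k)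
  have [measurable]: "J b k \<in> borel_measurable (F (Suc k))" "R (Suc k) \<in> borel_measurable (F (Suc k))"
    using Suc filt[of k] R[of "Suc k"] by (auto intro: measurable_from_subalg)
  show ?case unfolding J_Suc[abs_def] by measurable
qed

definition err :: "nat \<Rightarrow> real" where
  "err k = C * ((\<integral>x. \<bar>R (Suc k) x - R k x\<bar>^3 \<partial>M) + (v k - v (Suc k))^2)"

lemma step:
  assumes k: "k < n" and bc: "b \<le> c"
  shows "step M (F k) (\<lambda>x. R k x - c) (\<lambda>x. R (Suc k) x - R k x) (J b k) e (v (Suc k)) (v k - v (Suc k)) C"
proof unfold_locales
  show "subalgebra M (F k)" using sub k by simp
  show "(\<lambda>x. R k x - c) \<in> borel_measurable (F k)" using R[of k] k by simp
  show "J b k \<in> borel_measurable (F k)" using J_measurable k by simp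
  show "\<And>x. 0 \<le> J b k x \<and> J b k x \<le> 1" by (simp add: J_def)
  show "\<And>x. J b k x \<noteq> 0 \<Longrightarrow> R k x - c \<le> 0" using bc by (force simp: J_def split: if_splits)
  show "martingale_diff M (F k) (\<lambda>x. R (Suc k) x - R k x)" using D k by simp
  show "0 < e" by (rule v(1))
  show "e \<le> v (Suc k)" using v(2) k by simp
  show "0 \<le> v k - v (Suc k)" using v(3)[OF k] by simp
qed (rule C)

lemma meas:
  assumes "k \<le> n"
  shows "R k \<in> borel_measurable M" "J b k \<in> borel_measurable M"
  using sub[OF assms] R[OF assms] J_measurable[OF assms] by (auto intro: measurable_from_subalg)

lemma integrable_J_barrier:
  assumes "j \<le> n" "k \<le> n"
  shows "integrable M (\<lambda>x. J b j x * barrier w (R k x - c))"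
proof -
  note [measurable] = meas[OF assms(1)] meas[OF assms(2)]
  show ?thesis
  proof (rule integrable_bounded[where K=1])
    show "\<bar>J b j x * barrier w (R k x - c)\<bar> \<le> 1" for x
      using barrier_abs_le[of w "R k x - c"] by (simp add: J_def)
  qed measurable
qed

lemma integrable_J: "integrable M (J b n)"
proof (rule integrable_bounded[where K=1])
  show "J b n \<in> borel_measurable M" by (rule meas) simp
  show "\<bar>J b n x\<bar> \<le> 1" for x by (simp add: J_def)
qed

lemma J_integral:
  assumes k: "k \<le> n"
  shows "(\<integral>x. J b k x \<partial>M) = prob {x \<in> space M. \<forall>j\<le>k. R j x \<le> b}"
proof -
  let ?S = "{x \<in> space M. \<forall>j\<le>k. R j x \<le> b}"
  have "(\<integral>x. J b k x \<partial>M) = (\<integral>x. indicator ?S x \<partial>M)"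
  proof (rule Bochner_Integration.integral_cong[OF refl])
    fix x assume "x \<in> space M"
    then show "J b k x = indicator ?S x"
      by (cases "\<forall>j\<le>k. R j x \<le> b") (simp_all add: J_def)
  qed
  also have "\<dots> = prob (?S \<inter> space M)" by (rule Bochner_Integration.integral_indicator)
  also have "?S \<inter> space M = ?S" by blast
  finally show ?thesis .
qed

lemma J_initial: "r \<le> b \<Longrightarrow> (\<integral>x. J b 0 x * barrier w (R 0 x - c) \<partial>M) = barrier w (r - c)"
proof -
  assume "r \<le> b"
  note [measurable] = meas[of 0, simplified]
  have "(\<integral>x. J b 0 x * barrier w (R 0 x - c) \<partial>M) = (\<integral>x. barrier w (r - c) \<partial>M)"
  proof (rule integral_cong_AE)
    show "AE x in M. J b 0 x * barrier w (R 0 x - c) = barrier w (r - c)"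
      using R0 by eventually_elim (use \<open>r \<le> b\<close> in \<open>simp add: J_def\<close>)
  qed measurable
  then show ?thesis by (simp add: prob_space)
qed

text \<open>
  The walk is killed when it exceeds \<open>0\<close>, but the profile vanishes only at level \<open>\<delta>\<close>. A killed walk
  that landed between \<open>0\<close> and \<open>\<delta>\<close> had a nonnegative profile, so discarding it lowers the
  expectation. It landed above \<open>\<delta>\<close> only by a step longer than \<open>\<delta>\<close>, and the indicator of such a
  step is at most \<open>D\<^sup>4 / \<delta>\<^sup>4\<close>. At the end the profile of a surviving walk is at least its value
  at \<open>- \<delta>\<close>.
\<close>

lemma survival_upper:
  assumes ge: "\<And>k. k < n \<Longrightarrow> var_ge M (F k) (\<lambda>x. R (Suc k) x - R k x) (v k - v (Suc k))"
    and "r \<le> 0" "\<delta> > 0"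
  shows "barrier (v n) (- \<delta>) * prob {x \<in> space M. \<forall>j\<le>n. R j x \<le> 0}
    \<le> barrier (v 0) (r - \<delta>) + (\<Sum>k<n. err k + (\<integral>x. (R (Suc k) x - R k x)^4 \<partial>M) / \<delta>^4)"
proof -
  have "(\<integral>x. J 0 k x * barrier (v k) (R k x - \<delta>) \<partial>M)
    \<le> barrier (v 0) (r - \<delta>) + (\<Sum>i<k. err i + (\<integral>x. (R (Suc i) x - R i x)^4 \<partial>M) / \<delta>^4)" if "k \<le> n" for k
    using that
  proof (induction k)
    case 0
    then show ?case using J_initial[of 0 "v 0" \<delta>] assms by simp
  next
    case (Suc k)
    then have k: "k < n" "k \<le> n" "Suc k \<le> n" by auto
    let ?D = "\<lambda>x. R (Suc k) x - R k x"
    interpret s: step M "F k" "\<lambda>x. R k x - \<delta>" ?D "J 0 k" e "v (Suc k)" "v k - v (Suc k)" C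
      by (rule step) (use k assms in auto)
    have D4: "integrable M (\<lambda>x. ?D x ^ 4)" using D[OF k(1)] by (simp add: martingale_diff_def)
    have "(\<integral>x. J 0 (Suc k) x * barrier (v (Suc k)) (R (Suc k) x - \<delta>) \<partial>M)
      \<le> (\<integral>x. J 0 k x * barrier (v (Suc k)) (R (Suc k) x - \<delta>) + ?D x^4 / \<delta>^4 \<partial>M)"
    proof (rule integral_mono)
      fix x assume "x \<in> space M"
      have vp: "v (Suc k) > 0" using v(1) v(2)[of "Suc k"] k by simp
      have D0: "0 \<le> ?D x^4 / \<delta>^4" by simp
      show "J 0 (Suc k) x * barrier (v (Suc k)) (R (Suc k) x - \<delta>)
        \<le> J 0 k x * barrier (v (Suc k)) (R (Suc k) x - \<delta>) + ?D x^4 / \<delta>^4"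
      proof (cases "J 0 k x = 1 \<and> R (Suc k) x > 0")
        case False
        have "J 0 k x = 0 \<or> J 0 k x = 1" by (simp add: J_def)
        then show ?thesis using D0 False by (elim disjE) (simp_all add: J_Suc)
      next
        case True
        have "0 \<le> barrier (v (Suc k)) (R (Suc k) x - \<delta>) + ?D x^4 / \<delta>^4"
        proof (cases "R (Suc k) x \<le> \<delta>")
          case True
          then show ?thesis using barrier_nonneg[OF vp, of "R (Suc k) x - \<delta>"] D0 by simp
        next
          case False
          have "R k x \<le> 0" using True by (auto simp: J_def split: if_splits)
          then have "\<delta>^4 \<le> ?D x^4" using False assms by (intro power_mono) auto
          then have "1 \<le> ?D x^4 / \<delta>^4" using assms by simp
          then show ?thesis
            using barrier_abs_le[of "v (Suc k)" "R (Suc k) x - \<delta>"] by linarith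
        qed
        then show ?thesis using True by (simp add: J_Suc)
      qed
    qed (use k D4 in \<open>auto intro!: integrable_J_barrier\<close>)
    also have "\<dots> = (\<integral>x. J 0 k x * barrier (v (Suc k)) (R (Suc k) x - \<delta>) \<partial>M) + (\<integral>x. ?D x^4 \<partial>M) / \<delta>^4"
      using k D4 by (subst Bochner_Integration.integral_add) (auto intro!: integrable_J_barrier)
    also have "(\<integral>x. J 0 k x * barrier (v (Suc k)) (R (Suc k) x - \<delta>) \<partial>M)
      \<le> (\<integral>x. J 0 k x * barrier (v k) (R k x - \<delta>) \<partial>M) + err k"
      using s.step_upper[OF ge[OF k(1)]] by (simp add: s.err_def err_def algebra_simps)
    finally show ?case using Suc.IH k by simp
  qed
  from this[of n] have *: "(\<integral>x. J 0 n x * barrier (v n) (R n x - \<delta>) \<partial>M)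
    \<le> barrier (v 0) (r - \<delta>) + (\<Sum>i<n. err i + (\<integral>x. (R (Suc i) x - R i x)^4 \<partial>M) / \<delta>^4)" by simp
  have vp: "v n > 0" using v(1) v(2)[of n] by simp
  note [measurable] = meas[of n]
  have "barrier (v n) (- \<delta>) * prob {x \<in> space M. \<forall>j\<le>n. R j x \<le> 0} = (\<integral>x. J 0 n x * barrier (v n) (- \<delta>) \<partial>M)"
    by (simp add: J_integral)
  also have "\<dots> \<le> (\<integral>x. J 0 n x * barrier (v n) (R n x - \<delta>) \<partial>M)"
  proof (rule integral_mono)
    show "integrable M (\<lambda>x. J 0 n x * barrier (v n) (- \<delta>))"
      using integrable_J by simp
    show "J 0 n x * barrier (v n) (- \<delta>) \<le> J 0 n x * barrier (v n) (R n x - \<delta>)" for x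
      using barrier_antimono[OF vp, of "R n x - \<delta>" "- \<delta>"] by (auto simp: J_def)
  qed (auto intro!: integrable_J_barrier)
  finally show ?thesis using * by simp
qed

text \<open>
  Here the walk is killed at the level \<open>\<delta>\<close> where the profile vanishes. The profile is not positive
  at a killed walk, so discarding it raises the expectation.
\<close>

lemma survival_lower:
  assumes le: "\<And>k. k < n \<Longrightarrow> var_le M (F k) (\<lambda>x. R (Suc k) x - R k x) (v k - v (Suc k))"
    and "r \<le> 0" "\<delta> > 0"
  shows "barrier (v 0) (r - \<delta>) \<le> Phi 0 * prob {x \<in> space M. \<forall>j\<le>n. R j x \<le> \<delta>} + (\<Sum>k<n. err k)"
proof -
  have "barrier (v 0) (r - \<delta>) \<le> (\<integral>x. J \<delta> k x * barrier (v k) (R k x - \<delta>) \<partial>M) + (\<Sum>i<k. err i)" if "k \<le> n" for k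
    using that
  proof (induction k)
    case 0
    then show ?case using J_initial[of \<delta> "v 0" \<delta>] assms by simp
  next
    case (Suc k)
    then have k: "k < n" "k \<le> n" "Suc k \<le> n" by auto
    let ?D = "\<lambda>x. R (Suc k) x - R k x"
    interpret s: step M "F k" "\<lambda>x. R k x - \<delta>" ?D "J \<delta> k" e "v (Suc k)" "v k - v (Suc k)" C
      by (rule step) (use k assms in auto)
    have vp: "v (Suc k) > 0" using v(1) v(2)[of "Suc k"] k by simp
    have "(\<integral>x. J \<delta> k x * barrier (v (Suc k)) (R (Suc k) x - \<delta>) \<partial>M)
      \<le> (\<integral>x. J \<delta> (Suc k) x * barrier (v (Suc k)) (R (Suc k) x - \<delta>) \<partial>M)"
    proof (intro integral_mono integrable_J_barrier)
      fix x
      have "J \<delta> k x = 0 \<or> J \<delta> k x = 1" by (simp add: J_def)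
      then show "J \<delta> k x * barrier (v (Suc k)) (R (Suc k) x - \<delta>)
        \<le> J \<delta> (Suc k) x * barrier (v (Suc k)) (R (Suc k) x - \<delta>)"
        using barrier_nonpos[OF vp, of "R (Suc k) x - \<delta>"] by (elim disjE) (simp_all add: J_Suc)
    qed (use k in auto)
    moreover have "(\<integral>x. J \<delta> k x * barrier (v k) (R k x - \<delta>) \<partial>M)
      \<le> (\<integral>x. J \<delta> k x * barrier (v (Suc k)) (R (Suc k) x - \<delta>) \<partial>M) + err k"
      using s.step_lower[OF le[OF k(1)]] by (simp add: s.err_def err_def algebra_simps)
    ultimately show ?case using Suc.IH k by simp
  qed
  from this[of n] have *: "barrier (v 0) (r - \<delta>)
    \<le> (\<integral>x. J \<delta> n x * barrier (v n) (R n x - \<delta>) \<partial>M) + (\<Sum>i<n. err i)" by simp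
  note [measurable] = meas[of n]
  have "(\<integral>x. J \<delta> n x * barrier (v n) (R n x - \<delta>) \<partial>M) \<le> (\<integral>x. J \<delta> n x * Phi 0 \<partial>M)"
  proof (rule integral_mono)
    show "integrable M (\<lambda>x. J \<delta> n x * Phi 0)"
      using integrable_J by simp
    show "J \<delta> n x * barrier (v n) (R n x - \<delta>) \<le> J \<delta> n x * Phi 0" for x
      using barrier_le by (auto simp: J_def)
  qed (auto intro!: integrable_J_barrier)
  then show ?thesis using * by (simp add: J_integral mult.commute)
qed

end

section \<open>Survival in continuous time\<close>

lemma martingale_diff_cong_AE:
  assumes "martingale_diff M G D" "AE x in M. D x = D' x" "D' \<in> borel_measurable M" "subalgebra M G"
  shows "martingale_diff M G D'"
proof -
  have D [measurable]: "D \<in> borel_measurable M" "integrable M (\<lambda>x. D x ^ 4)"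
    using assms(1) by (auto simp: martingale_diff_def)
  note [measurable] = assms(3)
  have "integrable M (\<lambda>x. D' x ^ 4)"
    using D(2) by (rule integrable_cong_AE_imp) (measurable, use assms(2) in auto)
  moreover have "(\<integral>x. Z x * D' x \<partial>M) = 0"
    if "Z \<in> borel_measurable G" "\<forall>x\<in>space M. \<bar>Z x\<bar> \<le> K" for Z and K :: real
  proof -
    have [measurable]: "Z \<in> borel_measurable M"
      by (rule measurable_from_subalg[OF assms(4) that(1)])
    have "(\<integral>x. Z x * D' x \<partial>M) = (\<integral>x. Z x * D x \<partial>M)"
      by (rule integral_cong_AE) (measurable, use assms(2) in auto)
    also have "\<dots> = 0" using assms(1) that unfolding martingale_diff_def by blast
    finally show ?thesis .
  qed
  ultimately show ?thesis using assms(3) unfolding martingale_diff_def by blast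
qed

lemma integral_square_weight_cong_AE:
  fixes Z D D' :: "'a \<Rightarrow> real"
  assumes "AE x in M. D x = D' x" "D \<in> borel_measurable M" "D' \<in> borel_measurable M"
    "subalgebra M G" "Z \<in> borel_measurable G"
  shows "(\<integral>x. Z x * (D' x)^2 \<partial>M) = (\<integral>x. Z x * (D x)^2 \<partial>M)"
proof -
  note [measurable] = assms(2,3) measurable_from_subalg[OF assms(4,5)]
  show ?thesis by (rule integral_cong_AE) (measurable, use assms(1) in auto)
qed

lemma var_ge_cong_AE:
  assumes "var_ge M G D a" "AE x in M. D x = D' x" "D \<in> borel_measurable M" "D' \<in> borel_measurable M"
    "subalgebra M G"
  shows "var_ge M G D' a"
  using assms(1) integral_square_weight_cong_AE[OF assms(2-5)] by (simp add: var_ge_def)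

lemma var_le_cong_AE:
  assumes "var_le M G D a" "AE x in M. D x = D' x" "D \<in> borel_measurable M" "D' \<in> borel_measurable M"
    "subalgebra M G"
  shows "var_le M G D' a"
  using assms(1) integral_square_weight_cong_AE[OF assms(2-5)] by (simp add: var_le_def)

text \<open>
  Third moments of the increments are controlled by second and fourth ones; the weight \<open>\<theta>\<close> will be
  the square root of the mesh of the clock.
\<close>

lemma cube_le_square_fourth:
  fixes u \<theta> :: real
  assumes "\<theta> > 0"
  shows "\<bar>u\<bar>^3 \<le> \<theta> * u^2 + u^4 / \<theta>"
proof -
  have "0 \<le> (\<theta> - \<bar>u\<bar>)^2 * u^2 / \<theta>" using assms by simp
  also have "\<dots> = \<theta> * u^2 - 2 * \<bar>u\<bar>^3 + u^4 / \<theta>"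
    using assms by (simp add: field_simps power2_eq_square power3_eq_cube power4_eq_xxxx)
  finally have "2 * \<bar>u\<bar>^3 \<le> \<theta> * u^2 + u^4 / \<theta>" by simp
  moreover have "0 \<le> \<bar>u\<bar>^3" by simp
  ultimately show ?thesis by linarith
qed

definition survives :: "'a measure \<Rightarrow> (real \<Rightarrow> 'a \<Rightarrow> real) \<Rightarrow> real \<Rightarrow> real \<Rightarrow> 'a set" where
  "survives M R b T = {x \<in> space M. \<forall>t\<in>{0..T}. R t x \<le> b}"

text \<open>
  \<open>m\<close> is a deterministic clock for the increments, in the sense that their second and fourth moments
  are of the order of its increments and of their squares. Adaptedness holds only up to null sets,
  since a continuous version of a stochastic integral need not be adapted to a filtration that
  has not been completed.
\<close>

locale quartic_martingale = prob_space M for M :: "'a measure" +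
  fixes F :: "real \<Rightarrow> 'a measure" and R :: "real \<Rightarrow> 'a \<Rightarrow> real" and r :: real
    and m :: "real \<Rightarrow> real" and K :: real
  assumes sub: "\<And>t. 0 \<le> t \<Longrightarrow> subalgebra M (F t)"
    and filt: "\<And>s t. 0 \<le> s \<Longrightarrow> s \<le> t \<Longrightarrow> subalgebra (F t) (F s)"
    and adapted: "\<And>t. 0 \<le> t \<Longrightarrow> \<exists>R'\<in>borel_measurable (F t). AE x in M. R t x = R' x"
    and meas: "\<And>t. 0 \<le> t \<Longrightarrow> R t \<in> borel_measurable M"
    and paths: "\<And>x. x \<in> space M \<Longrightarrow> continuous_on {0..} (\<lambda>t. R t x)"
    and diff: "\<And>s t. 0 \<le> s \<Longrightarrow> s \<le> t \<Longrightarrow> martingale_diff M (F s) (\<lambda>x. R t x - R s x)"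
    and second_moment: "\<And>s t. 0 \<le> s \<Longrightarrow> s \<le> t \<Longrightarrow> (\<integral>x. (R t x - R s x)^2 \<partial>M) \<le> m t - m s"
    and fourth_moment: "\<And>s t. 0 \<le> s \<Longrightarrow> s \<le> t \<Longrightarrow> (\<integral>x. (R t x - R s x)^4 \<partial>M) \<le> K * (m t - m s)^2"
    and K: "0 \<le> K" and m: "\<And>T. continuous_on {0..T} m"
    and initial: "AE x in M. R 0 x = r" and r: "r \<le> 0"
begin

text \<open>
  On a grid along which \<open>m\<close> grows by at most \<open>\<theta>\<^sup>2\<close> per step, all error terms of the discrete
  estimates are at most a constant times \<open>\<theta>\<close> times the increment of \<open>m\<close>, so that their sum is
  of order \<open>\<theta>\<close>. The discrete estimates are applied to adapted versions \<open>R' k\<close> of \<open>R (t k)\<close>.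
\<close>

lemma grid_survival_bounds:
  assumes t: "t 0 = 0" "t n = T" "\<And>k. k < n \<Longrightarrow> t k \<le> t (Suc k)"
    and \<theta>: "0 < \<theta>" "\<theta> \<le> 1" "\<And>k. k < n \<Longrightarrow> m (t (Suc k)) - m (t k) \<le> \<theta>^2"
    and A: "\<And>s t. 0 \<le> s \<Longrightarrow> s \<le> t \<Longrightarrow> 0 \<le> A t - A s \<and> A t - A s \<le> m t - m s"
    and e: "0 < e" and \<delta>: "0 < \<delta>"
    and C: "taylor_constant e C"
  shows
    "(\<And>s t. 0 \<le> s \<Longrightarrow> s \<le> t \<Longrightarrow> var_ge M (F s) (\<lambda>x. R t x - R s x) (A t - A s)) \<Longrightarrow>
      barrier e (- \<delta>) * prob {x \<in> space M. \<forall>k\<le>n. R (t k) x \<le> 0}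
        \<le> barrier (e + (A T - A 0)) (r - \<delta>) + \<theta> * ((C * (2 + K) + K / \<delta>^4) * (m T - m 0))"
    "(\<And>s t. 0 \<le> s \<Longrightarrow> s \<le> t \<Longrightarrow> var_le M (F s) (\<lambda>x. R t x - R s x) (A t - A s)) \<Longrightarrow>
      barrier (e + (A T - A 0)) (r - \<delta>)
        \<le> Phi 0 * prob {x \<in> space M. \<forall>k\<le>n. R (t k) x \<le> \<delta>} + \<theta> * ((C * (2 + K) + K / \<delta>^4) * (m T - m 0))"
proof -
  have mono: "j \<le> k \<Longrightarrow> k \<le> n \<Longrightarrow> t j \<le> t k" for j k
  proof (induction k rule: dec_induct)
    case (step k)
    then show ?case using t(3)[of k] by simp
  qed simp
  have t0: "k \<le> n \<Longrightarrow> 0 \<le> t k" for k using mono[of 0 k] t(1) by simp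
  have tk: "0 \<le> t k" "t k \<le> t (Suc k)" if "k < n" for k using t0[of k] t(3)[OF that] that by auto
  have "\<forall>k. \<exists>R'. k \<le> n \<longrightarrow> R' \<in> borel_measurable (F (t k)) \<and> (AE x in M. R (t k) x = R' x)"
    using adapted t0 by blast
  then obtain R' where R': "\<And>k. k \<le> n \<Longrightarrow> R' k \<in> borel_measurable (F (t k))"
    "\<And>k. k \<le> n \<Longrightarrow> AE x in M. R (t k) x = R' k x" by metis
  have R'M: "R' k \<in> borel_measurable M" if "k \<le> n" for k
    using measurable_from_subalg[OF sub[OF t0[OF that]] R'(1)[OF that]] .
  have RM: "R (t k) \<in> borel_measurable M" if "k \<le> n" for k
    using meas[OF t0[OF that]] .
  have AED: "AE x in M. R (t (Suc k)) x - R (t k) x = R' (Suc k) x - R' k x" if "k < n" for k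
    using R'(2)[of k] R'(2)[of "Suc k"] that by auto
  have DM: "(\<lambda>x. R (t (Suc k)) x - R (t k) x) \<in> borel_measurable M"
     "(\<lambda>x. R' (Suc k) x - R' k x) \<in> borel_measurable M" if "k < n" for k
    using RM[of k] RM[of "Suc k"] R'M[of k] R'M[of "Suc k"] that
    by (auto intro!: borel_measurable_diff)
  define v where "v k = e + (A T - A (t k))" for k
  interpret w: discrete_walk M "\<lambda>k. F (t k)" R' n r v e C
  proof unfold_locales
    show "subalgebra M (F (t k))" if "k \<le> n" for k using sub t0 that by simp
    show "subalgebra (F (t (Suc k))) (F (t k))" if "k < n" for k
      by (rule filt[OF tk[OF that]])
    show "R' k \<in> borel_measurable (F (t k))" if "k \<le> n" for k using R'(1) that .
    show "martingale_diff M (F (t k)) (\<lambda>x. R' (Suc k) x - R' k x)" if "k < n" for k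
      by (rule martingale_diff_cong_AE[OF diff[OF tk[OF that]] AED[OF that] DM(2)[OF that] sub[OF tk(1)[OF that]]])
    show "AE x in M. R' 0 x = r" using R'(2)[of 0] initial t(1) by auto
    show "e \<le> v k" if "k \<le> n" for k
      using A[of "t k" T] t0[OF that] mono[of k n] t(2) that by (simp add: v_def)
    show "v (Suc k) \<le> v k" if "k < n" for k
      using A[of "t k" "t (Suc k)"] t0[of k] t(3)[OF that] that by (simp add: v_def)
  next
    show "0 < e" by (rule e)
  qed (rule C)
  have vd: "v k - v (Suc k) = A (t (Suc k)) - A (t k)" for k by (simp add: v_def)
  have v0: "v 0 = e + (A T - A 0)" "v n = e" using t by (simp_all add: v_def)
  have bound: "w.err k \<le> \<theta> * (C * (2 + K)) * (m (t (Suc k)) - m (t k))"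
    "(\<integral>x. (R' (Suc k) x - R' k x)^4 \<partial>M) \<le> \<theta> * K * (m (t (Suc k)) - m (t k))" if k: "k < n" for k
  proof -
    define \<mu> where "\<mu> = m (t (Suc k)) - m (t k)"
    have le: "0 \<le> t k" "t k \<le> t (Suc k)" using k t0 t by auto
    have \<mu>: "0 \<le> \<mu>" "\<mu> \<le> \<theta>^2" "A (t (Suc k)) - A (t k) \<le> \<mu>" "0 \<le> A (t (Suc k)) - A (t k)"
      using A[OF le] \<theta>(3)[OF k] by (auto simp: \<mu>_def)
    have th: "\<theta>^2 \<le> \<theta>" using \<theta> by (simp add: power2_eq_square mult_left_le)
    have mm: "\<mu>^2 \<le> \<theta>^2 * \<mu>" using \<mu> by (simp add: power2_eq_square mult_right_mono)
    also have "\<dots> \<le> \<theta> * \<mu>" using th \<mu> by (simp add: mult_right_mono)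
    finally have mm': "\<mu>^2 \<le> \<theta> * \<mu>" .
    let ?D = "\<lambda>x. R (t (Suc k)) x - R (t k) x" and ?D' = "\<lambda>x. R' (Suc k) x - R' k x"
    have D4: "integrable M (\<lambda>x. ?D x ^ 4)"
      using diff[OF le] by (simp add: martingale_diff_def)
    note Dint = integrable_powers_of_fourth[OF DM(1)[OF k] D4]
    have d2: "(\<integral>x. (?D x)^2 \<partial>M) \<le> \<mu>" unfolding \<mu>_def by (rule second_moment[OF le])
    have d4: "(\<integral>x. (?D x)^4 \<partial>M) \<le> K * \<mu>^2" unfolding \<mu>_def by (rule fourth_moment[OF le])
    have e3: "(\<integral>x. \<bar>?D' x\<bar>^3 \<partial>M) = (\<integral>x. \<bar>?D x\<bar>^3 \<partial>M)"
    proof (rule integral_cong_AE)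
      show "AE x in M. \<bar>?D' x\<bar>^3 = \<bar>?D x\<bar>^3" using AED[OF k] by eventually_elim simp
    qed (intro borel_measurable_power borel_measurable_abs DM[OF k])+
    have e4: "(\<integral>x. (?D' x)^4 \<partial>M) = (\<integral>x. (?D x)^4 \<partial>M)"
    proof (rule integral_cong_AE)
      show "AE x in M. (?D' x)^4 = (?D x)^4" using AED[OF k] by eventually_elim simp
    qed (intro borel_measurable_power DM[OF k])+
    have Km: "K * \<mu>^2 \<le> \<theta> * K * \<mu>" using mult_left_mono[OF mm' K] by (simp add: mult_ac)
    show "(\<integral>x. (?D' x)^4 \<partial>M) \<le> \<theta> * K * \<mu>" using e4 d4 Km by simp
    have "(\<integral>x. \<bar>?D x\<bar>^3 \<partial>M) \<le> (\<integral>x. \<theta> * (?D x)^2 + (?D x)^4 / \<theta> \<partial>M)"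
      using Dint D4 cube_le_square_fourth[OF \<theta>(1)] by (intro integral_mono) auto
    also have "\<dots> = \<theta> * (\<integral>x. (?D x)^2 \<partial>M) + (\<integral>x. (?D x)^4 \<partial>M) / \<theta>"
      using Dint(2) D4 by simp
    also have "\<dots> \<le> \<theta> * \<mu> + K * \<mu>^2 / \<theta>"
      using d2 d4 \<theta> by (intro add_mono mult_left_mono divide_right_mono) auto
    also have "\<dots> \<le> \<theta> * \<mu> + K * (\<theta>^2 * \<mu>) / \<theta>"
      using mm K \<theta> by (intro add_mono divide_right_mono mult_left_mono) auto
    also have "\<dots> = (1 + K) * (\<theta> * \<mu>)" using \<theta> by (simp add: power2_eq_square algebra_simps)
    finally have d3: "(\<integral>x. \<bar>?D' x\<bar>^3 \<partial>M) \<le> (1 + K) * (\<theta> * \<mu>)" using e3 by simp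
    have "(A (t (Suc k)) - A (t k))^2 \<le> \<mu>^2" using \<mu> by (intro power_mono) auto
    then have a2: "(A (t (Suc k)) - A (t k))^2 \<le> \<theta> * \<mu>" using mm' by simp
    have "w.err k \<le> C * ((1 + K) * (\<theta> * \<mu>) + \<theta> * \<mu>)"
      unfolding w.err_def vd using d3 a2 taylor_constantD(1)[OF C] by (intro mult_left_mono add_mono)
    also have "\<dots> = \<theta> * (C * (2 + K)) * \<mu>" by (simp add: algebra_simps)
    finally show "w.err k \<le> \<theta> * (C * (2 + K)) * \<mu>" .
  qed
  have tele: "(\<Sum>k<n. m (t (Suc k)) - m (t k)) = m T - m 0"
    using sum_lessThan_telescope[of "\<lambda>k. m (t k)" n] t by simp
  have mT: "0 \<le> m T - m 0" using A[of 0 T] mono[of 0 n] t by simp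
  have sum1: "(\<Sum>k<n. w.err k) \<le> \<theta> * (C * (2 + K)) * (m T - m 0)"
    unfolding tele[symmetric] sum_distrib_left by (intro sum_mono bound) simp
  have sum2: "(\<Sum>k<n. (\<integral>x. (R' (Suc k) x - R' k x)^4 \<partial>M) / \<delta>^4) \<le> \<theta> * K * (m T - m 0) / \<delta>^4"
    unfolding tele[symmetric] sum_distrib_left sum_divide_distrib
    by (intro sum_mono divide_right_mono bound) (use \<delta> in auto)
  have P: "prob {x \<in> space M. \<forall>k\<le>n. R' k x \<le> b} = prob {x \<in> space M. \<forall>k\<le>n. R (t k) x \<le> b}" for b
  proof (rule measure_eq_AE)
    have "AE x in M. \<forall>k\<in>{..n}. R (t k) x = R' k x"
      using R'(2) by (subst AE_ball_countable) auto
    then show "AE x in M. (x \<in> {x \<in> space M. \<forall>k\<le>n. R' k x \<le> b}) = (x \<in> {x \<in> space M. \<forall>k\<le>n. R (t k) x \<le> b})"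
      by eventually_elim auto
    have *: "{x \<in> space M. \<forall>k\<le>n. f k x \<le> b} \<in> sets M"
      if "\<And>k. k \<le> n \<Longrightarrow> f k \<in> borel_measurable M" for f :: "nat \<Rightarrow> 'a \<Rightarrow> real"
    proof -
      have "{x \<in> space M. \<forall>k\<le>n. f k x \<le> b} = (\<Inter>k\<in>{..n}. f k -` {..b} \<inter> space M)" by auto
      also have "\<dots> \<in> sets M"
        by (rule sets.finite_INT) (auto intro!: measurable_sets[OF that])
      finally show ?thesis .
    qed
    show "{x \<in> space M. \<forall>k\<le>n. R' k x \<le> b} \<in> sets M" by (rule *[OF R'M])
    show "{x \<in> space M. \<forall>k\<le>n. R (t k) x \<le> b} \<in> sets M" by (rule *[OF RM])
  qed
  show "barrier e (- \<delta>) * prob {x \<in> space M. \<forall>k\<le>n. R (t k) x \<le> 0}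
        \<le> barrier (e + (A T - A 0)) (r - \<delta>) + \<theta> * ((C * (2 + K) + K / \<delta>^4) * (m T - m 0))"
    if ge: "\<And>s t. 0 \<le> s \<Longrightarrow> s \<le> t \<Longrightarrow> var_ge M (F s) (\<lambda>x. R t x - R s x) (A t - A s)"
  proof -
    have "var_ge M (F (t k)) (\<lambda>x. R' (Suc k) x - R' k x) (v k - v (Suc k))" if "k < n" for k
      unfolding vd
      by (rule var_ge_cong_AE[OF ge[OF tk[OF that]] AED[OF that] DM[OF that] sub[OF tk(1)[OF that]]])
    from w.survival_upper[OF this r \<delta>]
    have "barrier e (- \<delta>) * prob {x \<in> space M. \<forall>k\<le>n. R (t k) x \<le> 0}
      \<le> barrier (e + (A T - A 0)) (r - \<delta>)
        + ((\<Sum>k<n. w.err k) + (\<Sum>k<n. (\<integral>x. (R' (Suc k) x - R' k x)^4 \<partial>M) / \<delta>^4))"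
      unfolding P v0 sum.distrib .
    also have "\<dots> \<le> barrier (e + (A T - A 0)) (r - \<delta>)
        + (\<theta> * (C * (2 + K)) * (m T - m 0) + \<theta> * K * (m T - m 0) / \<delta>^4)"
      by (intro add_left_mono add_mono sum1 sum2)
    finally show ?thesis by (simp add: algebra_simps)
  qed
  show "barrier (e + (A T - A 0)) (r - \<delta>)
        \<le> Phi 0 * prob {x \<in> space M. \<forall>k\<le>n. R (t k) x \<le> \<delta>} + \<theta> * ((C * (2 + K) + K / \<delta>^4) * (m T - m 0))"
    if le: "\<And>s t. 0 \<le> s \<Longrightarrow> s \<le> t \<Longrightarrow> var_le M (F s) (\<lambda>x. R t x - R s x) (A t - A s)"
  proof -
    have "var_le M (F (t k)) (\<lambda>x. R' (Suc k) x - R' k x) (v k - v (Suc k))" if "k < n" for k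
      unfolding vd
      by (rule var_le_cong_AE[OF le[OF tk[OF that]] AED[OF that] DM[OF that] sub[OF tk(1)[OF that]]])
    from w.survival_lower[OF this r \<delta>]
    have "barrier (e + (A T - A 0)) (r - \<delta>)
      \<le> Phi 0 * prob {x \<in> space M. \<forall>k\<le>n. R (t k) x \<le> \<delta>} + (\<Sum>k<n. w.err k)"
      unfolding P v0 .
    moreover have "0 \<le> \<theta> * K * (m T - m 0) / \<delta>^4" using \<theta> K mT \<delta> by simp
    ultimately show ?thesis using sum1 by (simp add: algebra_simps)
  qed
qed

lemma fine_dyadic_grids:
  assumes "T > 0" "\<theta> > 0"
  obtains N where "\<And>j k. j \<ge> N \<Longrightarrow> k < 2^j \<Longrightarrow> m (T * real (Suc k) / 2^j) - m (T * real k / 2^j) \<le> \<theta>^2"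
proof -
  have "uniformly_continuous_on {0..T} m"
    by (rule compact_uniformly_continuous[OF m]) simp
  then obtain d where d: "d > 0" "\<And>s t. s \<in> {0..T} \<Longrightarrow> t \<in> {0..T} \<Longrightarrow> dist t s < d \<Longrightarrow> dist (m t) (m s) < \<theta>^2"
    using assms unfolding uniformly_continuous_on_def by (metis zero_less_power)
  obtain N where N: "T / d < 2^N"
    using real_arch_pow[of 2 "T / d"] by auto
  show ?thesis
  proof (rule that)
    fix j k :: nat assume j: "j \<ge> N" and k: "k < 2^j"
    have k': "real (Suc k) \<le> 2^j" using k by (metis Suc_leI of_nat_le_iff of_nat_numeral of_nat_power)
    have "(2::real)^N \<le> 2^j" using j by simp
    then have "T / d < 2^j" using N by linarith
    then have "T / 2^j < d" using d assms by (simp add: field_simps)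
    moreover have "T * real (Suc k) / 2^j - T * real k / 2^j = T / 2^j" by (simp add: field_simps)
    moreover have "T * real (Suc k) / 2^j \<le> T" "T * real k / 2^j \<le> T"
    proof -
      have le: "T * u / 2^j \<le> T" if "u \<le> 2^j" for u
        using mult_left_mono[OF that, of T] assms by (simp add: divide_le_eq)
      show "T * real (Suc k) / 2^j \<le> T" by (rule le[OF k'])
      show "T * real k / 2^j \<le> T" by (rule le) (use k' in linarith)
    qed
    ultimately have "dist (m (T * real (Suc k) / 2^j)) (m (T * real k / 2^j)) < \<theta>^2"
      using assms by (intro d(2)) (auto simp: dist_real_def)
    then show "m (T * real (Suc k) / 2^j) - m (T * real k / 2^j) \<le> \<theta>^2"
      by (simp add: dist_real_def)
  qed
qed

text \<open>
  Dyadic grids are nested, so survival on the grids decreases to survival on \<open>{0..T}\<close>.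
\<close>

definition dyadic_survives :: "real \<Rightarrow> real \<Rightarrow> nat \<Rightarrow> 'a set" where
  "dyadic_survives b T j = {x \<in> space M. \<forall>k\<le>2^j. R (T * real k / 2^j) x \<le> b}"

lemma dyadic_survives_sets:
  assumes "T > 0"
  shows "dyadic_survives b T j \<in> sets M"
proof -
  have "dyadic_survives b T j = (\<Inter>k\<in>{..2^j}. R (T * real k / 2^j) -` {..b} \<inter> space M)"
    unfolding dyadic_survives_def by auto
  also have "\<dots> \<in> sets M"
    by (rule sets.finite_INT) (use assms in \<open>auto intro!: measurable_sets[OF meas]\<close>)
  finally show ?thesis .
qed

lemma survives_eq_dyadic:
  assumes "T > 0"
  shows "survives M R b T = (\<Inter>j. dyadic_survives b T j)"
proof (intro equalityI subsetI)
  fix x assume x: "x \<in> survives M R b T"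
  show "x \<in> (\<Inter>j. dyadic_survives b T j)"
  proof
    fix j
    have "T * real k / 2^j \<in> {0..T}" if "k \<le> 2^j" for k
    proof -
      have "real k \<le> 2^j" using that by (metis of_nat_le_iff of_nat_numeral of_nat_power)
      then show ?thesis using assms by (auto simp: field_simps mult_left_mono)
    qed
    then show "x \<in> dyadic_survives b T j" using x unfolding survives_def dyadic_survives_def by blast
  qed
next
  fix x assume x: "x \<in> (\<Inter>j. dyadic_survives b T j)"
  then have sp: "x \<in> space M" unfolding dyadic_survives_def by blast
  have "R t x \<le> b" if t: "t \<in> {0..T}" for t
  proof -
    define k where "k j = nat \<lfloor>2^j * (t / T)\<rfloor>" for j :: nat
    define s where "s j = T * real (k j) / 2^j" for j
    have k1: "real (k j) = of_int \<lfloor>2^j * (t / T)\<rfloor>" for j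
      using t assms by (simp add: k_def)
    have k2: "k j \<le> 2^j" for j
    proof -
      have "t / T \<le> 1" using t assms by simp
      then have "2^j * (t / T) \<le> 2^j * 1" by (intro mult_left_mono) auto
      then have "real (k j) \<le> 2^j" unfolding k1 by linarith
      then show ?thesis by (metis of_nat_le_iff of_nat_numeral of_nat_power)
    qed
    have s1: "s j \<le> t \<and> t - T * (1/2)^j \<le> s j" for j
    proof -
      have "real (k j) \<le> 2^j * (t / T)" "2^j * (t / T) - 1 \<le> real (k j)" unfolding k1 by linarith+
      then have "T * real (k j) / 2^j \<le> T * (2^j * (t / T)) / 2^j"
        "T * (2^j * (t / T) - 1) / 2^j \<le> T * real (k j) / 2^j"
        using assms by (intro divide_right_mono mult_left_mono; (assumption | simp))+
      moreover have "T * (2^j * (t / T)) / 2^j = t" using assms by simp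
      moreover have "T * (2^j * (t / T) - 1) / 2^j = t - T * (1/2)^j"
        using assms by (simp add: right_diff_distrib diff_divide_distrib power_divide)
      ultimately show ?thesis unfolding s_def by simp
    qed
    have "s \<longlonglongrightarrow> t"
    proof (rule tendsto_sandwich[of "\<lambda>j. t - T * (1/2)^j" s sequentially "\<lambda>_. t"])
      have "(\<lambda>j. t - T * (1/2)^j) \<longlonglongrightarrow> t - T * 0"
        by (intro tendsto_intros LIMSEQ_realpow_zero) auto
      then show "(\<lambda>j. t - T * (1/2)^j) \<longlonglongrightarrow> t" by simp
    qed (use s1 in auto)
    moreover have "s j \<in> {0..}" for j using assms by (simp add: s_def)
    ultimately have "(\<lambda>j. R (s j) x) \<longlonglongrightarrow> R t x"
      using t by (intro continuous_on_tendsto_compose[OF paths[OF sp]]) auto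
    moreover have "R (s j) x \<le> b" for j
      using x k2[of j] unfolding dyadic_survives_def s_def by blast
    ultimately show "R t x \<le> b" by (intro LIMSEQ_le_const2) auto
  qed
  then show "x \<in> survives M R b T" using sp by (auto simp: survives_def)
qed

lemma survives_sets: "T > 0 \<Longrightarrow> survives M R b T \<in> sets M"
  unfolding survives_eq_dyadic by (intro sets.countable_INT) (auto intro: dyadic_survives_sets)

lemma prob_dyadic_survives_tendsto:
  assumes "T > 0"
  shows "(\<lambda>j. prob (dyadic_survives b T j)) \<longlonglongrightarrow> prob (survives M R b T)"
  unfolding survives_eq_dyadic[OF assms]
proof (rule finite_Lim_measure_decseq)
  show "range (dyadic_survives b T) \<subseteq> sets M" using dyadic_survives_sets[OF assms] by auto
  show "decseq (dyadic_survives b T)"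
  proof (rule decseq_SucI, rule subsetI)
    fix j x assume x: "x \<in> dyadic_survives b T (Suc j)"
    have "R (T * real k / 2^j) x \<le> b" if "k \<le> 2^j" for k
    proof -
      have "R (T * real (2 * k) / 2^Suc j) x \<le> b"
        using x that unfolding dyadic_survives_def by (auto simp del: of_nat_mult)
      then show ?thesis by simp
    qed
    then show "x \<in> dyadic_survives b T j" using x unfolding dyadic_survives_def by blast
  qed
qed

text \<open>
  Survival on \<open>{0..T}\<close> implies survival on every grid, so the bound for one sufficiently fine grid
  suffices; then the mesh tends to zero.
\<close>

lemma survives_upper:
  assumes T: "T > 0" and e: "0 < e" and \<delta>: "0 < \<delta>"
    and A: "\<And>s t. 0 \<le> s \<Longrightarrow> s \<le> t \<Longrightarrow> 0 \<le> A t - A s \<and> A t - A s \<le> m t - m s"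
    and ge: "\<And>s t. 0 \<le> s \<Longrightarrow> s \<le> t \<Longrightarrow> var_ge M (F s) (\<lambda>x. R t x - R s x) (A t - A s)"
  shows "barrier e (- \<delta>) * prob (survives M R 0 T) \<le> barrier (e + (A T - A 0)) (r - \<delta>)"
proof -
  obtain C where C: "taylor_constant e C" using barrier_Taylor[OF e] by blast
  define Q where "Q = (C * (2 + K) + K / \<delta>^4) * (m T - m 0)"
  have *: "barrier e (- \<delta>) * prob (survives M R 0 T) \<le> barrier (e + (A T - A 0)) (r - \<delta>) + \<theta> * Q"
    if \<theta>: "0 < \<theta>" "\<theta> \<le> 1" for \<theta>
  proof -
    obtain N where N: "\<And>j k. j \<ge> N \<Longrightarrow> k < 2^j \<Longrightarrow> m (T * real (Suc k) / 2^j) - m (T * real k / 2^j) \<le> \<theta>^2"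
      using fine_dyadic_grids[OF T \<theta>(1)] by metis
    have "barrier e (- \<delta>) * prob (dyadic_survives 0 T N) \<le> barrier (e + (A T - A 0)) (r - \<delta>) + \<theta> * Q"
      unfolding Q_def dyadic_survives_def
      by (rule grid_survival_bounds(1)[of "\<lambda>k. T * real k / 2^N" "2^N"])
        (use T \<theta> N[of N] A e \<delta> C ge in \<open>auto simp: field_simps\<close>)
    moreover have "prob (survives M R 0 T) \<le> prob (dyadic_survives 0 T N)"
      by (rule finite_measure_mono[OF _ dyadic_survives_sets[OF T]])
        (use survives_eq_dyadic[OF T] in auto)
    moreover have "0 \<le> barrier e (- \<delta>)" using e \<delta> by (intro barrier_nonneg) auto
    ultimately show ?thesis by (meson mult_left_mono order_trans)
  qed
  have "((\<lambda>\<theta>. barrier (e + (A T - A 0)) (r - \<delta>) + \<theta> * Q) \<longlongrightarrow> barrier (e + (A T - A 0)) (r - \<delta>) + 0 * Q) (at_right 0)"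
    by (intro tendsto_intros)
  moreover have "\<forall>\<^sub>F \<theta> in at_right 0. barrier e (- \<delta>) * prob (survives M R 0 T)
      \<le> barrier (e + (A T - A 0)) (r - \<delta>) + \<theta> * Q"
    using * by (auto simp: eventually_at_right_field intro!: exI[of _ 1])
  ultimately have "barrier e (- \<delta>) * prob (survives M R 0 T) \<le> barrier (e + (A T - A 0)) (r - \<delta>) + 0 * Q"
    by (intro tendsto_lowerbound) auto
  then show ?thesis by simp
qed

text \<open>
  Survival on a grid does not imply survival on \<open>{0..T}\<close>, so for fixed \<open>\<theta>\<close> the dyadic grids are
  refined first, and only then does \<open>\<theta>\<close> tend to zero.
\<close>

lemma survives_lower:
  assumes T: "T > 0" and e: "0 < e" and \<delta>: "0 < \<delta>"
    and A: "\<And>s t. 0 \<le> s \<Longrightarrow> s \<le> t \<Longrightarrow> 0 \<le> A t - A s \<and> A t - A s \<le> m t - m s"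
    and le: "\<And>s t. 0 \<le> s \<Longrightarrow> s \<le> t \<Longrightarrow> var_le M (F s) (\<lambda>x. R t x - R s x) (A t - A s)"
  shows "barrier (e + (A T - A 0)) (r - \<delta>) \<le> Phi 0 * prob (survives M R \<delta> T)"
proof -
  obtain C where C: "taylor_constant e C" using barrier_Taylor[OF e] by blast
  define Q where "Q = (C * (2 + K) + K / \<delta>^4) * (m T - m 0)"
  have *: "barrier (e + (A T - A 0)) (r - \<delta>) \<le> Phi 0 * prob (survives M R \<delta> T) + \<theta> * Q"
    if \<theta>: "0 < \<theta>" "\<theta> \<le> 1" for \<theta>
  proof -
    obtain N where N: "\<And>j k. j \<ge> N \<Longrightarrow> k < 2^j \<Longrightarrow> m (T * real (Suc k) / 2^j) - m (T * real k / 2^j) \<le> \<theta>^2"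
      using fine_dyadic_grids[OF T \<theta>(1)] by metis
    have g: "barrier (e + (A T - A 0)) (r - \<delta>) \<le> Phi 0 * prob (dyadic_survives \<delta> T j) + \<theta> * Q" if "j \<ge> N" for j
      unfolding Q_def dyadic_survives_def
      by (rule grid_survival_bounds(2)[of "\<lambda>k. T * real k / 2^j" "2^j"])
        (use T \<theta> N[OF that] A e \<delta> C le in \<open>auto simp: field_simps\<close>)
    have "(\<lambda>j. Phi 0 * prob (dyadic_survives \<delta> T j) + \<theta> * Q) \<longlonglongrightarrow> Phi 0 * prob (survives M R \<delta> T) + \<theta> * Q"
      by (intro tendsto_intros prob_dyadic_survives_tendsto T)
    then show ?thesis by (rule LIMSEQ_le_const) (use g in blast)
  qed
  have "((\<lambda>\<theta>. Phi 0 * prob (survives M R \<delta> T) + \<theta> * Q) \<longlongrightarrow> Phi 0 * prob (survives M R \<delta> T) + 0 * Q) (at_right 0)"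
    by (intro tendsto_intros)
  moreover have "\<forall>\<^sub>F \<theta> in at_right 0. barrier (e + (A T - A 0)) (r - \<delta>) \<le> Phi 0 * prob (survives M R \<delta> T) + \<theta> * Q"
    using * by (auto simp: eventually_at_right_field intro!: exI[of _ 1])
  ultimately have "barrier (e + (A T - A 0)) (r - \<delta>) \<le> Phi 0 * prob (survives M R \<delta> T) + 0 * Q"
    by (intro tendsto_lowerbound) auto
  then show ?thesis by simp
qed

lemma survives_mono: "b \<le> c \<Longrightarrow> survives M R b T \<subseteq> survives M R c T"
  unfolding survives_def by (blast intro: order_trans)

lemma prob_survives_level_tendsto:
  assumes T: "T > 0"
  shows "(\<lambda>n. prob (survives M R (inverse (real (Suc n))) T)) \<longlonglongrightarrow> prob (survives M R 0 T)"
proof -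
  have "survives M R 0 T = (\<Inter>n. survives M R (inverse (real (Suc n))) T)"
  proof (intro equalityI subsetI)
    fix x assume "x \<in> survives M R 0 T"
    then show "x \<in> (\<Inter>n. survives M R (inverse (real (Suc n))) T)"
      using survives_mono[of 0 "inverse (real (Suc _))" T] by (meson INT_I inverse_nonnegative_iff_nonnegative of_nat_0_le_iff subsetD)
  next
    fix x assume x: "x \<in> (\<Inter>n. survives M R (inverse (real (Suc n))) T)"
    have "R t x \<le> 0" if "t \<in> {0..T}" for t
    proof (rule LIMSEQ_le_const[OF LIMSEQ_inverse_real_of_nat], intro exI allI impI)
      show "R t x \<le> inverse (real (Suc n))" for n
        using x that unfolding survives_def by blast
    qed
    then show "x \<in> survives M R 0 T" using x unfolding survives_def by blast
  qed
  moreover have "(\<lambda>n. prob (survives M R (inverse (real (Suc n))) T)) \<longlonglongrightarrow> prob (\<Inter>n. survives M R (inverse (real (Suc n))) T)"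
  proof (rule finite_Lim_measure_decseq)
    show "decseq (\<lambda>n. survives M R (inverse (real (Suc n))) T)"
      by (rule decseq_SucI, rule survives_mono, rule le_imp_inverse_le) auto
    show "range (\<lambda>n. survives M R (inverse (real (Suc n))) T) \<subseteq> sets M"
      using survives_sets[OF T] by blast
  qed
  ultimately show ?thesis by simp
qed

text \<open>
  \<open>tau0plus R x > T\<close> means that the path stays below \<open>0\<close> on an interval that extends beyond \<open>T\<close>.
\<close>

lemma prob_tau0plus_tendsto:
  assumes T: "T > 0"
  shows "(\<lambda>n. prob (survives M R 0 (T + inverse (real (Suc n)))))
    \<longlonglongrightarrow> prob {x \<in> space M. tau0plus R x > ereal T}"
proof -
  have "{x \<in> space M. tau0plus R x > ereal T} = (\<Union>n. survives M R 0 (T + inverse (real (Suc n))))"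
  proof (intro equalityI subsetI)
    fix x assume "x \<in> {x \<in> space M. tau0plus R x > ereal T}"
    then have x: "x \<in> space M" "ereal T < tau0plus R x" by auto
    then obtain q where q: "ereal T < ereal q" "ereal q < tau0plus R x"
      using ereal_dense2 by blast
    obtain n where n: "inverse (real (Suc n)) < q - T"
      using q(1) reals_Archimedean[of "q - T"] by auto
    have "R t x \<le> 0" if "t \<in> {0..T + inverse (real (Suc n))}" for t
    proof (rule ccontr)
      assume "\<not> R t x \<le> 0"
      then have "tau0plus R x \<le> ereal t"
        unfolding tau0plus_def using that by (intro Inf_lower) auto
      also have "ereal t < ereal q" using that n by simp
      finally show False using q(2) by simp
    qed
    then have "x \<in> survives M R 0 (T + inverse (real (Suc n)))"
      using x unfolding survives_def by blast
    then show "x \<in> (\<Union>n. survives M R 0 (T + inverse (real (Suc n))))" by blast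
  next
    fix x assume "x \<in> (\<Union>n. survives M R 0 (T + inverse (real (Suc n))))"
    then obtain n where n: "x \<in> survives M R 0 (T + inverse (real (Suc n)))" by blast
    have "ereal (T + inverse (real (Suc n))) \<le> tau0plus R x"
      unfolding tau0plus_def
    proof (rule Inf_greatest, clarify)
      fix t assume "0 \<le> t" "0 < R t x"
      then show "ereal (T + inverse (real (Suc n))) \<le> ereal t"
        using n by (force simp: survives_def)
    qed
    moreover have "ereal T < ereal (T + inverse (real (Suc n)))" by simp
    ultimately have "ereal T < tau0plus R x" by (rule less_le_trans[rotated])
    then show "x \<in> {x \<in> space M. tau0plus R x > ereal T}"
      using n unfolding survives_def by blast
  qed
  moreover have "(\<lambda>n. prob (survives M R 0 (T + inverse (real (Suc n)))))
    \<longlonglongrightarrow> prob (\<Union>n. survives M R 0 (T + inverse (real (Suc n))))"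
  proof (rule finite_Lim_measure_incseq)
    show "incseq (\<lambda>n. survives M R 0 (T + inverse (real (Suc n))))"
    proof (rule incseq_SucI, rule subsetI)
      fix n x assume x: "x \<in> survives M R 0 (T + inverse (real (Suc n)))"
      have "inverse (real (Suc (Suc n))) \<le> inverse (real (Suc n))"
        by (rule le_imp_inverse_le) auto
      then have "{0..T + inverse (real (Suc (Suc n)))} \<subseteq> {0..T + inverse (real (Suc n))}" by simp
      then show "x \<in> survives M R 0 (T + inverse (real (Suc (Suc n))))"
        using x unfolding survives_def by blast
    qed
    have "0 < T + inverse (real (Suc n))" for n using T by (simp add: add_pos_pos)
    then show "range (\<lambda>n. survives M R 0 (T + inverse (real (Suc n)))) \<subseteq> sets M"
      using survives_sets by blast
  qed
  ultimately show ?thesis by simp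
qed

end

text \<open>
  Both processes are compared with the profile for the common clock \<open>A\<close>, at the starting point
  \<open>r - \<delta>\<close> and with a final variance \<open>e\<close>. Letting \<open>e\<close> tend to zero turns the final profile into an
  indicator, and letting \<open>\<delta>\<close> tend to zero closes the gap between the levels \<open>0\<close> and \<open>\<delta>\<close>.
\<close>

theorem tau0plus_comparison:
  assumes R: "quartic_martingale M F R r m K" and R': "quartic_martingale M F' R' r m' K'"
    and T: "T > 0"
    and A: "\<And>s t. 0 \<le> s \<Longrightarrow> s \<le> t \<Longrightarrow> 0 \<le> A t - A s \<and> A t - A s \<le> m t - m s"
    and A': "\<And>s t. 0 \<le> s \<Longrightarrow> s \<le> t \<Longrightarrow> 0 \<le> A t - A s \<and> A t - A s \<le> m' t - m' s"
    and ge: "\<And>s t. 0 \<le> s \<Longrightarrow> s \<le> t \<Longrightarrow> var_ge M (F s) (\<lambda>x. R t x - R s x) (A t - A s)"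
    and le: "\<And>s t. 0 \<le> s \<Longrightarrow> s \<le> t \<Longrightarrow> var_le M (F' s) (\<lambda>x. R' t x - R' s x) (A t - A s)"
  shows "measure M {x \<in> space M. tau0plus R x > ereal T} \<le> measure M {x \<in> space M. tau0plus R' x > ereal T}"
proof -
  interpret R: quartic_martingale M F R r m K by (rule R)
  interpret R': quartic_martingale M F' R' r m' K' by (rule R')
  have 1: "measure M (survives M R 0 T) \<le> measure M (survives M R' \<delta> T)" if T: "T > 0" and \<delta>: "\<delta> > 0" for T \<delta>
  proof -
    have "barrier e (- \<delta>) * measure M (survives M R 0 T) \<le> Phi 0 * measure M (survives M R' \<delta> T)" if "e > 0" for e
      using R.survives_upper[OF T that \<delta> A ge] R'.survives_lower[OF T that \<delta> A' le] by linarith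
    then have ev: "\<forall>\<^sub>F e in at_right 0. barrier e (- \<delta>) * measure M (survives M R 0 T) \<le> Phi 0 * measure M (survives M R' \<delta> T)"
      by (auto simp: eventually_at_filter)
    have "((\<lambda>e. barrier e (- \<delta>) * measure M (survives M R 0 T)) \<longlongrightarrow> Phi 0 * measure M (survives M R 0 T)) (at_right 0)"
      using \<delta> by (intro tendsto_intros barrier_tendsto_initial) auto
    then have "Phi 0 * measure M (survives M R 0 T) \<le> Phi 0 * measure M (survives M R' \<delta> T)"
      by (rule tendsto_upperbound[OF _ ev]) simp
    then show ?thesis using Phi_pos[of 0] by simp
  qed
  have 2: "measure M (survives M R 0 T) \<le> measure M (survives M R' 0 T)" if T: "T > 0" for T
    by (rule LIMSEQ_le_const[OF R'.prob_survives_level_tendsto[OF T]]) (use 1[OF T] in auto)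
  show ?thesis
    by (rule LIMSEQ_le[OF R.prob_tau0plus_tendsto[OF T] R'.prob_tau0plus_tendsto[OF T]])
      (use 2 T in \<open>auto intro!: exI[of _ 0] simp: add_pos_pos\<close>)
qed

section \<open>Step integrals\<close>

text \<open>
  The counterpart of \<open>partition_of\<close> for a window from \<open>s\<close> to \<open>t\<close>.
\<close>

definition grid :: "real \<Rightarrow> real \<Rightarrow> nat \<Rightarrow> (nat \<Rightarrow> real) \<Rightarrow> bool" where
  "grid s t n q \<longleftrightarrow> s \<le> q 0 \<and> (\<forall>i<n. q i \<le> q (Suc i)) \<and> q n \<le> t"

lemma grid_mono:
  assumes g: "grid s t n q" and "i \<le> j" "j \<le> n"
  shows "q i \<le> q j"
  using assms(2,3)
proof (induction j rule: dec_induct)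
  case (step j)
  then have "q i \<le> q j" "q j \<le> q (Suc j)" using g by (auto simp: grid_def)
  then show ?case by simp
qed simp

lemma grid_bounds: "grid s t n q \<Longrightarrow> i \<le> n \<Longrightarrow> s \<le> q i \<and> q i \<le> t"
  using grid_mono[of s t n q 0 i] grid_mono[of s t n q i n] by (auto simp: grid_def)

lemma grid_widen: "grid s t n q \<Longrightarrow> s' \<le> s \<Longrightarrow> t \<le> t' \<Longrightarrow> grid s' t' n q"
  by (auto simp: grid_def)

lemma step_fun_Suc: "step_fun (Suc n) q c u = step_fun n q c u + c n * indicator {q n<..q (Suc n)} u"
  by (simp add: step_fun_def)

lemma step_integral_Suc:
  "step_integral W (Suc n) q c x = step_integral W n q c x + c n * (W (q (Suc n)) x - W (q n) x)"
  by (simp add: step_integral_def)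

lemma step_fun_measurable [measurable]: "step_fun n q c \<in> borel_measurable borel"
  unfolding step_fun_def[abs_def] by measurable

lemma step_fun_outside:
  assumes "grid s t n q" "u \<notin> {s<..t}"
  shows "step_fun n q c u = 0"
proof -
  have "indicator {q i<..q (Suc i)} u = (0::real)" if "i < n" for i
    using grid_bounds[OF assms(1), of i] grid_bounds[OF assms(1), of "Suc i"] that assms(2)
    by (auto simp: indicator_def)
  then show ?thesis unfolding step_fun_def by (intro sum.neutral) simp
qed

text \<open>
  At most one step is active at any point, so functions with \<open>G 0 0 = 0\<close> act on the coefficients.
\<close>

lemma step_fun_comp:
  fixes G :: "real \<Rightarrow> real \<Rightarrow> real"
  assumes "grid s t n q" "G 0 0 = 0"
  shows "G (step_fun n q c u) (step_fun n q d u) = step_fun n q (\<lambda>i. G (c i) (d i)) u"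
  using assms(1)
proof (induction n arbitrary: t)
  case 0
  then show ?case using assms(2) by (simp add: step_fun_def)
next
  case (Suc n)
  then have g: "grid s (q n) n q" by (simp add: grid_def)
  note IH = Suc.IH[OF g]
  show ?case
  proof (cases "u \<le> q n")
    case True
    then show ?thesis using IH by (simp add: step_fun_Suc)
  next
    case False
    then have "step_fun n q a u = 0" for a by (intro step_fun_outside[OF g]) simp
    then show ?thesis using assms(2) by (simp add: step_fun_Suc indicator_def)
  qed
qed

text \<open>
  Windows are half-open like the steps of a step function, so that consecutive ones tile the
  half-line.
\<close>

abbreviation win :: "real \<Rightarrow> real \<Rightarrow> real measure" where
  "win s t \<equiv> restrict_space lborel {s<..t}"

lemma integral_step_fun:
  assumes "grid s t n q"
  shows "integrable (win s t) (step_fun n q c)"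
    "integral\<^sup>L (win s t) (step_fun n q c) = (\<Sum>i<n. c i * (q (Suc i) - q i))"
proof -
  have ind: "(\<lambda>u. indicator {s<..t} u *\<^sub>R step_fun n q c u) = step_fun n q c"
  proof
    fix u show "indicator {s<..t} u *\<^sub>R step_fun n q c u = step_fun n q c u"
      using step_fun_outside[OF assms, of u c] by (cases "u \<in> {s<..t}") simp_all
  qed
  have m: "{s<..t} \<inter> space lborel \<in> sets lborel" by simp
  have le: "q i \<le> q (Suc i)" if "i < n" for i using assms that by (simp add: grid_def)
  have i: "integrable lborel (\<lambda>u. c i * indicator {q i<..q (Suc i)} u)" if "i < n" for i
    using le[OF that] by (intro integrable_mult_right integrable_real_indicator) auto
  have "integrable lborel (step_fun n q c)"
    unfolding step_fun_def[abs_def] by (rule Bochner_Integration.integrable_sum) (use i in simp)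
  then show "integrable (win s t) (step_fun n q c)"
    unfolding integrable_restrict_space[OF m] ind .
  have "integral\<^sup>L (win s t) (step_fun n q c) = (\<integral>u. step_fun n q c u \<partial>lborel)"
    unfolding integral_restrict_space[OF m] ind ..
  also have "\<dots> = (\<Sum>i<n. \<integral>u. c i * indicator {q i<..q (Suc i)} u \<partial>lborel)"
    unfolding step_fun_def[abs_def] by (rule Bochner_Integration.integral_sum) (use i in simp)
  also have "\<dots> = (\<Sum>i<n. c i * (q (Suc i) - q i))"
    by (rule sum.cong) (use le in auto)
  finally show "integral\<^sup>L (win s t) (step_fun n q c) = (\<Sum>i<n. c i * (q (Suc i) - q i))" .
qed

lemma (in prob_space) integrable_mult_squares:
  fixes X Y :: "'a \<Rightarrow> real"
  assumes "X \<in> borel_measurable M" "Y \<in> borel_measurable M"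
    "integrable M (\<lambda>x. (X x)^2)" "integrable M (\<lambda>x. (Y x)^2)"
  shows "integrable M (\<lambda>x. X x * Y x)"
proof (rule Bochner_Integration.integrable_bound)
  show "integrable M (\<lambda>x. (X x)^2 + (Y x)^2)" using assms by simp
  show "(\<lambda>x. X x * Y x) \<in> borel_measurable M" using assms by simp
  have "\<bar>a * b\<bar> \<le> a^2 + b^2" for a b :: real
  proof -
    have "2 * \<bar>a * b\<bar> \<le> a^2 + b^2"
      using zero_le_power2[of "\<bar>a\<bar> - \<bar>b\<bar>"] by (simp add: power2_diff abs_mult)
    then show ?thesis using abs_ge_zero[of "a * b"] by linarith
  qed
  then show "AE x in M. norm (X x * Y x) \<le> norm ((X x)^2 + (Y x)^2)"
    by (intro AE_I2) simp
qed

locale filtered = prob_space M for M :: "'a measure" +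
  fixes F :: "real \<Rightarrow> 'a measure"
  assumes sub: "\<And>t. 0 \<le> t \<Longrightarrow> subalgebra M (F t)"
    and filt: "\<And>s t. 0 \<le> s \<Longrightarrow> s \<le> t \<Longrightarrow> subalgebra (F t) (F s)"
begin

lemma lift_M: "0 \<le> t \<Longrightarrow> X \<in> borel_measurable (F t) \<Longrightarrow> X \<in> borel_measurable M"
  by (rule measurable_from_subalg[OF sub])

lemma lift: "0 \<le> s \<Longrightarrow> s \<le> t \<Longrightarrow> X \<in> borel_measurable (F s) \<Longrightarrow> X \<in> borel_measurable (F t)"
  by (rule measurable_from_subalg[OF filt])

lemma bm_measurable:
  "brownian_motion M F W \<Longrightarrow> 0 \<le> t \<Longrightarrow> W t \<in> borel_measurable (F t)"
  by (simp add: brownian_motion_def)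

lemma bm_increment_measurable:
  assumes "brownian_motion M F W" "0 \<le> s" "s \<le> t"
  shows "(\<lambda>x. W t x - W s x) \<in> borel_measurable M"
proof -
  have "0 \<le> t" using assms by simp
  show ?thesis
    by (rule borel_measurable_diff) (rule lift_M[OF _ bm_measurable[OF assms(1)]]; fact)+
qed

lemma increment_indep:
  assumes bm: "brownian_motion M F W" and st: "0 \<le> s" "s < t" and Y: "Y \<in> borel_measurable (F s)"
  shows "indep_var borel Y borel (\<lambda>x. W t x - W s x)"
proof -
  let ?D = "\<lambda>x. W t x - W s x"
  let ?E = "{?D -` A \<inter> space M | A. A \<in> sets borel}"
  let ?Y = "{Y -` A \<inter> space M | A. A \<in> sets borel}"
  have YM: "Y \<in> borel_measurable M" using lift_M[OF st(1) Y] .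
  have DM: "?D \<in> borel_measurable M" using bm_increment_measurable[OF bm] st by simp
  have sp: "space (F s) = space M" using sub[OF st(1)] by (simp add: subalgebra_def)
  have ind: "indep_set (sets (F s)) ?E" using bm st unfolding brownian_motion_def by blast
  moreover have "?Y \<subseteq> sets (F s)"
    using measurable_sets[OF Y] unfolding sp by blast
  ultimately have "indep_set ?Y ?E" unfolding indep_sets2_eq by blast
  moreover have "Int_stable {X -` A \<inter> space M | A. A \<in> sets borel}" for X :: "'a \<Rightarrow> real"
  proof (rule Int_stableI, clarify)
    fix A C :: "real set" assume "A \<in> sets borel" "C \<in> sets borel"
    then show "\<exists>E. X -` A \<inter> space M \<inter> (X -` C \<inter> space M) = X -` E \<inter> space M \<and> E \<in> sets borel"
      by (intro exI[of _ "A \<inter> C"]) auto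
  qed
  ultimately show ?thesis unfolding indep_var_eq using YM DM by (intro conjI indep_set_sigma_sets)
qed

lemma increment_powers:
  assumes bm: "brownian_motion M F W" and st: "0 \<le> s" "s < t"
  shows "integrable M (\<lambda>x. (W t x - W s x)^k)"
    "(\<integral>x. (W t x - W s x)^k \<partial>M) = (\<integral>y. normal_density 0 (sqrt (t - s)) y * y^k \<partial>lborel)"
proof -
  have d: "distributed M lborel (\<lambda>x. W t x - W s x) (normal_density 0 (sqrt (t - s)))"
    using bm st unfolding brownian_motion_def by blast
  show "integrable M (\<lambda>x. (W t x - W s x)^k)"
    using distributed_integrable[OF d, of "\<lambda>y. y^k"] integrable_normal_moment[of "sqrt (t - s)" 0 k] st
    by simp
  show "(\<integral>x. (W t x - W s x)^k \<partial>M) = (\<integral>y. normal_density 0 (sqrt (t - s)) y * y^k \<partial>lborel)"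
    using distributed_integral[OF d, of "\<lambda>y. y^k"] by simp
qed

lemma increment_product:
  assumes bm: "brownian_motion M F W" and st: "0 \<le> s" "s < t"
    and Y: "Y \<in> borel_measurable (F s)" "integrable M Y"
  shows "integrable M (\<lambda>x. Y x * (W t x - W s x)^k)"
    "(\<integral>x. Y x * (W t x - W s x)^k \<partial>M) = (\<integral>x. Y x \<partial>M) * (\<integral>x. (W t x - W s x)^k \<partial>M)"
proof -
  have "indep_var borel ((\<lambda>y. y) \<circ> Y) borel ((\<lambda>y. y^k) \<circ> (\<lambda>x. W t x - W s x))"
    by (rule indep_var_compose[OF increment_indep[OF bm st Y(1)]]) auto
  then have i: "indep_var borel Y borel (\<lambda>x. (W t x - W s x)^k)"
    by (simp add: comp_def)
  show "integrable M (\<lambda>x. Y x * (W t x - W s x)^k)"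
    by (rule indep_var_integrable[OF i Y(2) increment_powers(1)[OF bm st]])
  show "(\<integral>x. Y x * (W t x - W s x)^k \<partial>M) = (\<integral>x. Y x \<partial>M) * (\<integral>x. (W t x - W s x)^k \<partial>M)"
    by (rule indep_var_lebesgue_integral[OF i Y(2) increment_powers(1)[OF bm st]])
qed

text \<open>
  The case \<open>s = t\<close> is treated separately because the normal density degenerates there.
\<close>

lemma increment_moments:
  assumes bm: "brownian_motion M F W" and st: "0 \<le> s" "s \<le> t"
    and Y: "Y \<in> borel_measurable (F s)" "integrable M Y"
  shows "integrable M (\<lambda>x. Y x * (W t x - W s x)^k)"
    and "(\<integral>x. Y x * (W t x - W s x) \<partial>M) = 0"
    and "(\<integral>x. Y x * (W t x - W s x)^2 \<partial>M) = (t - s) * (\<integral>x. Y x \<partial>M)"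
    and "(\<integral>x. Y x * (W t x - W s x)^3 \<partial>M) = 0"
    and "(\<integral>x. Y x * (W t x - W s x)^4 \<partial>M) = 3 * (t - s)^2 * (\<integral>x. Y x \<partial>M)"
proof -
  have "integrable M (\<lambda>x. Y x * (W t x - W s x)^k) \<and>
    (\<integral>x. Y x * (W t x - W s x) \<partial>M) = 0 \<and>
    (\<integral>x. Y x * (W t x - W s x)^2 \<partial>M) = (t - s) * (\<integral>x. Y x \<partial>M) \<and>
    (\<integral>x. Y x * (W t x - W s x)^3 \<partial>M) = 0 \<and>
    (\<integral>x. Y x * (W t x - W s x)^4 \<partial>M) = 3 * (t - s)^2 * (\<integral>x. Y x \<partial>M)"
  proof (cases "s = t")
    case True
    have "integrable M (\<lambda>x. Y x * 0^k)" using Y(2) by (rule integrable_mult_left)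
    then show ?thesis using True by simp
  next
    case False
    then have lt: "s < t" using st by simp
    have \<sigma>: "sqrt (t - s) > 0" "(sqrt (t - s))^2 = t - s" using lt by auto
    note p = increment_powers(2)[OF bm st(1) lt]
    have m1: "(\<integral>x. (W t x - W s x)^1 \<partial>M) = 0"
      unfolding p using integral_normal_moment_odd[OF \<sigma>(1), of 0 0] by simp
    have m2: "(\<integral>x. (W t x - W s x)^2 \<partial>M) = t - s"
      unfolding p using integral_normal_moment_even[OF \<sigma>(1), of 0 1] \<sigma> by simp
    have m3: "(\<integral>x. (W t x - W s x)^3 \<partial>M) = 0"
      unfolding p using integral_normal_moment_odd[OF \<sigma>(1), of 0 1] by simp
    have "(\<integral>y. normal_density 0 (sqrt (t - s)) y * y^4 \<partial>lborel) = fact 4 / ((2 / (t - s))^2 * fact 2)"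
      using integral_normal_moment_even[OF \<sigma>(1), of 0 2] \<sigma> by simp
    also have "\<dots> = 3 * (t - s)^2" using lt by (simp add: fact_numeral power_divide)
    finally have m4: "(\<integral>x. (W t x - W s x)^4 \<partial>M) = 3 * (t - s)^2" unfolding p .
    note q = increment_product(2)[OF bm st(1) lt Y]
    show ?thesis
      using increment_product(1)[OF bm st(1) lt Y, of k] q[of 1] q[of 2] q[of 3] q[of 4] m1 m2 m3 m4
      by simp
  qed
  then show "integrable M (\<lambda>x. Y x * (W t x - W s x)^k)"
    and "(\<integral>x. Y x * (W t x - W s x) \<partial>M) = 0"
    and "(\<integral>x. Y x * (W t x - W s x)^2 \<partial>M) = (t - s) * (\<integral>x. Y x \<partial>M)"
    and "(\<integral>x. Y x * (W t x - W s x)^3 \<partial>M) = 0"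
    and "(\<integral>x. Y x * (W t x - W s x)^4 \<partial>M) = 3 * (t - s)^2 * (\<integral>x. Y x \<partial>M)"
    by blast+
qed

lemma step_integral_measurable:
  assumes bm: "brownian_motion M F W" and s: "0 \<le> s" and g: "grid s t n q"
  shows "step_integral W n q c \<in> borel_measurable (F (q n))"
  using g
proof (induction n arbitrary: t)
  case 0
  then show ?case by (simp add: step_integral_def[abs_def])
next
  case (Suc n)
  then have g: "grid s (q n) n q" and le: "q n \<le> q (Suc n)" by (auto simp: grid_def)
  have q0: "0 \<le> q n" "0 \<le> q (Suc n)" using grid_bounds[OF g, of n] s le by auto
  have a: "step_integral W n q c \<in> borel_measurable (F (q (Suc n)))"
    by (rule lift[OF q0(1) le Suc.IH[OF g]])
  have b: "W (q n) \<in> borel_measurable (F (q (Suc n)))"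
    by (rule lift[OF q0(1) le bm_measurable[OF bm q0(1)]])
  have c: "W (q (Suc n)) \<in> borel_measurable (F (q (Suc n)))"
    by (rule bm_measurable[OF bm q0(2)])
  show ?case unfolding step_integral_Suc[abs_def]
    by (intro borel_measurable_add borel_measurable_times borel_measurable_diff borel_measurable_const a b c)
qed

lemma step_integral_measurable_M:
  assumes bm: "brownian_motion M F W" and s: "0 \<le> s" and g: "grid s t n q"
  shows "step_integral W n q c \<in> borel_measurable M"
  by (rule lift_M[OF _ step_integral_measurable[OF assms]]) (use grid_bounds[OF g, of n] s in auto)

text \<open>
  Expanding the fourth power of (past + new increment), the odd moments of the new increment
  vanish, and \<open>3 w\<^sup>2\<close> grows to \<open>3 (w + c\<^sup>2 d)\<^sup>2\<close>, as for a centred normal variable.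
\<close>

lemma step_integral_fourth:
  assumes bm: "brownian_motion M F W" and s: "0 \<le> s" and g: "grid s t n q"
  shows "integrable M (\<lambda>x. step_integral W n q c x ^ 4)"
    "(\<integral>x. (step_integral W n q c x)^2 \<partial>M) = (\<Sum>i<n. (c i)^2 * (q (Suc i) - q i))"
    "(\<integral>x. (step_integral W n q c x)^4 \<partial>M) \<le> 3 * (\<Sum>i<n. (c i)^2 * (q (Suc i) - q i))^2"
proof -
  have "integrable M (\<lambda>x. step_integral W n q c x ^ 4) \<and>
    (\<integral>x. (step_integral W n q c x)^2 \<partial>M) = (\<Sum>i<n. (c i)^2 * (q (Suc i) - q i)) \<and>
    (\<integral>x. (step_integral W n q c x)^4 \<partial>M) \<le> 3 * (\<Sum>i<n. (c i)^2 * (q (Suc i) - q i))^2"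
    using g
  proof (induction n arbitrary: t)
    case 0
    then show ?case by (simp add: step_integral_def)
  next
    case (Suc n)
    then have g: "grid s (q n) n q" and le: "q n \<le> q (Suc n)" by (auto simp: grid_def)
    have q0: "0 \<le> q n" using grid_bounds[OF g, of n] s by auto
    let ?S = "step_integral W n q c" and ?D = "\<lambda>x. W (q (Suc n)) x - W (q n) x"
    define d where "d = q (Suc n) - q n"
    define w where "w = (\<Sum>i<n. (c i)^2 * (q (Suc i) - q i))"
    note IH = Suc.IH[OF g, folded w_def]
    have SF: "?S \<in> borel_measurable (F (q n))" by (rule step_integral_measurable[OF bm s g])
    have SM: "?S \<in> borel_measurable M" by (rule step_integral_measurable_M[OF bm s g])
    have pF: "(\<lambda>x. ?S x ^ k) \<in> borel_measurable (F (q n))" for k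
      by (rule borel_measurable_power[OF SF])
    have S1: "integrable M ?S" and S2: "integrable M (\<lambda>x. ?S x ^ 2)" and S3: "integrable M (\<lambda>x. ?S x ^ 3)"
      using integrable_powers_of_fourth[OF SM] IH by blast+
    have S4: "integrable M (\<lambda>x. ?S x ^ 4)" using IH by blast
    have one: "integrable M (\<lambda>x. 1::real)" "(\<lambda>x. 1::real) \<in> borel_measurable (F (q n))" by simp_all
    note i1 = increment_moments[OF bm q0 le SF S1, folded d_def]
    note i2 = increment_moments[OF bm q0 le pF S2, folded d_def]
    note i3 = increment_moments[OF bm q0 le pF S3, folded d_def]
    note i0 = increment_moments[OF bm q0 le one(2) one(1), folded d_def]
    have e4: "(a + c * b)^4 = a^4 + 4 * c * (a^3 * b^1) + 6 * c^2 * (a^2 * b^2) + 4 * c^3 * (a * b^3) + c^4 * (1 * b^4)"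
      and e2: "(a + c * b)^2 = a^2 + 2 * c * (a * b^1) + c^2 * (1 * b^2)" for a b c :: real
      by (simp_all add: algebra_simps power2_eq_square power3_eq_cube power4_eq_xxxx)
    have x4: "(\<lambda>x. step_integral W (Suc n) q c x ^ 4) = (\<lambda>x. ?S x ^ 4 + 4 * c n * (?S x ^ 3 * ?D x ^ 1)
      + 6 * (c n)^2 * (?S x ^ 2 * ?D x ^ 2) + 4 * (c n)^3 * (?S x * ?D x ^ 3) + (c n)^4 * (1 * ?D x ^ 4))"
      unfolding step_integral_Suc by (rule ext) (rule e4)
    have x2: "(\<lambda>x. step_integral W (Suc n) q c x ^ 2) = (\<lambda>x. ?S x ^ 2 + 2 * c n * (?S x * ?D x ^ 1)
      + (c n)^2 * (1 * ?D x ^ 2))"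
      unfolding step_integral_Suc by (rule ext) (rule e2)
    have lin4: "integrable M (\<lambda>x. f1 x + a2 * f2 x + a3 * f3 x + a4 * f4 x + a5 * f5 x)"
      "(\<integral>x. f1 x + a2 * f2 x + a3 * f3 x + a4 * f4 x + a5 * f5 x \<partial>M)
        = (\<integral>x. f1 x \<partial>M) + a2 * (\<integral>x. f2 x \<partial>M) + a3 * (\<integral>x. f3 x \<partial>M) + a4 * (\<integral>x. f4 x \<partial>M) + a5 * (\<integral>x. f5 x \<partial>M)"
      if "integrable M f1" "integrable M f2" "integrable M f3" "integrable M f4" "integrable M f5"
      for f1 f2 f3 f4 f5 :: "'a \<Rightarrow> real" and a2 a3 a4 a5
      using that by simp_all
    have lin2: "(\<integral>x. f1 x + a2 * f2 x + a3 * f3 x \<partial>M)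
        = (\<integral>x. f1 x \<partial>M) + a2 * (\<integral>x. f2 x \<partial>M) + a3 * (\<integral>x. f3 x \<partial>M)"
      if "integrable M f1" "integrable M f2" "integrable M f3"
      for f1 f2 f3 :: "'a \<Rightarrow> real" and a2 a3
      using that by simp
    have I4: "integrable M (\<lambda>x. step_integral W (Suc n) q c x ^ 4)"
      unfolding x4 by (rule lin4(1)[OF S4 i3(1) i2(1) i1(1) i0(1)])
    have E2: "(\<integral>x. step_integral W (Suc n) q c x ^ 2 \<partial>M) = w + (c n)^2 * d"
      unfolding x2 lin2[OF S2 i1(1) i0(1)] using i1(2) i0(3) IH by (simp add: prob_space)
    have "(\<integral>x. step_integral W (Suc n) q c x ^ 4 \<partial>M)
      = (\<integral>x. ?S x ^ 4 \<partial>M) + 6 * (c n)^2 * (d * w) + (c n)^4 * (3 * d^2)"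
      unfolding x4 lin4(2)[OF S4 i3(1) i2(1) i1(1) i0(1)]
      using i3(2) i2(3) i1(4) i0(5) IH by (simp add: prob_space)
    also have "\<dots> \<le> 3 * w^2 + 6 * (c n)^2 * (d * w) + (c n)^4 * (3 * d^2)" using IH by simp
    also have "\<dots> = 3 * (w + (c n)^2 * d)^2"
      by (simp add: algebra_simps power2_eq_square power4_eq_xxxx)
    finally show ?case using I4 E2 by (simp add: w_def d_def)
  qed
  then show "integrable M (\<lambda>x. step_integral W n q c x ^ 4)"
    "(\<integral>x. (step_integral W n q c x)^2 \<partial>M) = (\<Sum>i<n. (c i)^2 * (q (Suc i) - q i))"
    "(\<integral>x. (step_integral W n q c x)^4 \<partial>M) \<le> 3 * (\<Sum>i<n. (c i)^2 * (q (Suc i) - q i))^2"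
    by blast+
qed

text \<open>
  The joint law of the two increments is unknown, but both have variance \<open>t - s\<close> given the past.
  So it is enough to bound the cross term pointwise by
  \<open>2 \<bar>c d \<Delta>B \<Delta>V\<bar> \<le> \<bar>c d\<bar> (\<Delta>B\<^sup>2 + \<Delta>V\<^sup>2)\<close>. The two bounds are attained when \<open>\<Delta>V\<close> is \<open>\<Delta>B\<close> or \<open>- \<Delta>B\<close>.
\<close>

lemma pair_increment:
  fixes c d :: real
  assumes B: "brownian_motion M F B" and V: "brownian_motion M F V" and st: "0 \<le> s" "s \<le> t"
    and Z: "Z \<in> borel_measurable (F s)" "\<And>x. x \<in> space M \<Longrightarrow> 0 \<le> Z x \<and> Z x \<le> K"
  defines "D \<equiv> \<lambda>x. c * (B t x - B s x) - d * (V t x - V s x)"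
  shows "integrable M (\<lambda>x. Z x * (D x)^2)"
    "(\<bar>c\<bar> - \<bar>d\<bar>)^2 * (t - s) * (\<integral>x. Z x \<partial>M) \<le> (\<integral>x. Z x * (D x)^2 \<partial>M)"
    "(\<integral>x. Z x * (D x)^2 \<partial>M) \<le> (\<bar>c\<bar> + \<bar>d\<bar>)^2 * (t - s) * (\<integral>x. Z x \<partial>M)"
proof -
  let ?b = "\<lambda>x. B t x - B s x" and ?v = "\<lambda>x. V t x - V s x"
  have ZM: "Z \<in> borel_measurable M" by (rule lift_M[OF st(1) Z(1)])
  have Zi: "integrable M Z" by (rule integrable_bounded[OF ZM, of K]) (use Z(2) in force)
  note b = increment_moments[OF B st Z(1) Zi] and v = increment_moments[OF V st Z(1) Zi]
  have DM: "D \<in> borel_measurable M" unfolding D_def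
    by (intro borel_measurable_diff[where f="\<lambda>x. c * ?b x" and g="\<lambda>x. d * ?v x"] borel_measurable_times
        borel_measurable_const bm_increment_measurable[OF B st] bm_increment_measurable[OF V st])
  have lo: "(\<bar>c\<bar> - \<bar>d\<bar>)^2 = c^2 + d^2 - 2 * \<bar>c * d\<bar>" by (simp add: power2_diff abs_mult)
  have hi: "(\<bar>c\<bar> + \<bar>d\<bar>)^2 = c^2 + d^2 + 2 * \<bar>c * d\<bar>" by (simp add: power2_sum abs_mult)
  have cross: "2 * \<bar>c * d * (p * q)\<bar> \<le> \<bar>c * d\<bar> * (p^2 + q^2)" for p q :: real
  proof -
    have "2 * \<bar>p * q\<bar> \<le> p^2 + q^2"
      using zero_le_power2[of "\<bar>p\<bar> - \<bar>q\<bar>"] by (simp add: power2_diff abs_mult)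
    from mult_left_mono[OF this, of "\<bar>c * d\<bar>"] show ?thesis by (simp add: abs_mult mult_ac)
  qed
  have sq: "(c^2 - \<bar>c * d\<bar>) * p^2 + (d^2 - \<bar>c * d\<bar>) * q^2 \<le> (c * p - d * q)^2"
    "(c * p - d * q)^2 \<le> (c^2 + \<bar>c * d\<bar>) * p^2 + (d^2 + \<bar>c * d\<bar>) * q^2" for p q :: real
  proof -
    have "(c * p - d * q)^2 = c^2 * p^2 + d^2 * q^2 - 2 * (c * d * (p * q))"
      by (simp add: power2_diff power_mult_distrib mult_ac)
    moreover have "2 * (c * d * (p * q)) \<le> \<bar>c * d\<bar> * (p^2 + q^2)" "- (2 * (c * d * (p * q))) \<le> \<bar>c * d\<bar> * (p^2 + q^2)"
      using cross[of p q] by linarith+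
    ultimately show "(c^2 - \<bar>c * d\<bar>) * p^2 + (d^2 - \<bar>c * d\<bar>) * q^2 \<le> (c * p - d * q)^2"
      "(c * p - d * q)^2 \<le> (c^2 + \<bar>c * d\<bar>) * p^2 + (d^2 + \<bar>c * d\<bar>) * q^2"
      unfolding left_diff_distrib distrib_right distrib_left by linarith+
  qed
  let ?L = "\<lambda>x. (c^2 - \<bar>c * d\<bar>) * (Z x * (?b x)^2) + (d^2 - \<bar>c * d\<bar>) * (Z x * (?v x)^2)"
  let ?U = "\<lambda>x. (c^2 + \<bar>c * d\<bar>) * (Z x * (?b x)^2) + (d^2 + \<bar>c * d\<bar>) * (Z x * (?v x)^2)"
  have L: "integrable M ?L" and U: "integrable M ?U"
    using b(1)[of 2] v(1)[of 2] by simp_all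
  have pt: "?L x \<le> Z x * (D x)^2 \<and> Z x * (D x)^2 \<le> ?U x" if x: "x \<in> space M" for x
  proof -
    have z: "0 \<le> Z x" using Z(2)[OF x] by simp
    have "(c^2 - \<bar>c * d\<bar>) * (?b x)^2 + (d^2 - \<bar>c * d\<bar>) * (?v x)^2 \<le> (D x)^2"
      "(D x)^2 \<le> (c^2 + \<bar>c * d\<bar>) * (?b x)^2 + (d^2 + \<bar>c * d\<bar>) * (?v x)^2"
      unfolding D_def by (rule sq)+
    from this[THEN mult_left_mono, OF z] show ?thesis by (simp add: distrib_left mult_ac)
  qed
  show I: "integrable M (\<lambda>x. Z x * (D x)^2)"
  proof (rule Bochner_Integration.integrable_bound[OF U])
    show "(\<lambda>x. Z x * (D x)^2) \<in> borel_measurable M"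
      by (intro borel_measurable_times borel_measurable_power ZM DM)
    show "AE x in M. norm (Z x * (D x)^2) \<le> norm (?U x)"
    proof (rule AE_I2)
      fix x assume x: "x \<in> space M"
      have "0 \<le> Z x * (D x)^2" using Z(2)[OF x] by simp
      then show "norm (Z x * (D x)^2) \<le> norm (?U x)" using pt[OF x] unfolding real_norm_def by linarith
    qed
  qed
  have lin: "(\<integral>x. a * (Z x * (?b x)^2) + a' * (Z x * (?v x)^2) \<partial>M) = (a + a') * (t - s) * (\<integral>x. Z x \<partial>M)" for a a'
    using b(1)[of 2] v(1)[of 2] b(3) v(3) by (simp add: distrib_right)
  have EL: "(\<integral>x. ?L x \<partial>M) = (\<bar>c\<bar> - \<bar>d\<bar>)^2 * (t - s) * (\<integral>x. Z x \<partial>M)"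
    unfolding lin lo by simp
  have EU: "(\<integral>x. ?U x \<partial>M) = (\<bar>c\<bar> + \<bar>d\<bar>)^2 * (t - s) * (\<integral>x. Z x \<partial>M)"
    unfolding lin hi by simp
  show "(\<bar>c\<bar> - \<bar>d\<bar>)^2 * (t - s) * (\<integral>x. Z x \<partial>M) \<le> (\<integral>x. Z x * (D x)^2 \<partial>M)"
    unfolding EL[symmetric] by (rule integral_mono[OF L I]) (use pt in blast)
  show "(\<integral>x. Z x * (D x)^2 \<partial>M) \<le> (\<bar>c\<bar> + \<bar>d\<bar>)^2 * (t - s) * (\<integral>x. Z x \<partial>M)"
    unfolding EU[symmetric] by (rule integral_mono[OF I U]) (use pt in blast)
qed

text \<open>
  Distinct increments are orthogonal given the past, so the bounds for single increments add up.
\<close>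

lemma pair_step_integral:
  fixes c d :: "nat \<Rightarrow> real"
  assumes B: "brownian_motion M F B" and V: "brownian_motion M F V" and s: "0 \<le> s" and g: "grid s t n q"
    and Z: "Z \<in> borel_measurable (F s)" "\<And>x. x \<in> space M \<Longrightarrow> \<bar>Z x\<bar> \<le> K"
  defines "U \<equiv> \<lambda>n x. step_integral B n q c x - step_integral V n q d x"
  shows "integrable M (\<lambda>x. (U n x)^2)"
    "(\<integral>x. Z x * U n x \<partial>M) = 0"
    "(\<And>x. x \<in> space M \<Longrightarrow> 0 \<le> Z x) \<Longrightarrow>
      (\<Sum>i<n. (\<bar>c i\<bar> - \<bar>d i\<bar>)^2 * (q (Suc i) - q i)) * (\<integral>x. Z x \<partial>M) \<le> (\<integral>x. Z x * (U n x)^2 \<partial>M) \<and>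
      (\<integral>x. Z x * (U n x)^2 \<partial>M) \<le> (\<Sum>i<n. (\<bar>c i\<bar> + \<bar>d i\<bar>)^2 * (q (Suc i) - q i)) * (\<integral>x. Z x \<partial>M)"
proof -
  have ZM: "Z \<in> borel_measurable M" by (rule lift_M[OF s Z(1)])
  have Zi: "integrable M Z" by (rule integrable_bounded[OF ZM Z(2)])
  have UF: "U n \<in> borel_measurable (F (q n))" if "grid s t n q" for n t
    unfolding U_def by (intro borel_measurable_diff step_integral_measurable[OF _ s that] B V)
  have U2: "integrable M (\<lambda>x. (U n x)^2)" if g: "grid s t n q" for n t
  proof -
    let ?b = "step_integral B n q c" and ?v = "step_integral V n q d"
    have bM: "?b \<in> borel_measurable M" "?v \<in> borel_measurable M"
      by (rule step_integral_measurable_M[OF B s g] step_integral_measurable_M[OF V s g])+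
    have b2: "integrable M (\<lambda>x. (?b x)^2)" "integrable M (\<lambda>x. (?v x)^2)"
      by (rule integrable_powers_of_fourth(2)[OF bM(1) step_integral_fourth(1)[OF B s g]]
          integrable_powers_of_fourth(2)[OF bM(2) step_integral_fourth(1)[OF V s g]])+
    have "integrable M (\<lambda>x. (?b x)^2 + (?v x)^2 - 2 * (?b x * ?v x))"
      using b2 integrable_mult_squares[OF bM b2] by simp
    then show ?thesis unfolding U_def by (simp add: power2_diff mult.assoc)
  qed
  show "integrable M (\<lambda>x. (U n x)^2)" by (rule U2[OF g])
  have U1: "integrable M (\<lambda>x. Z x * U n x)" if g: "grid s t n q" for n t
  proof -
    have q0: "0 \<le> q n" using grid_bounds[OF g, of n] s by auto
    have UM: "U n \<in> borel_measurable M" by (rule lift_M[OF q0 UF[OF g]])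
    have "integrable M (\<lambda>x. U n x * 1)"
      by (rule integrable_mult_squares) (use UM U2[OF g] in simp_all)
    then have "integrable M (U n)" by simp
    then show ?thesis by (rule integrable_bounded_mult[OF _ ZM Z(2)])
  qed
  have ZF: "Z \<in> borel_measurable (F (q n))" if g: "grid s t n q" for n t
    by (rule lift[OF s _ Z(1)]) (use grid_bounds[OF g, of n] in auto)
  have main: "(\<integral>x. Z x * U n x \<partial>M) = 0 \<and>
    ((\<forall>x\<in>space M. 0 \<le> Z x) \<longrightarrow>
      (\<Sum>i<n. (\<bar>c i\<bar> - \<bar>d i\<bar>)^2 * (q (Suc i) - q i)) * (\<integral>x. Z x \<partial>M) \<le> (\<integral>x. Z x * (U n x)^2 \<partial>M) \<and>
      (\<integral>x. Z x * (U n x)^2 \<partial>M) \<le> (\<Sum>i<n. (\<bar>c i\<bar> + \<bar>d i\<bar>)^2 * (q (Suc i) - q i)) * (\<integral>x. Z x \<partial>M))"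
    using g
  proof (induction n arbitrary: t)
    case 0
    then show ?case by (simp add: U_def step_integral_def)
  next
    case (Suc n)
    then have g: "grid s (q n) n q" and le: "q n \<le> q (Suc n)" by (auto simp: grid_def)
    have q0: "0 \<le> q n" using grid_bounds[OF g, of n] s by auto
    note IH = Suc.IH[OF g]
    let ?b = "\<lambda>x. B (q (Suc n)) x - B (q n) x" and ?v = "\<lambda>x. V (q (Suc n)) x - V (q n) x"
    let ?D = "\<lambda>x. c n * ?b x - d n * ?v x"
    have U_Suc: "U (Suc n) x = U n x + ?D x" for x
      unfolding U_def step_integral_Suc by simp
    note ZFn = ZF[OF g]
    note zb = increment_moments[OF B q0 le ZFn Zi] and zv = increment_moments[OF V q0 le ZFn Zi]
    have ZUF: "(\<lambda>x. Z x * U n x) \<in> borel_measurable (F (q n))"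
      by (rule borel_measurable_times[OF ZFn UF[OF g]])
    note ub = increment_moments[OF B q0 le ZUF U1[OF g]] and uv = increment_moments[OF V q0 le ZUF U1[OF g]]
    have "(\<lambda>x. Z x * U (Suc n) x) = (\<lambda>x. Z x * U n x + c n * (Z x * ?b x) - d n * (Z x * ?v x))"
      unfolding U_Suc by (simp add: algebra_simps)
    then have 1: "(\<integral>x. Z x * U (Suc n) x \<partial>M) = 0"
      using U1[OF g] zb(1)[of 1] zv(1)[of 1] zb(2) zv(2) IH by simp
    have 2: "(\<Sum>i<Suc n. (\<bar>c i\<bar> - \<bar>d i\<bar>)^2 * (q (Suc i) - q i)) * (\<integral>x. Z x \<partial>M) \<le> (\<integral>x. Z x * (U (Suc n) x)^2 \<partial>M) \<and>
      (\<integral>x. Z x * (U (Suc n) x)^2 \<partial>M) \<le> (\<Sum>i<Suc n. (\<bar>c i\<bar> + \<bar>d i\<bar>)^2 * (q (Suc i) - q i)) * (\<integral>x. Z x \<partial>M)"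
      if pos: "\<forall>x\<in>space M. 0 \<le> Z x"
    proof -
      have zk: "0 \<le> Z x \<and> Z x \<le> K" if "x \<in> space M" for x
        using pos Z(2)[OF that] that by (auto simp: abs_le_iff)
      note p = pair_increment[OF B V q0 le ZFn zk, of "c n" "d n"]
      have zu: "integrable M (\<lambda>x. Z x * (U n x)^2)"
        by (rule integrable_bounded_mult[OF U2[OF g] ZM Z(2)])
      have eq: "(\<lambda>x. Z x * (U (Suc n) x)^2) = (\<lambda>x. Z x * (U n x)^2 + 2 * c n * (Z x * U n x * ?b x)
         - 2 * d n * (Z x * U n x * ?v x) + Z x * (?D x)^2)"
        unfolding U_Suc power2_sum by (simp add: algebra_simps)
      have lin: "(\<integral>x. f1 x + a2 * f2 x - a3 * f3 x + f4 x \<partial>M)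
        = (\<integral>x. f1 x \<partial>M) + a2 * (\<integral>x. f2 x \<partial>M) - a3 * (\<integral>x. f3 x \<partial>M) + (\<integral>x. f4 x \<partial>M)"
        if "integrable M f1" "integrable M f2" "integrable M f3" "integrable M f4"
        for f1 f2 f3 f4 :: "'a \<Rightarrow> real" and a2 a3
        using that by simp
      have ub1: "integrable M (\<lambda>x. Z x * U n x * ?b x)" and uv1: "integrable M (\<lambda>x. Z x * U n x * ?v x)"
        using ub(1)[of 1] uv(1)[of 1] by simp_all
      have "(\<integral>x. Z x * (U (Suc n) x)^2 \<partial>M) = (\<integral>x. Z x * (U n x)^2 \<partial>M) + (\<integral>x. Z x * (?D x)^2 \<partial>M)"
      proof -
        have "(\<integral>x. Z x * (U (Suc n) x)^2 \<partial>M) = (\<integral>x. Z x * (U n x)^2 \<partial>M)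
          + 2 * c n * (\<integral>x. Z x * U n x * ?b x \<partial>M) - 2 * d n * (\<integral>x. Z x * U n x * ?v x \<partial>M)
          + (\<integral>x. Z x * (?D x)^2 \<partial>M)"
          unfolding eq by (rule lin[OF zu ub1 uv1 p(1)])
        then show ?thesis using ub(2) uv(2) by simp
      qed
      then show ?thesis using IH pos p(2,3) by (simp add: distrib_right)
    qed
    show ?case using 1 2 by blast
  qed
  then show "(\<integral>x. Z x * U n x \<partial>M) = 0" by blast
  show "(\<And>x. x \<in> space M \<Longrightarrow> 0 \<le> Z x) \<Longrightarrow>
      (\<Sum>i<n. (\<bar>c i\<bar> - \<bar>d i\<bar>)^2 * (q (Suc i) - q i)) * (\<integral>x. Z x \<partial>M) \<le> (\<integral>x. Z x * (U n x)^2 \<partial>M) \<and>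
      (\<integral>x. Z x * (U n x)^2 \<partial>M) \<le> (\<Sum>i<n. (\<bar>c i\<bar> + \<bar>d i\<bar>)^2 * (q (Suc i) - q i)) * (\<integral>x. Z x \<partial>M)"
    using main by blast
qed

end

section \<open>Refining grids\<close>

lemma enumerate_finite_set:
  fixes Q :: "real set"
  assumes "finite Q" "Q \<noteq> {}"
  shows "\<exists>N q. q ` {..N} = Q \<and> (\<forall>i<N. q i < q (Suc i))"
proof (intro exI conjI allI impI)
  let ?xs = "sorted_list_of_set Q"
  have "length ?xs = card Q" by simp
  moreover have "card Q > 0" using assms by (simp add: card_gt_0_iff)
  ultimately have "{..length ?xs - 1} = {0..<length ?xs}" by auto
  moreover have "(!) ?xs ` {0..<length ?xs} = set ?xs"
    by (subst nth_image) simp_all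
  ultimately show "(!) ?xs ` {..length ?xs - 1} = Q"
    using assms(1) by simp
  show "?xs ! i < ?xs ! Suc i" if "i < length ?xs - 1" for i
    using sorted_wrt_nth_less[where P="(<)" and xs="?xs" and i=i and j="Suc i"]
      strict_sorted_list_of_set that by simp
qed

lemma strict_grid_less:
  fixes q :: "nat \<Rightarrow> real"
  assumes q: "\<forall>i<N. q i < q (Suc i)"
  shows "j < k \<Longrightarrow> k \<le> N \<Longrightarrow> q j < q k"
proof (induction k)
  case (Suc k)
  show ?case
  proof (cases "j = k")
    case True
    then show ?thesis using q Suc by simp
  next
    case False
    then have "q j < q k" using Suc by simp
    also have "q k < q (Suc k)" using q Suc by simp
    finally show ?thesis .
  qed
qed simp

text \<open>
  Two step functions, given on unrelated partitions, are brought to one strictly increasing grid,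
  on which they can be added and on which the two drivers can be compared step by step.
\<close>

lemma common_grid:
  assumes p: "grid s t n p" and p': "grid s t n' p'" and E: "finite E" "E \<subseteq> {s..t}"
  obtains N q where "grid s t N q" "\<forall>i<N. q i < q (Suc i)"
    "p ` {..n} \<subseteq> q ` {..N}" "p' ` {..n'} \<subseteq> q ` {..N}" "E \<subseteq> q ` {..N}"
proof -
  obtain N q where q: "q ` {..N} = p ` {..n} \<union> p' ` {..n'} \<union> E" "\<forall>i<N. q i < q (Suc i)"
  proof -
    have "finite (p ` {..n} \<union> p' ` {..n'} \<union> E)" "p ` {..n} \<union> p' ` {..n'} \<union> E \<noteq> {}"
      using E(1) by auto
    from enumerate_finite_set[OF this] show ?thesis using that by blast
  qed
  have b: "s \<le> q i \<and> q i \<le> t" if "i \<le> N" for i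
  proof -
    have "q i \<in> q ` {..N}" using that by simp
    then show ?thesis unfolding q(1) using grid_bounds[OF p] grid_bounds[OF p'] E(2) by auto
  qed
  have "grid s t N q" unfolding grid_def using b[of 0] b[of N] q(2) less_imp_le by blast
  then show ?thesis using that[of N q] q by blast
qed

lemma increment_refine:
  fixes q :: "nat \<Rightarrow> real" and w :: "real \<Rightarrow> real"
  assumes q: "\<forall>i<N. q i < q (Suc i)" and jk: "j \<le> k" "k \<le> N"
  shows "w (q k) - w (q j) = (\<Sum>i<N. indicator {q j<..q k} (q (Suc i)) * (w (q (Suc i)) - w (q i)))"
proof -
  note less = strict_grid_less[OF q]
  have "indicator {q j<..q k} (q (Suc i)) = (if j \<le> i \<and> i < k then 1 else 0::real)" if "i < N" for i
  proof -
    have 1: "q j < q (Suc i) \<longleftrightarrow> j \<le> i"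
    proof (cases "j \<le> i")
      case True
      then show ?thesis using less[of j "Suc i"] that by simp
    next
      case False
      then have "q (Suc i) \<le> q j" using less[of "Suc i" j] jk by (cases "Suc i = j") auto
      then show ?thesis using False by simp
    qed
    have 2: "q (Suc i) \<le> q k \<longleftrightarrow> i < k"
    proof (cases "i < k")
      case True
      then have "q (Suc i) \<le> q k" using less[of "Suc i" k] jk by (cases "Suc i = k") auto
      then show ?thesis using True by simp
    next
      case False
      then show ?thesis using less[of k "Suc i"] that by simp
    qed
    show ?thesis using 1 2 by (simp add: indicator_def)
  qed
  then have "(\<Sum>i<N. indicator {q j<..q k} (q (Suc i)) * (w (q (Suc i)) - w (q i)))
    = (\<Sum>i<N. if j \<le> i \<and> i < k then w (q (Suc i)) - w (q i) else 0)"
    by (intro sum.cong) simp_all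
  also have "\<dots> = (\<Sum>i\<in>{i \<in> {..<N}. j \<le> i \<and> i < k}. w (q (Suc i)) - w (q i))"
    by (rule sum.inter_filter[symmetric]) simp
  also have "{i \<in> {..<N}. j \<le> i \<and> i < k} = {j..<k}" using jk by auto
  also have "(\<Sum>i\<in>{j..<k}. w (q (Suc i)) - w (q i)) = w (q k) - w (q j)"
    by (rule sum_Suc_diff'[OF jk(1)])
  finally show ?thesis ..
qed

text \<open>
  The coefficient on a step of the finer grid is the value of the step function at its right end
  point. Each coarse increment telescopes along the finer grid, so the integrals agree pointwise.
\<close>

lemma step_integral_refine:
  assumes p: "grid s t n p" and q: "\<forall>i<N. q i < q (Suc i)" and sub: "p ` {..n} \<subseteq> q ` {..N}"
  shows "step_integral W N q (\<lambda>i. step_fun n p c (q (Suc i))) x = step_integral W n p c x"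
proof -
  have *: "W (p (Suc l)) x - W (p l) x
    = (\<Sum>i<N. indicator {p l<..p (Suc l)} (q (Suc i)) * (W (q (Suc i)) x - W (q i) x))" if l: "l < n" for l
  proof -
    have "p l \<in> q ` {..N}" "p (Suc l) \<in> q ` {..N}" using sub l by auto
    then obtain j k where jk: "j \<le> N" "p l = q j" "k \<le> N" "p (Suc l) = q k" by auto
    have "p l \<le> p (Suc l)" using p l by (simp add: grid_def)
    then have "j \<le> k" using strict_grid_less[OF q, of k j] jk by (metis linorder_not_le)
    then show ?thesis using increment_refine[OF q, of j k "\<lambda>t. W t x"] jk by simp
  qed
  have "step_integral W N q (\<lambda>i. step_fun n p c (q (Suc i))) x
    = (\<Sum>i<N. \<Sum>l<n. c l * (indicator {p l<..p (Suc l)} (q (Suc i)) * (W (q (Suc i)) x - W (q i) x)))"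
    unfolding step_integral_def step_fun_def sum_distrib_right mult.assoc ..
  also have "\<dots> = (\<Sum>l<n. \<Sum>i<N. c l * (indicator {p l<..p (Suc l)} (q (Suc i)) * (W (q (Suc i)) x - W (q i) x)))"
    by (rule sum.swap)
  also have "\<dots> = step_integral W n p c x"
    unfolding step_integral_def sum_distrib_left[symmetric]
    by (rule sum.cong[OF refl]) (simp only: lessThan_iff *)
  finally show ?thesis .
qed

text \<open>
  A step function evaluated at \<open>u\<close> is the step integral against the path that jumps from \<open>0\<close> to \<open>1\<close>
  at \<open>u\<close>. This reduces the refinement of step functions to that of step integrals.
\<close>

lemma step_fun_eq_step_integral:
  assumes "grid s t n p"
  shows "step_fun n p c u = step_integral (\<lambda>r _. indicator {u..} r) n p c ()"
  unfolding step_fun_def step_integral_def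
proof (rule sum.cong[OF refl])
  fix i assume "i \<in> {..<n}"
  then have "p i \<le> p (Suc i)" using assms by (simp add: grid_def)
  then show "c i * indicator {p i<..p (Suc i)} u = c i * (indicator {u..} (p (Suc i)) - indicator {u..} (p i))"
    by (simp add: indicator_def)
qed

lemma step_fun_refine:
  assumes p: "grid s t n p" and q: "\<forall>i<N. q i < q (Suc i)" and sub: "p ` {..n} \<subseteq> q ` {..N}"
    and gq: "grid s t N q"
  shows "step_fun N q (\<lambda>i. step_fun n p c (q (Suc i))) u = step_fun n p c u"
  unfolding step_fun_eq_step_integral[OF gq] step_fun_eq_step_integral[OF p, of c u]
  by (rule step_integral_refine[OF p q sub])

lemma step_fun_linear: "step_fun n q (\<lambda>i. c i + a * d i) u = step_fun n q c u + a * step_fun n q d u"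
  unfolding step_fun_def sum_distrib_left sum.distrib[symmetric]
  by (rule sum.cong) (simp_all add: distrib_right)

lemma step_integral_linear:
  "step_integral W n q (\<lambda>i. c i + a * d i) x = step_integral W n q c x + a * step_integral W n q d x"
  unfolding step_integral_def sum_distrib_left sum.distrib[symmetric]
  by (rule sum.cong) (simp_all add: distrib_right)

lemma sum_split_shift: "(\<Sum>i<j + k. f i) = (\<Sum>i<j. f i) + (\<Sum>i<k. f (j + i) :: real)" for j k :: nat
  by (induction k) simp_all

lemma step_fun_split:
  "step_fun (j + k) q c u = step_fun j q c u + step_fun k (\<lambda>i. q (j + i)) (\<lambda>i. c (j + i)) u"
  by (simp add: step_fun_def sum_split_shift)

lemma step_integral_split:
  "step_integral W (j + k) q c x = step_integral W j q c x + step_integral W k (\<lambda>i. q (j + i)) (\<lambda>i. c (j + i)) x"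
  by (simp add: step_integral_def sum_split_shift)

section \<open>Mean square distance\<close>

text \<open>
  The squared \<open>L\<^sup>2\<close> norm. It takes values in \<open>ennreal\<close>, so that distances can be added before
  square integrability is known.
\<close>

definition sqn :: "'a measure \<Rightarrow> ('a \<Rightarrow> real) \<Rightarrow> ennreal" where
  "sqn N f = (\<integral>\<^sup>+x. ennreal ((f x)^2) \<partial>N)"

lemma sqn_mono: "(\<And>x. x \<in> space N \<Longrightarrow> \<bar>f x\<bar> \<le> \<bar>g x\<bar>) \<Longrightarrow> sqn N f \<le> sqn N g"
  unfolding sqn_def by (rule nn_integral_mono) (simp add: abs_le_square_iff)

lemma sqn_cong: "(\<And>x. x \<in> space N \<Longrightarrow> f x = g x) \<Longrightarrow> sqn N f = sqn N g"
  unfolding sqn_def by (rule nn_integral_cong) simp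

lemma sqn_cmult: "sqn N (\<lambda>x. a * f x) = ennreal (a^2) * sqn N f" if "f \<in> borel_measurable N"
proof -
  have "(\<lambda>x. ennreal ((f x)^2)) \<in> borel_measurable N" using that by measurable
  then show ?thesis
    unfolding sqn_def by (simp add: power_mult_distrib ennreal_mult nn_integral_cmult)
qed

lemma sqn_add_le:
  assumes "f \<in> borel_measurable N" "g \<in> borel_measurable N"
    and "sqn N f \<le> ennreal a" "sqn N g \<le> ennreal b" "0 \<le> a" "0 \<le> b"
  shows "sqn N (\<lambda>x. f x + g x) \<le> ennreal (2 * (a + b))"
proof -
  have m: "(\<lambda>x. ennreal ((f x)^2)) \<in> borel_measurable N" "(\<lambda>x. ennreal ((g x)^2)) \<in> borel_measurable N"
    using assms by measurable
  have pt: "(p + q)^2 \<le> 2 * (p^2 + q^2)" for p q :: real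
    using zero_le_power2[of "p - q"] by (simp add: power2_diff power2_sum)
  have "sqn N (\<lambda>x. f x + g x) \<le> (\<integral>\<^sup>+x. ennreal 2 * (ennreal ((f x)^2) + ennreal ((g x)^2)) \<partial>N)"
    unfolding sqn_def
  proof (rule nn_integral_mono)
    fix x
    have "ennreal ((f x + g x)^2) \<le> ennreal (2 * ((f x)^2 + (g x)^2))"
      by (rule ennreal_leI[OF pt])
    also have "\<dots> = ennreal 2 * (ennreal ((f x)^2) + ennreal ((g x)^2))"
      by (subst ennreal_mult) (auto simp: ennreal_plus)
    finally show "ennreal ((f x + g x)^2) \<le> ennreal 2 * (ennreal ((f x)^2) + ennreal ((g x)^2))" .
  qed
  also have "\<dots> = ennreal 2 * (sqn N f + sqn N g)"
    unfolding sqn_def by (subst nn_integral_cmult, use m in measurable, subst nn_integral_add[OF m], rule refl)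
  also have "\<dots> \<le> ennreal 2 * (ennreal a + ennreal b)"
    using assms by (intro mult_left_mono add_mono) auto
  also have "\<dots> = ennreal (2 * (a + b))"
    using assms by (subst ennreal_mult) (auto simp: ennreal_plus)
  finally show ?thesis .
qed

lemma sqn_uminus: "sqn N (\<lambda>x. - f x) = sqn N f"
  by (simp add: sqn_def)

lemma sqn_eq_integral: "integrable N (\<lambda>x. (f x)^2) \<Longrightarrow> sqn N f = ennreal (\<integral>x. (f x)^2 \<partial>N)"
  unfolding sqn_def by (rule nn_integral_eq_integral) simp_all

lemma sqn_finite_integrable:
  assumes "f \<in> borel_measurable N" "sqn N f \<le> ennreal a"
  shows "integrable N (\<lambda>x. (f x)^2)"
proof (rule integrableI_nonneg)
  show "(\<integral>\<^sup>+x. ennreal ((f x)^2) \<partial>N) < \<infinity>"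
    using assms(2) unfolding sqn_def by (rule le_less_trans) simp
qed (use assms in simp_all)

lemma sqn_win:
  "sqn (win s t) f = (\<integral>\<^sup>+u. ennreal ((f u)^2) * indicator {s<..t} u \<partial>lborel)"
  unfolding sqn_def by (rule nn_integral_restrict_space) simp

lemma sqn_win_mono: "{s<..t} \<subseteq> {s'<..t'} \<Longrightarrow> sqn (win s t) f \<le> sqn (win s' t') f"
  unfolding sqn_win by (rule nn_integral_mono) (auto simp: indicator_def)

lemma win_measurable: "f \<in> borel_measurable borel \<Longrightarrow> f \<in> borel_measurable (win s t)"
  for f :: "real \<Rightarrow> real"
  by (rule measurable_restrict_space1) simp

lemma sqn_step_fun:
  assumes "grid s t n q"
  shows "sqn (win s t) (step_fun n q c) = ennreal (\<Sum>i<n. (c i)^2 * (q (Suc i) - q i))"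
proof -
  have "(\<lambda>u. (step_fun n q c u)^2) = step_fun n q (\<lambda>i. (c i)^2)"
    using step_fun_comp[OF assms, of "\<lambda>a b. a^2" c _ c] by auto
  then show ?thesis
    using sqn_eq_integral[of "win s t" "step_fun n q c"] integral_step_fun[OF assms, of "\<lambda>i. (c i)^2"] by simp
qed

lemma sqrt_bound: "\<bar>u\<bar> \<le> e + u^2 / e" if "e > 0" for e u :: real
proof -
  have "2 * (e * \<bar>u\<bar>) \<le> e^2 + u^2"
    using zero_le_power2[of "e - \<bar>u\<bar>"] by (simp add: power2_diff)
  moreover have "0 \<le> e * \<bar>u\<bar>" using that by simp
  ultimately have "e * \<bar>u\<bar> \<le> e^2 + u^2" by linarith
  then have "\<bar>u\<bar> \<le> (e^2 + u^2) / e" using that by (simp add: pos_le_divide_eq mult.commute)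
  then show ?thesis using that by (simp add: add_divide_distrib power2_eq_square)
qed

definition eps :: "nat \<Rightarrow> real" where "eps k = inverse (real (Suc k))"

lemma eps: "eps k > 0" "eps \<longlonglongrightarrow> 0" "(\<lambda>k. sqrt (eps k)) \<longlonglongrightarrow> 0"
proof -
  show "eps k > 0" by (simp add: eps_def)
  show e: "eps \<longlonglongrightarrow> 0" unfolding eps_def by (rule LIMSEQ_inverse_real_of_nat)
  show "(\<lambda>k. sqrt (eps k)) \<longlonglongrightarrow> 0" using tendsto_real_sqrt[OF e] by simp
qed

text \<open>
  The pointwise bound \<open>\<bar>q\<^sup>2 - p\<^sup>2\<bar> \<le> (1 + 1/h) (p - q)\<^sup>2 + h p\<^sup>2\<close> is integrated with \<open>h = sqrt (eps k)\<close>,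
  which balances the two terms.
\<close>

lemma L2_limit_square:
  fixes D Z :: "'b \<Rightarrow> real"
  assumes D: "D \<in> borel_measurable N" and U: "\<And>k. U k \<in> borel_measurable N"
    and Z: "Z \<in> borel_measurable N" "\<And>x. x \<in> space N \<Longrightarrow> \<bar>Z x\<bar> \<le> K"
    and U2: "\<And>k. integrable N (\<lambda>x. (U k x)^2)"
    and lim: "\<And>k. sqn N (\<lambda>x. D x - U k x) \<le> ennreal (eps k)"
  shows "integrable N (\<lambda>x. (D x)^2)"
    "(\<lambda>k. \<integral>x. Z x * (U k x)^2 \<partial>N) \<longlonglongrightarrow> (\<integral>x. Z x * (D x)^2 \<partial>N)"
proof -
  have dm: "(\<lambda>x. D x - U k x) \<in> borel_measurable N" for k using D U by simp
  have d2: "integrable N (\<lambda>x. (D x - U k x)^2)" for k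
    by (rule sqn_finite_integrable[OF dm lim])
  have d2e: "(\<integral>x. (D x - U k x)^2 \<partial>N) \<le> eps k" for k
    using lim[of k] eps(1)[of k] unfolding sqn_eq_integral[OF d2] by simp
  have "integrable N (\<lambda>x. 2 * ((D x - U 0 x)^2 + (U 0 x)^2))" using d2[of 0] U2[of 0] by simp
  then show D2: "integrable N (\<lambda>x. (D x)^2)"
  proof (rule Bochner_Integration.integrable_bound)
    have "(p::real)^2 \<le> 2 * ((p - q)^2 + q^2)" for p q
      using zero_le_power2[of "p - 2 * q"] by (simp add: power2_eq_square algebra_simps)
    then show "AE x in N. norm ((D x)^2) \<le> norm (2 * ((D x - U 0 x)^2 + (U 0 x)^2))"
      by (intro AE_I2) simp
  qed (use D in simp)
  have ZI: "integrable N (\<lambda>x. Z x * f x)" if "integrable N f" for f :: "'b \<Rightarrow> real"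
  proof (rule Bochner_Integration.integrable_bound)
    show "integrable N (\<lambda>x. K * f x)" using that by simp
    show "(\<lambda>x. Z x * f x) \<in> borel_measurable N" using that Z by simp
    show "AE x in N. norm (Z x * f x) \<le> norm (K * f x)"
      by (intro AE_I2) (use Z(2) in \<open>auto simp: abs_mult intro!: mult_right_mono intro: order_trans[OF _ abs_ge_self]\<close>)
  qed
  define E where "E = (\<integral>x. (D x)^2 \<partial>N)"
  have E0: "0 \<le> E" unfolding E_def by (rule Bochner_Integration.integral_nonneg) simp
  have bound: "\<bar>(\<integral>x. Z x * (U k x)^2 \<partial>N) - (\<integral>x. Z x * (D x)^2 \<partial>N)\<bar>
      \<le> \<bar>K\<bar> * (eps k + sqrt (eps k) + sqrt (eps k) * E)" for k
  proof -
    define h where "h = sqrt (eps k)"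
    have h: "h > 0" "h^2 = eps k" using eps(1)[of k] by (auto simp: h_def)
    have pt: "\<bar>q^2 - p^2\<bar> \<le> (1 + 1 / h) * (p - q)^2 + h * p^2" for p q :: real
    proof -
      have "\<bar>q^2 - p^2\<bar> = \<bar>(p - q)^2 - 2 * (p * (p - q))\<bar>"
        by (simp add: power2_eq_square algebra_simps)
      also have "\<dots> \<le> (p - q)^2 + 2 * \<bar>p * (p - q)\<bar>"
        using abs_triangle_ineq4[of "(p - q)^2" "2 * (p * (p - q))"] by simp
      also have "2 * \<bar>p * (p - q)\<bar> \<le> h * p^2 + (p - q)^2 / h"
      proof -
        have "0 \<le> (h * \<bar>p\<bar> - \<bar>p - q\<bar>)^2 / h" using h by simp
        also have "\<dots> = h * p^2 + (p - q)^2 / h - 2 * \<bar>p * (p - q)\<bar>"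
        proof -
          have "(h * a - b)^2 / h = h * a^2 + b^2 / h - 2 * (a * b)" for a b :: real
            using h by (simp add: field_simps power2_eq_square)
          from this[of "\<bar>p\<bar>" "\<bar>p - q\<bar>"] show ?thesis by (simp add: abs_mult)
        qed
        finally show ?thesis by simp
      qed
      finally show ?thesis by (simp add: distrib_right)
    qed
    have "(\<integral>x. Z x * (U k x)^2 \<partial>N) - (\<integral>x. Z x * (D x)^2 \<partial>N) = (\<integral>x. Z x * ((U k x)^2 - (D x)^2) \<partial>N)"
      using ZI[OF U2[of k]] ZI[OF D2] by (simp add: right_diff_distrib)
    also have "\<bar>\<dots>\<bar> \<le> (\<integral>x. \<bar>K\<bar> * ((1 + 1 / h) * (D x - U k x)^2 + h * (D x)^2) \<partial>N)"
    proof (rule integral_abs_bound[THEN order_trans], rule integral_mono)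
      show "integrable N (\<lambda>x. \<bar>Z x * ((U k x)^2 - (D x)^2)\<bar>)"
        by (intro Bochner_Integration.integrable_abs ZI Bochner_Integration.integrable_diff U2 D2)
      show "integrable N (\<lambda>x. \<bar>K\<bar> * ((1 + 1 / h) * (D x - U k x)^2 + h * (D x)^2))"
        by (intro integrable_mult_right Bochner_Integration.integrable_add d2 D2)
      fix x assume x: "x \<in> space N"
      have "\<bar>Z x\<bar> \<le> \<bar>K\<bar>" using Z(2)[OF x] by linarith
      then show "\<bar>Z x * ((U k x)^2 - (D x)^2)\<bar> \<le> \<bar>K\<bar> * ((1 + 1 / h) * (D x - U k x)^2 + h * (D x)^2)"
        unfolding abs_mult using pt[of "U k x" "D x"] by (intro mult_mono) auto
    qed
    also have "\<dots> = \<bar>K\<bar> * ((1 + 1 / h) * (\<integral>x. (D x - U k x)^2 \<partial>N) + h * E)"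
      using d2[of k] D2 by (simp add: E_def)
    also have "\<dots> \<le> \<bar>K\<bar> * ((1 + 1 / h) * eps k + h * E)"
      using d2e[of k] h by (intro mult_left_mono add_right_mono) auto
    also have "(1 + 1 / h) * eps k = eps k + h"
      using h by (simp add: distrib_right flip: h(2)) (simp add: power2_eq_square)
    finally show ?thesis by (simp add: h_def)
  qed
  show "(\<lambda>k. \<integral>x. Z x * (U k x)^2 \<partial>N) \<longlonglongrightarrow> (\<integral>x. Z x * (D x)^2 \<partial>N)"
  proof (rule LIM_zero_cancel, rule Lim_null_comparison)
    have "(\<lambda>k. \<bar>K\<bar> * (eps k + sqrt (eps k) + sqrt (eps k) * E)) \<longlonglongrightarrow> \<bar>K\<bar> * (0 + 0 + 0 * E)"
      by (intro tendsto_intros eps)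
    then show "(\<lambda>k. \<bar>K\<bar> * (eps k + sqrt (eps k) + sqrt (eps k) * E)) \<longlonglongrightarrow> 0" by simp
    show "\<forall>\<^sub>F k in sequentially. norm ((\<integral>x. Z x * (U k x)^2 \<partial>N) - (\<integral>x. Z x * (D x)^2 \<partial>N))
        \<le> \<bar>K\<bar> * (eps k + sqrt (eps k) + sqrt (eps k) * E)"
      using bound by simp
  qed
qed

lemma (in prob_space) L2_limit_first:
  fixes D Z :: "'a \<Rightarrow> real"
  assumes D: "D \<in> borel_measurable M" and U: "\<And>k. U k \<in> borel_measurable M"
    and lim: "\<And>k. sqn M (\<lambda>x. D x - U k x) \<le> ennreal (eps k)"
  shows "integrable M (\<lambda>x. D x - U k x)"
    "(\<lambda>k. \<integral>x. \<bar>D x - U k x\<bar> \<partial>M) \<longlonglongrightarrow> 0"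
proof -
  have dm: "(\<lambda>x. D x - U k x) \<in> borel_measurable M" for k using D U by simp
  have d2: "integrable M (\<lambda>x. (D x - U k x)^2)" for k
    by (rule sqn_finite_integrable[OF dm lim])
  have d2e: "(\<integral>x. (D x - U k x)^2 \<partial>M) \<le> eps k" for k
    using lim[of k] eps(1)[of k] unfolding sqn_eq_integral[OF d2] by simp
  have d1: "integrable M (\<lambda>x. D x - U k x)" for k
  proof (rule Bochner_Integration.integrable_bound)
    show "integrable M (\<lambda>x. 1 + (D x - U k x)^2 / 1)" using d2[of k] by simp
    show "AE x in M. norm (D x - U k x) \<le> norm (1 + (D x - U k x)^2 / 1)"
    proof (rule AE_I2)
      fix x show "norm (D x - U k x) \<le> norm (1 + (D x - U k x)^2 / 1)"
        using sqrt_bound[of 1 "D x - U k x"] by simp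
    qed
  qed (rule dm)
  show "integrable M (\<lambda>x. D x - U k x)" by (rule d1)
  have b: "(\<integral>x. \<bar>D x - U k x\<bar> \<partial>M) \<le> 2 * sqrt (eps k)" for k
  proof -
    define h where "h = sqrt (eps k)"
    have h: "h > 0" "h^2 = eps k" using eps(1)[of k] by (auto simp: h_def)
    have "(\<integral>x. \<bar>D x - U k x\<bar> \<partial>M) \<le> (\<integral>x. h + (D x - U k x)^2 / h \<partial>M)"
      using d1[of k] d2[of k] sqrt_bound[OF h(1)] by (intro integral_mono) auto
    also have "\<dots> = h + (\<integral>x. (D x - U k x)^2 \<partial>M) / h" using d2[of k] by (simp add: prob_space)
    also have "\<dots> \<le> h + eps k / h" using d2e[of k] h by (intro add_left_mono divide_right_mono) auto
    also have "eps k / h = h" using h by (simp add: power2_eq_square flip: h(2))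
    finally show ?thesis by (simp add: h_def)
  qed
  show "(\<lambda>k. \<integral>x. \<bar>D x - U k x\<bar> \<partial>M) \<longlonglongrightarrow> 0"
  proof (rule Lim_null_comparison)
    show "\<forall>\<^sub>F k in sequentially. norm (\<integral>x. \<bar>D x - U k x\<bar> \<partial>M) \<le> 2 * sqrt (eps k)"
      using b by simp
    show "(\<lambda>k. 2 * sqrt (eps k)) \<longlonglongrightarrow> 0" using tendsto_mult_left[OF eps(3), of 2] by simp
  qed
qed

section \<open>Wiener integrals\<close>

text \<open>
  \<open>X\<close> is the integral of \<open>f\<close> against \<open>W\<close> over the window from \<open>s\<close> to \<open>t\<close>. The step functions are
  required to live on the same window, which makes the integral depend only on increments of \<open>W\<close>
  after \<open>s\<close>. The definition makes sense for any process \<open>W\<close>, in particular for one that is itself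
  a stochastic integral.
\<close>

definition wiener_integral ::
  "'a measure \<Rightarrow> (real \<Rightarrow> 'a \<Rightarrow> real) \<Rightarrow> real \<Rightarrow> real \<Rightarrow> (real \<Rightarrow> real) \<Rightarrow> ('a \<Rightarrow> real) \<Rightarrow> bool" where
  "wiener_integral M W s t f X \<longleftrightarrow> X \<in> borel_measurable M \<and> f \<in> borel_measurable borel \<and>
    (\<forall>e>0. \<exists>n p c. grid s t n p \<and>
      sqn (win s t) (\<lambda>u. f u - step_fun n p c u) \<le> ennreal e \<and>
      sqn M (\<lambda>x. X x - step_integral W n p c x) \<le> ennreal e)"

lemma wiener_integralD:
  assumes "wiener_integral M W s t f X"
  shows "X \<in> borel_measurable M" "f \<in> borel_measurable borel"
    "e > 0 \<Longrightarrow> \<exists>n p c. grid s t n p \<and> sqn (win s t) (\<lambda>u. f u - step_fun n p c u) \<le> ennreal e \<and>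
      sqn M (\<lambda>x. X x - step_integral W n p c x) \<le> ennreal e"
  using assms unfolding wiener_integral_def by blast+

lemma wiener_integral_of_stochastic_integral:
  assumes I: "stochastic_integral M W f I" and f0: "f0 \<in> borel_measurable borel" "\<And>u. 0 \<le> u \<Longrightarrow> f0 u = f u"
    and t: "0 \<le> t"
  shows "wiener_integral M W 0 t f0 (I t)"
  unfolding wiener_integral_def
proof (intro conjI allI impI)
  show "I t \<in> borel_measurable M" using I t by (simp add: stochastic_integral_def)
  show "f0 \<in> borel_measurable borel" by (rule f0)
  fix e :: real assume e: "e > 0"
  obtain n p c where k: "\<And>k. partition_of t (n k) (p k)"
    and l1: "(\<lambda>k. \<integral>\<^sup>+s\<in>{0..t}. ennreal ((f s - step_fun (n k) (p k) (c k) s)\<^sup>2) \<partial>lborel) \<longlonglongrightarrow> 0"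
    and l2: "(\<lambda>k. \<integral>\<^sup>+x. ennreal ((I t x - step_integral W (n k) (p k) (c k) x)\<^sup>2) \<partial>M) \<longlonglongrightarrow> 0"
    using I t unfolding stochastic_integral_def by blast
  have "0 < ennreal e" using e by simp
  from order_tendstoD(2)[OF l1 this] order_tendstoD(2)[OF l2 this]
  have "\<forall>\<^sub>F k in sequentially. (\<integral>\<^sup>+s\<in>{0..t}. ennreal ((f s - step_fun (n k) (p k) (c k) s)\<^sup>2) \<partial>lborel) < ennreal e
    \<and> (\<integral>\<^sup>+x. ennreal ((I t x - step_integral W (n k) (p k) (c k) x)\<^sup>2) \<partial>M) < ennreal e"
    by eventually_elim simp
  then obtain k where k1: "(\<integral>\<^sup>+s\<in>{0..t}. ennreal ((f s - step_fun (n k) (p k) (c k) s)\<^sup>2) \<partial>lborel) < ennreal e"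
    and k2: "(\<integral>\<^sup>+x. ennreal ((I t x - step_integral W (n k) (p k) (c k) x)\<^sup>2) \<partial>M) < ennreal e"
    unfolding eventually_sequentially by blast
  have g: "grid 0 t (n k) (p k)" using k[of k] by (simp add: grid_def partition_of_def)
  have "sqn (win 0 t) (\<lambda>u. f0 u - step_fun (n k) (p k) (c k) u)
    \<le> (\<integral>\<^sup>+s\<in>{0..t}. ennreal ((f s - step_fun (n k) (p k) (c k) s)\<^sup>2) \<partial>lborel)"
    unfolding sqn_win by (rule nn_integral_mono) (auto simp: indicator_def f0)
  then show "\<exists>n p c. grid 0 t n p \<and> sqn (win 0 t) (\<lambda>u. f0 u - step_fun n p c u) \<le> ennreal e \<and>
      sqn M (\<lambda>x. I t x - step_integral W n p c x) \<le> ennreal e"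
    using k1 k2 g unfolding sqn_def by (meson order_trans less_imp_le)
qed

lemma wiener_integral_zero: "s \<le> t \<Longrightarrow> wiener_integral M W s t (\<lambda>_. 0) (\<lambda>_. 0)"
  unfolding wiener_integral_def
  by (intro conjI allI impI exI[of _ 0] exI[of _ "\<lambda>_. s"])
    (auto simp: grid_def sqn_def step_fun_def step_integral_def)

lemma wiener_integral_extend:
  assumes W: "wiener_integral M W s t f X" and "s' \<le> s" "t \<le> t'"
  shows "wiener_integral M W s' t' (\<lambda>u. f u * indicator {s<..t} u) X"
  unfolding wiener_integral_def
proof (intro conjI allI impI)
  show "X \<in> borel_measurable M" using wiener_integralD(1)[OF W] .
  show "(\<lambda>u. f u * indicator {s<..t} u) \<in> borel_measurable borel"
    using wiener_integralD(2)[OF W] by simp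
  fix e :: real assume "e > 0"
  then obtain n p c where g: "grid s t n p" and a: "sqn (win s t) (\<lambda>u. f u - step_fun n p c u) \<le> ennreal e"
    and b: "sqn M (\<lambda>x. X x - step_integral W n p c x) \<le> ennreal e"
    using wiener_integralD(3)[OF W] by blast
  have "sqn (win s' t') (\<lambda>u. f u * indicator {s<..t} u - step_fun n p c u) = sqn (win s t) (\<lambda>u. f u - step_fun n p c u)"
    unfolding sqn_win
  proof (rule nn_integral_cong)
    fix u
    show "ennreal ((f u * indicator {s<..t} u - step_fun n p c u)^2) * indicator {s'<..t'} u
      = ennreal ((f u - step_fun n p c u)^2) * indicator {s<..t} u"
      using step_fun_outside[OF g, of u c] assms(2,3) by (cases "u \<in> {s<..t}") simp_all
  qed
  then show "\<exists>n p c. grid s' t' n p \<and>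
      sqn (win s' t') (\<lambda>u. f u * indicator {s<..t} u - step_fun n p c u) \<le> ennreal e \<and>
      sqn M (\<lambda>x. X x - step_integral W n p c x) \<le> ennreal e"
    using a b grid_widen[OF g assms(2,3)] by metis
qed

lemma wiener_integral_pair:
  assumes X: "wiener_integral M W s t f X" and Y: "wiener_integral M W' s t g Y" and e: "e > 0"
  obtains N q c d where "grid s t N q"
    "sqn (win s t) (\<lambda>u. f u - step_fun N q c u) \<le> ennreal e" "sqn (win s t) (\<lambda>u. g u - step_fun N q d u) \<le> ennreal e"
    "sqn M (\<lambda>x. X x - step_integral W N q c x) \<le> ennreal e" "sqn M (\<lambda>x. Y x - step_integral W' N q d x) \<le> ennreal e"
proof -
  obtain n p c where p: "grid s t n p" and a: "sqn (win s t) (\<lambda>u. f u - step_fun n p c u) \<le> ennreal e"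
    "sqn M (\<lambda>x. X x - step_integral W n p c x) \<le> ennreal e"
    using wiener_integralD(3)[OF X e] by blast
  obtain n' p' c' where p': "grid s t n' p'" and a': "sqn (win s t) (\<lambda>u. g u - step_fun n' p' c' u) \<le> ennreal e"
    "sqn M (\<lambda>x. Y x - step_integral W' n' p' c' x) \<le> ennreal e"
    using wiener_integralD(3)[OF Y e] by blast
  obtain N q where q: "grid s t N q" and st: "\<forall>i<N. q i < q (Suc i)"
    and sub: "p ` {..n} \<subseteq> q ` {..N}" "p' ` {..n'} \<subseteq> q ` {..N}"
    using common_grid[OF p p', of "{}"] by auto
  show ?thesis
    using that[OF q, of "\<lambda>i. step_fun n p c (q (Suc i))" "\<lambda>i. step_fun n' p' c' (q (Suc i))"] a a'
    unfolding step_fun_refine[OF p st sub(1) q] step_fun_refine[OF p' st sub(2) q]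
      step_integral_refine[OF p st sub(1)] step_integral_refine[OF p' st sub(2)] by blast
qed

context filtered
begin

lemma step_integral_isometry:
  assumes "brownian_motion M F W" "0 \<le> s" "grid s t n q"
  shows "sqn M (step_integral W n q c) = sqn (win s t) (step_fun n q c)"
  unfolding sqn_step_fun[OF assms(3)] step_integral_fourth(2)[OF assms, symmetric]
  by (rule sqn_eq_integral, rule integrable_powers_of_fourth(2)[OF step_integral_measurable_M[OF assms]
        step_integral_fourth(1)[OF assms]])

lemma wiener_integral_linear:
  assumes bm: "brownian_motion M F W" and s: "0 \<le> s"
    and X: "wiener_integral M W s t f X" and Y: "wiener_integral M W s t g Y"
  shows "wiener_integral M W s t (\<lambda>u. f u + a * g u) (\<lambda>x. X x + a * Y x)"
  unfolding wiener_integral_def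
proof (intro conjI allI impI)
  have XM: "X \<in> borel_measurable M" and YM: "Y \<in> borel_measurable M"
    and f: "f \<in> borel_measurable borel" and g: "g \<in> borel_measurable borel"
    using wiener_integralD[OF X] wiener_integralD[OF Y] by blast+
  show "(\<lambda>x. X x + a * Y x) \<in> borel_measurable M" using XM YM by simp
  show "(\<lambda>u. f u + a * g u) \<in> borel_measurable borel" using f g by simp
  fix e :: real assume e: "e > 0"
  \<comment> \<open>The error of the sum is at most twice the sum of \<open>e'\<close> and \<open>a\<^sup>2 e'\<close>.\<close>
  define e' where "e' = e / (2 * (1 + a^2))"
  have pos: "0 < 1 + a^2" by (simp add: add_pos_nonneg)
  have "2 * (e' + a^2 * e') = (2 * (1 + a^2)) * e'" by (simp add: algebra_simps)
  also have "\<dots> = e" unfolding e'_def using pos by simp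
  finally have e': "e' > 0" "2 * (e' + a^2 * e') = e"
    using e pos by (simp_all add: e'_def)
  obtain N q c d where q: "grid s t N q"
    and l: "sqn (win s t) (\<lambda>u. f u - step_fun N q c u) \<le> ennreal e'" "sqn (win s t) (\<lambda>u. g u - step_fun N q d u) \<le> ennreal e'"
    and r: "sqn M (\<lambda>x. X x - step_integral W N q c x) \<le> ennreal e'" "sqn M (\<lambda>x. Y x - step_integral W N q d x) \<le> ennreal e'"
    by (rule wiener_integral_pair[OF X Y e'(1)])
  have scale: "sqn L (\<lambda>x. a * h x) \<le> ennreal (a^2 * e')"
    if "sqn L h \<le> ennreal e'" "h \<in> borel_measurable L" for L :: "'b measure" and h
  proof -
    have "sqn L (\<lambda>x. a * h x) = ennreal (a^2) * sqn L h" by (rule sqn_cmult[OF that(2)])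
    also have "\<dots> \<le> ennreal (a^2) * ennreal e'" by (rule mult_left_mono[OF that(1)]) simp
    also have "\<dots> = ennreal (a^2 * e')" by (rule ennreal_mult[symmetric]) (use e' in auto)
    finally show ?thesis .
  qed
  have m: "(\<lambda>u. f u - step_fun N q c u) \<in> borel_measurable (win s t)" "(\<lambda>u. g u - step_fun N q d u) \<in> borel_measurable (win s t)"
    by (rule win_measurable; use f g in simp)+
  have mM: "(\<lambda>x. X x - step_integral W N q c x) \<in> borel_measurable M" "(\<lambda>x. Y x - step_integral W N q d x) \<in> borel_measurable M"
    by (intro borel_measurable_diff XM YM step_integral_measurable_M[OF bm s q])+
  have ma: "(\<lambda>x. a * h x) \<in> borel_measurable L" if "h \<in> borel_measurable L" for L :: "'b measure" and h :: "'b \<Rightarrow> real"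
    using that by simp
  have nn: "0 \<le> e'" "0 \<le> a^2 * e'" using e' by simp_all
  have lin: "(p + a * q) - (p' + a * q') = (p - p') + a * (q - q')" for p q p' q' :: real
    by (simp add: algebra_simps)
  show "\<exists>n p c. grid s t n p \<and> sqn (win s t) (\<lambda>u. f u + a * g u - step_fun n p c u) \<le> ennreal e \<and>
      sqn M (\<lambda>x. X x + a * Y x - step_integral W n p c x) \<le> ennreal e"
  proof (intro exI conjI)
    show "grid s t N q" by (rule q)
    show "sqn (win s t) (\<lambda>u. f u + a * g u - step_fun N q (\<lambda>i. c i + a * d i) u) \<le> ennreal e"
      unfolding step_fun_linear lin e'(2)[symmetric]
      by (rule sqn_add_le[OF m(1) ma[OF m(2)] l(1) scale[OF l(2) m(2)] nn])
    show "sqn M (\<lambda>x. X x + a * Y x - step_integral W N q (\<lambda>i. c i + a * d i) x) \<le> ennreal e"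
      unfolding step_integral_linear lin e'(2)[symmetric]
      by (rule sqn_add_le[OF mM(1) ma[OF mM(2)] r(1) scale[OF r(2) mM(2)] nn])
  qed
qed

lemma wiener_integral_closed:
  assumes bm: "brownian_motion M F W" and s: "0 \<le> s"
    and X: "X \<in> borel_measurable M" and f: "f \<in> borel_measurable borel"
    and approx: "\<And>e. e > 0 \<Longrightarrow> \<exists>g Y. wiener_integral M W s t g Y \<and>
      sqn (win s t) (\<lambda>u. f u - g u) \<le> ennreal e \<and> sqn M (\<lambda>x. X x - Y x) \<le> ennreal e"
  shows "wiener_integral M W s t f X"
  unfolding wiener_integral_def
proof (intro conjI allI impI X f)
  fix e :: real assume e: "e > 0"
  then have e4: "e / 4 > 0" by simp
  obtain g Y where Y: "wiener_integral M W s t g Y"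
    and a: "sqn (win s t) (\<lambda>u. f u - g u) \<le> ennreal (e / 4)" "sqn M (\<lambda>x. X x - Y x) \<le> ennreal (e / 4)"
    using approx[OF e4] by blast
  obtain n p c where p: "grid s t n p" and b: "sqn (win s t) (\<lambda>u. g u - step_fun n p c u) \<le> ennreal (e / 4)"
    "sqn M (\<lambda>x. Y x - step_integral W n p c x) \<le> ennreal (e / 4)"
    using wiener_integralD(3)[OF Y e4] by blast
  have YM: "Y \<in> borel_measurable M" and g: "g \<in> borel_measurable borel" using wiener_integralD[OF Y] by blast+
  have m: "(\<lambda>u. f u - g u) \<in> borel_measurable (win s t)" "(\<lambda>u. g u - step_fun n p c u) \<in> borel_measurable (win s t)"
    by (rule win_measurable; use f g in simp)+
  have mM: "(\<lambda>x. X x - Y x) \<in> borel_measurable M" "(\<lambda>x. Y x - step_integral W n p c x) \<in> borel_measurable M"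
    by (intro borel_measurable_diff X YM step_integral_measurable_M[OF bm s p])+
  have "sqn (win s t) (\<lambda>u. f u - step_fun n p c u) \<le> ennreal e"
    using sqn_add_le[OF m a(1) b(1)] e by simp
  moreover have "sqn M (\<lambda>x. X x - step_integral W n p c x) \<le> ennreal e"
    using sqn_add_le[OF mM a(2) b(2)] e by simp
  ultimately show "\<exists>n p c. grid s t n p \<and> sqn (win s t) (\<lambda>u. f u - step_fun n p c u) \<le> ennreal e \<and>
      sqn M (\<lambda>x. X x - step_integral W n p c x) \<le> ennreal e"
    using p by blast
qed

text \<open>
  Approximations of the integrals over \<open>{0<..t}\<close> and \<open>{0<..s}\<close> are unrelated. On a common grid
  through \<open>s\<close>, the first one is cut at \<open>s\<close>. Before \<open>s\<close> both step functions are close to \<open>f\<close>, hence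
  close to each other, and by the isometry their integrals nearly cancel.
\<close>

lemma wiener_integral_increment:
  assumes bm: "brownian_motion M F W" and st: "0 \<le> s" "s \<le> t"
    and X: "wiener_integral M W 0 t f X" and X': "wiener_integral M W 0 s f X'"
  shows "wiener_integral M W s t f (\<lambda>x. X x - X' x)"
  unfolding wiener_integral_def
proof (intro conjI allI impI)
  have XM: "X \<in> borel_measurable M" and XM': "X' \<in> borel_measurable M" and f: "f \<in> borel_measurable borel"
    using wiener_integralD[OF X] wiener_integralD[OF X'] by blast+
  show "(\<lambda>x. X x - X' x) \<in> borel_measurable M" using XM XM' by simp
  show "f \<in> borel_measurable borel" by (rule f)
  fix e :: real assume e: "e > 0"
  \<comment> \<open>Four errors are added pairwise, and each addition costs a factor two per summand.\<close>
  define e' where "e' = e / 16"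
  have e': "e' > 0" using e by (simp add: e'_def)
  then have nn: "0 \<le> e'" by simp
  obtain n p c where p: "grid 0 t n p" and a: "sqn (win 0 t) (\<lambda>u. f u - step_fun n p c u) \<le> ennreal e'"
    "sqn M (\<lambda>x. X x - step_integral W n p c x) \<le> ennreal e'"
    using wiener_integralD(3)[OF X e'] by blast
  obtain n' p' c' where p': "grid 0 s n' p'" and a': "sqn (win 0 s) (\<lambda>u. f u - step_fun n' p' c' u) \<le> ennreal e'"
    "sqn M (\<lambda>x. X' x - step_integral W n' p' c' x) \<le> ennreal e'"
    using wiener_integralD(3)[OF X' e'] by blast
  have p't: "grid 0 t n' p'" using grid_widen[OF p'] st by simp
  obtain N q where q: "grid 0 t N q" and sq: "\<forall>i<N. q i < q (Suc i)"
    and sub: "p ` {..n} \<subseteq> q ` {..N}" "p' ` {..n'} \<subseteq> q ` {..N}" and sE: "{s} \<subseteq> q ` {..N}"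
    using common_grid[OF p p't, of "{s}"] st by auto
  obtain j where j: "j \<le> N" "q j = s" using sE by auto
  define k where "k = N - j"
  have N: "N = j + k" using j by (simp add: k_def)
  define d where "d i = step_fun n p c (q (Suc i))" for i
  define d' where "d' i = step_fun n' p' c' (q (Suc i))" for i
  let ?q = "\<lambda>i. q (j + i)" and ?d = "\<lambda>i. d (j + i)"
  have g1: "grid 0 s j q" using q j by (simp add: grid_def)
  have g2: "grid s t k ?q" using q j unfolding N grid_def by simp
  have d'0: "d' (j + i) = 0" if "i < k" for i
  proof -
    have "q j < q (Suc (j + i))" using strict_grid_less[OF sq, of j "Suc (j + i)"] that N by simp
    then show ?thesis unfolding d'_def j(2) by (intro step_fun_outside[OF p']) simp
  qed
  have rf: "step_fun N q d u = step_fun n p c u" "step_fun N q d' u = step_fun n' p' c' u" for u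
    unfolding d_def[abs_def] d'_def[abs_def]
    by (rule step_fun_refine[OF p sq sub(1) q] step_fun_refine[OF p't sq sub(2) q])+
  have ri: "step_integral W N q d x = step_integral W n p c x" "step_integral W N q d' x = step_integral W n' p' c' x" for x
    unfolding d_def[abs_def] d'_def[abs_def]
    by (rule step_integral_refine[OF p sq sub(1)] step_integral_refine[OF p't sq sub(2)])+
  have right: "step_fun k ?q ?d u = step_fun n p c u" if "u \<in> {s<..t}" for u
    using rf(1)[of u] step_fun_outside[OF g1, of u d] that unfolding N step_fun_split by simp
  have left: "step_fun j q d u = step_fun n p c u" "step_fun j q d' u = step_fun n' p' c' u" if "u \<in> {0<..s}" for u
    using rf[of u] step_fun_outside[OF g2, of u] that unfolding N step_fun_split by simp_all
  have "sqn (win s t) (\<lambda>u. f u - step_fun k ?q ?d u) = sqn (win s t) (\<lambda>u. f u - step_fun n p c u)"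
    by (rule sqn_cong) (simp add: right space_restrict_space)
  also have "\<dots> \<le> sqn (win 0 t) (\<lambda>u. f u - step_fun n p c u)"
    by (rule sqn_win_mono) (use st in auto)
  also have "\<dots> \<le> ennreal e"
    by (rule order_trans[OF a(1)], rule ennreal_leI) (use e in \<open>simp add: e'_def\<close>)
  finally have 1: "sqn (win s t) (\<lambda>u. f u - step_fun k ?q ?d u) \<le> ennreal e" .
  let ?S = "step_integral W j q (\<lambda>i. d i + (- 1) * d' i)"
  have S: "step_integral W k ?q ?d x = step_integral W n p c x - step_integral W n' p' c' x - ?S x" for x
  proof -
    have "step_integral W k ?q (\<lambda>i. d' (j + i)) x = 0"
      unfolding step_integral_def by (rule sum.neutral) (simp add: d'0)
    then have "step_integral W n' p' c' x = step_integral W j q d' x"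
      using ri(2)[of x] unfolding N step_integral_split by simp
    moreover have "step_integral W n p c x = step_integral W j q d x + step_integral W k ?q ?d x"
      using ri(1)[of x] unfolding N step_integral_split by simp
    ultimately show ?thesis unfolding step_integral_linear by simp
  qed
  have m: "(\<lambda>u. f u - step_fun n p c u) \<in> borel_measurable (win 0 s)" "(\<lambda>u. f u - step_fun n' p' c' u) \<in> borel_measurable (win 0 s)"
    by (rule win_measurable; use f in simp)+
  have as: "sqn (win 0 s) (\<lambda>u. f u - step_fun n p c u) \<le> ennreal e'"
    by (rule order_trans[OF sqn_win_mono a(1)]) (use st in auto)
  have "sqn M ?S = sqn (win 0 s) (step_fun j q (\<lambda>i. d i + (- 1) * d' i))"
    by (rule step_integral_isometry[OF bm order_refl g1])
  also have "\<dots> = sqn (win 0 s) (\<lambda>u. - (f u - step_fun n p c u) + (f u - step_fun n' p' c' u))"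
    unfolding step_fun_linear by (rule sqn_cong) (simp add: left space_restrict_space)
  also have "\<dots> \<le> ennreal (2 * (e' + e'))"
    by (rule sqn_add_le[OF borel_measurable_uminus[OF m(1)] m(2) _ a'(1) nn nn]) (rule as[folded sqn_uminus[of _ "\<lambda>u. f u - step_fun n p c u"]])
  finally have Sle: "sqn M ?S \<le> ennreal (4 * e')" by simp
  have SM: "?S \<in> borel_measurable M" by (rule step_integral_measurable_M[OF bm order_refl g1])
  have mM: "(\<lambda>x. X x - step_integral W n p c x) \<in> borel_measurable M" "(\<lambda>x. X' x - step_integral W n' p' c' x) \<in> borel_measurable M"
    by (intro borel_measurable_diff XM XM' step_integral_measurable_M[OF bm order_refl p]
        step_integral_measurable_M[OF bm order_refl p'])+
  have A: "sqn M (\<lambda>x. (X x - step_integral W n p c x) + - (X' x - step_integral W n' p' c' x)) \<le> ennreal (2 * (e' + e'))"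
    by (rule sqn_add_le[OF mM(1) borel_measurable_uminus[OF mM(2)] a(2) _ nn nn])
      (rule a'(2)[folded sqn_uminus[of _ "\<lambda>x. X' x - step_integral W n' p' c' x"]])
  have "sqn M (\<lambda>x. ((X x - step_integral W n p c x) + - (X' x - step_integral W n' p' c' x)) + ?S x)
    \<le> ennreal (2 * (2 * (e' + e') + 4 * e'))"
    by (rule sqn_add_le[OF borel_measurable_add[OF mM(1) borel_measurable_uminus[OF mM(2)]] SM A Sle])
      (use nn in simp_all)
  moreover have "(\<lambda>x. ((X x - step_integral W n p c x) + - (X' x - step_integral W n' p' c' x)) + ?S x)
    = (\<lambda>x. X x - X' x - step_integral W k ?q ?d x)"
    unfolding S by (rule ext) simp
  ultimately have 2: "sqn M (\<lambda>x. X x - X' x - step_integral W k ?q ?d x) \<le> ennreal e"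
    by (simp add: e'_def)
  show "\<exists>n p c. grid s t n p \<and> sqn (win s t) (\<lambda>u. f u - step_fun n p c u) \<le> ennreal e \<and>
      sqn M (\<lambda>x. X x - X' x - step_integral W n p c x) \<le> ennreal e"
    using g2 1 2 by blast
qed

end

section \<open>Moments of Wiener integrals\<close>

lemma wiener_integral_sequence:
  assumes "wiener_integral M W s t f X"
  shows "\<exists>n p c. \<forall>k. grid s t (n k) (p k) \<and>
    sqn (win s t) (\<lambda>u. f u - step_fun (n k) (p k) (c k) u) \<le> ennreal (eps k) \<and>
    sqn M (\<lambda>x. X x - step_integral W (n k) (p k) (c k) x) \<le> ennreal (eps k)"
proof -
  have "\<forall>k. \<exists>n p c. grid s t n p \<and> sqn (win s t) (\<lambda>u. f u - step_fun n p c u) \<le> ennreal (eps k) \<and>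
      sqn M (\<lambda>x. X x - step_integral W n p c x) \<le> ennreal (eps k)"
    using wiener_integralD(3)[OF assms eps(1)] by blast
  then show ?thesis by (simp only: choice_iff)
qed

lemma wiener_integral_pair_sequence:
  assumes X: "wiener_integral M B s t f X" and Y: "wiener_integral M V s t g Y"
  shows "\<exists>N q c d. \<forall>k. grid s t (N k) (q k) \<and>
    sqn (win s t) (\<lambda>u. f u - step_fun (N k) (q k) (c k) u) \<le> ennreal (eps k / 4) \<and>
    sqn (win s t) (\<lambda>u. g u - step_fun (N k) (q k) (d k) u) \<le> ennreal (eps k / 4) \<and>
    sqn M (\<lambda>x. X x - step_integral B (N k) (q k) (c k) x) \<le> ennreal (eps k / 4) \<and>
    sqn M (\<lambda>x. Y x - step_integral V (N k) (q k) (d k) x) \<le> ennreal (eps k / 4)"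
proof -
  have "\<forall>k. \<exists>N q c d. grid s t N q \<and>
    sqn (win s t) (\<lambda>u. f u - step_fun N q c u) \<le> ennreal (eps k / 4) \<and> sqn (win s t) (\<lambda>u. g u - step_fun N q d u) \<le> ennreal (eps k / 4) \<and>
    sqn M (\<lambda>x. X x - step_integral B N q c x) \<le> ennreal (eps k / 4) \<and> sqn M (\<lambda>x. Y x - step_integral V N q d x) \<le> ennreal (eps k / 4)"
  proof
    fix k
    have "eps k / 4 > 0" using eps(1)[of k] by simp
    then show "\<exists>N q c d. grid s t N q \<and>
      sqn (win s t) (\<lambda>u. f u - step_fun N q c u) \<le> ennreal (eps k / 4) \<and> sqn (win s t) (\<lambda>u. g u - step_fun N q d u) \<le> ennreal (eps k / 4) \<and>
      sqn M (\<lambda>x. X x - step_integral B N q c x) \<le> ennreal (eps k / 4) \<and> sqn M (\<lambda>x. Y x - step_integral V N q d x) \<le> ennreal (eps k / 4)"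
      by (rule wiener_integral_pair[OF X Y]) (intro exI conjI)
  qed
  then show ?thesis by (simp only: choice_iff)
qed

lemma integrable_step_fun_square:
  "grid s t n p \<Longrightarrow> integrable (win s t) (\<lambda>u. (step_fun n p c u)^2)"
proof -
  assume g: "grid s t n p"
  have "(\<lambda>u. (step_fun n p c u)^2) = step_fun n p (\<lambda>i. (c i)^2)"
    using step_fun_comp[OF g, of "\<lambda>a b. a^2" c _ c] by auto
  then show ?thesis using integral_step_fun(1)[OF g] by simp
qed

lemma wiener_integrand_square_integrable:
  assumes "wiener_integral M W s t f X"
  shows "integrable (win s t) (\<lambda>u. (f u)^2)"
proof -
  obtain n p c where k: "\<forall>k. grid s t (n k) (p k) \<and>
    sqn (win s t) (\<lambda>u. f u - step_fun (n k) (p k) (c k) u) \<le> ennreal (eps k) \<and>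
    sqn M (\<lambda>x. X x - step_integral W (n k) (p k) (c k) x) \<le> ennreal (eps k)"
    using wiener_integral_sequence[OF assms] by blast
  show ?thesis
  proof (rule L2_limit_square(1)[where U="\<lambda>k. step_fun (n k) (p k) (c k)" and Z="\<lambda>_. 1" and K=1])
    show "f \<in> borel_measurable (win s t)" by (rule win_measurable) (rule wiener_integralD(2)[OF assms])
    show "step_fun (n k) (p k) (c k) \<in> borel_measurable (win s t)" for k
      by (rule win_measurable) (rule step_fun_measurable)
    show "integrable (win s t) (\<lambda>x. (step_fun (n k) (p k) (c k) x)^2)" for k
      by (rule integrable_step_fun_square) (use k in blast)
    show "sqn (win s t) (\<lambda>x. f x - step_fun (n k) (p k) (c k) x) \<le> ennreal (eps k)" for k
      using k by blast
  qed simp_all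
qed

context filtered
begin

lemma wiener_integral_AE_approx:
  assumes bm: "brownian_motion M F W" and s: "0 \<le> s" and X: "wiener_integral M W s t f X"
  shows "\<exists>n p c. (\<forall>k. grid s t (n k) (p k) \<and>
      sqn (win s t) (\<lambda>u. f u - step_fun (n k) (p k) (c k) u) \<le> ennreal (eps k)) \<and>
    (AE x in M. (\<lambda>k. step_integral W (n k) (p k) (c k) x) \<longlonglongrightarrow> X x)"
proof -
  obtain n p c where k: "\<forall>k. grid s t (n k) (p k) \<and>
    sqn (win s t) (\<lambda>u. f u - step_fun (n k) (p k) (c k) u) \<le> ennreal (eps k) \<and>
    sqn M (\<lambda>x. X x - step_integral W (n k) (p k) (c k) x) \<le> ennreal (eps k)"
    using wiener_integral_sequence[OF X] by blast
  let ?U = "\<lambda>k. step_integral W (n k) (p k) (c k)"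
  have UM: "?U k \<in> borel_measurable M" for k
    by (rule step_integral_measurable_M[OF bm s]) (use k in blast)
  have le: "sqn M (\<lambda>x. X x - ?U k x) \<le> ennreal (eps k)" for k using k by blast
  note L = L2_limit_first[where U="?U", OF wiener_integralD(1)[OF X] UM le]
  obtain \<rho> :: "nat \<Rightarrow> nat" where \<rho>: "strict_mono \<rho>" "AE x in M. (\<lambda>k. X x - ?U (\<rho> k) x) \<longlonglongrightarrow> 0"
    using tendsto_L1_AE_subseq[where u="\<lambda>k x. X x - ?U k x", OF L(1)] L(2) by auto
  have "AE x in M. (\<lambda>k. ?U (\<rho> k) x) \<longlonglongrightarrow> X x"
    using \<rho>(2)
  proof eventually_elim
    case (elim x)
    from tendsto_diff[OF tendsto_const[of "X x"] elim] show ?case by simp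
  qed
  moreover have "sqn (win s t) (\<lambda>u. f u - step_fun (n (\<rho> k)) (p (\<rho> k)) (c (\<rho> k)) u) \<le> ennreal (eps k)" for k
  proof -
    have "eps (\<rho> k) \<le> eps k"
      unfolding eps_def using seq_suble[OF \<rho>(1), of k] by (intro le_imp_inverse_le) auto
    then show ?thesis using k by (meson ennreal_leI order_trans)
  qed
  ultimately show ?thesis using k
    by (intro exI[of _ "\<lambda>k. n (\<rho> k)"] exI[of _ "\<lambda>k. p (\<rho> k)"] exI[of _ "\<lambda>k. c (\<rho> k)"]) simp
qed

lemma wiener_integral_adapted:
  assumes bm: "brownian_motion M F W" and s: "0 \<le> s" "s \<le> t" and X: "wiener_integral M W s t f X"
  shows "\<exists>X'\<in>borel_measurable (F t). AE x in M. X x = X' x"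
proof -
  obtain n p c where k: "\<forall>k. grid s t (n k) (p k) \<and>
      sqn (win s t) (\<lambda>u. f u - step_fun (n k) (p k) (c k) u) \<le> ennreal (eps k)"
    and AE: "AE x in M. (\<lambda>k. step_integral W (n k) (p k) (c k) x) \<longlonglongrightarrow> X x"
    using wiener_integral_AE_approx[OF bm s(1) X] by blast
  let ?U = "\<lambda>k. step_integral W (n k) (p k) (c k)"
  have UF: "?U k \<in> borel_measurable (F t)" for k
  proof -
    have g: "grid s t (n k) (p k)" using k by blast
    have "0 \<le> p k (n k)" "p k (n k) \<le> t" using grid_bounds[OF g, of "n k"] s by auto
    then show ?thesis by (rule lift) (rule step_integral_measurable[OF bm s(1) g])
  qed
  show ?thesis
  proof (rule bexI)
    show "AE x in M. X x = lim (\<lambda>k. ?U k x)"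
      using AE by eventually_elim (rule limI[symmetric])
    show "(\<lambda>x. lim (\<lambda>k. ?U k x)) \<in> borel_measurable (F t)"
      by (rule borel_measurable_lim_metric[where f="?U", OF UF])
  qed
qed

text \<open>
  Fatou's lemma along a subsequence that converges almost everywhere. The squared norm of the
  approximating step function is bounded by twice that of \<open>f\<close> up to a null sequence, whence the
  constant \<open>12 = 3 * 2\<^sup>2\<close>.
\<close>

lemma wiener_integral_fourth:
  assumes bm: "brownian_motion M F W" and s: "0 \<le> s" and X: "wiener_integral M W s t f X"
  shows "integrable M (\<lambda>x. X x ^ 4)"
    "(\<integral>x. X x ^ 4 \<partial>M) \<le> 12 * (\<integral>u. (f u)^2 \<partial>win s t)^2"
proof -
  obtain n p c where k: "\<forall>k. grid s t (n k) (p k) \<and>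
      sqn (win s t) (\<lambda>u. f u - step_fun (n k) (p k) (c k) u) \<le> ennreal (eps k)"
    and AE: "AE x in M. (\<lambda>k. step_integral W (n k) (p k) (c k) x) \<longlonglongrightarrow> X x"
    using wiener_integral_AE_approx[OF bm s X] by blast
  let ?U = "\<lambda>k. step_integral W (n k) (p k) (c k)"
  define a where "a = (\<integral>u. (f u)^2 \<partial>win s t)"
  have XM: "X \<in> borel_measurable M" and fM: "f \<in> borel_measurable (win s t)"
    using wiener_integralD[OF X] win_measurable by blast+
  have g: "grid s t (n k) (p k)" for k using k by blast
  have UM: "?U k \<in> borel_measurable M" for k by (rule step_integral_measurable_M[OF bm s g])
  have a0: "0 \<le> a" unfolding a_def by (rule Bochner_Integration.integral_nonneg) simp
  have fa: "sqn (win s t) f = ennreal a"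
    unfolding a_def by (rule sqn_eq_integral[OF wiener_integrand_square_integrable[OF X]])
  have b: "(\<integral>\<^sup>+x. ennreal (?U k x ^ 4) \<partial>M) \<le> ennreal (3 * (2 * (a + eps k))^2)" for k
  proof -
    define w where "w = (\<Sum>i<n k. (c k i)^2 * (p k (Suc i) - p k i))"
    have mf: "(\<lambda>u. f u - step_fun (n k) (p k) (c k) u) \<in> borel_measurable (win s t)"
      by (rule borel_measurable_diff[OF fM win_measurable[OF step_fun_measurable]])
    have ls: "sqn (win s t) (\<lambda>u. - (f u - step_fun (n k) (p k) (c k) u)) \<le> ennreal (eps k)"
      unfolding sqn_uminus using k by blast
    have "sqn (win s t) (\<lambda>u. f u + - (f u - step_fun (n k) (p k) (c k) u)) \<le> ennreal (2 * (a + eps k))"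
      by (rule sqn_add_le[OF fM borel_measurable_uminus[OF mf] _ ls a0]) (use fa eps(1)[of k] in simp_all)
    then have "sqn (win s t) (step_fun (n k) (p k) (c k)) \<le> ennreal (2 * (a + eps k))" by simp
    then have "ennreal w \<le> ennreal (2 * (a + eps k))"
      unfolding sqn_step_fun[OF g] w_def[symmetric] .
    moreover have "0 \<le> 2 * (a + eps k)" using a0 eps(1)[of k] by simp
    ultimately have w: "w \<le> 2 * (a + eps k)" by (simp only: ennreal_le_iff)
    have w0: "0 \<le> w" unfolding w_def using g[of k] by (intro sum_nonneg) (simp add: grid_def)
    have "(\<integral>\<^sup>+x. ennreal (?U k x ^ 4) \<partial>M) = ennreal (\<integral>x. ?U k x ^ 4 \<partial>M)"
      by (rule nn_integral_eq_integral[OF step_integral_fourth(1)[OF bm s g]]) simp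
    also have "\<dots> \<le> ennreal (3 * w^2)"
      unfolding w_def by (rule ennreal_leI[OF step_integral_fourth(3)[OF bm s g]])
    also have "\<dots> \<le> ennreal (3 * (2 * (a + eps k))^2)"
      using power_mono[OF w w0, of 2] by (intro ennreal_leI) simp
    finally show ?thesis .
  qed
  have lim: "(\<lambda>k. ennreal (3 * (2 * (a + eps k))^2)) \<longlonglongrightarrow> ennreal (3 * (2 * (a + 0))^2)"
    by (intro tendsto_ennrealI tendsto_intros eps)
  have "(\<integral>\<^sup>+x. ennreal (X x ^ 4) \<partial>M) = (\<integral>\<^sup>+x. liminf (\<lambda>k. ennreal (?U k x ^ 4)) \<partial>M)"
  proof (rule nn_integral_cong_AE)
    show "AE x in M. ennreal (X x ^ 4) = liminf (\<lambda>k. ennreal (?U k x ^ 4))"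
      using AE
    proof eventually_elim
      case (elim x)
      have "(\<lambda>k. ennreal (?U k x ^ 4)) \<longlonglongrightarrow> ennreal (X x ^ 4)"
        by (intro tendsto_ennrealI tendsto_power elim)
      from lim_imp_Liminf[OF _ this] show ?case by simp
    qed
  qed
  also have "\<dots> \<le> liminf (\<lambda>k. \<integral>\<^sup>+x. ennreal (?U k x ^ 4) \<partial>M)"
  proof (rule nn_integral_liminf)
    show "(\<lambda>x. ennreal (?U k x ^ 4)) \<in> borel_measurable M" for k
      by (intro measurable_compose[OF _ measurable_ennreal] borel_measurable_power UM)
  qed
  also have "\<dots> \<le> liminf (\<lambda>k. ennreal (3 * (2 * (a + eps k))^2))"
    by (rule Liminf_mono) (use b in simp)
  also have "\<dots> = ennreal (3 * (2 * (a + 0))^2)"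
    by (rule lim_imp_Liminf[OF _ lim]) simp
  also have "3 * (2 * (a + 0))^2 = 12 * a^2" by (simp add: power2_eq_square)
  finally have nn: "(\<integral>\<^sup>+x. ennreal (X x ^ 4) \<partial>M) \<le> ennreal (12 * a^2)" .
  show i: "integrable M (\<lambda>x. X x ^ 4)"
  proof (rule integrableI_nonneg)
    show "(\<lambda>x. X x ^ 4) \<in> borel_measurable M" by (rule borel_measurable_power[OF XM])
    show "(\<integral>\<^sup>+x. ennreal (X x ^ 4) \<partial>M) < \<infinity>" by (rule le_less_trans[OF nn]) simp
  qed simp
  have "ennreal (\<integral>x. X x ^ 4 \<partial>M) = (\<integral>\<^sup>+x. ennreal (X x ^ 4) \<partial>M)"
    by (rule nn_integral_eq_integral[symmetric, OF i]) simp
  then have "ennreal (\<integral>x. X x ^ 4 \<partial>M) \<le> ennreal (12 * a^2)" using nn by simp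
  then show "(\<integral>x. X x ^ 4 \<partial>M) \<le> 12 * (\<integral>u. (f u)^2 \<partial>win s t)^2"
    unfolding a_def by (subst (asm) ennreal_le_iff) simp_all
qed

text \<open>
  The bounds for step integrals pass to the limit on both sides: on the probability space by mean
  square convergence of the integrals, and on the time axis because \<open>\<bar>f\<bar> \<plusminus> \<bar>g\<bar>\<close> is a Lipschitz
  function of the pair of integrands.
\<close>

lemma wiener_integral_pair_moments:
  assumes B: "brownian_motion M F B" and V: "brownian_motion M F V" and s: "0 \<le> s"
    and X: "wiener_integral M B s t f X" and Y: "wiener_integral M V s t g Y"
    and Z: "Z \<in> borel_measurable (F s)" "\<And>x. x \<in> space M \<Longrightarrow> \<bar>Z x\<bar> \<le> K"
  shows "(\<integral>x. Z x * (X x - Y x) \<partial>M) = 0"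
    and "(\<And>x. x \<in> space M \<Longrightarrow> 0 \<le> Z x) \<Longrightarrow>
      (\<integral>u. (\<bar>f u\<bar> - \<bar>g u\<bar>)^2 \<partial>win s t) * (\<integral>x. Z x \<partial>M) \<le> (\<integral>x. Z x * (X x - Y x)^2 \<partial>M) \<and>
      (\<integral>x. Z x * (X x - Y x)^2 \<partial>M) \<le> (\<integral>u. (\<bar>f u\<bar> + \<bar>g u\<bar>)^2 \<partial>win s t) * (\<integral>x. Z x \<partial>M)"
proof -
  obtain N q c d where all: "\<forall>k. grid s t (N k) (q k) \<and>
    sqn (win s t) (\<lambda>u. f u - step_fun (N k) (q k) (c k) u) \<le> ennreal (eps k / 4) \<and>
    sqn (win s t) (\<lambda>u. g u - step_fun (N k) (q k) (d k) u) \<le> ennreal (eps k / 4) \<and>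
    sqn M (\<lambda>x. X x - step_integral B (N k) (q k) (c k) x) \<le> ennreal (eps k / 4) \<and>
    sqn M (\<lambda>x. Y x - step_integral V (N k) (q k) (d k) x) \<le> ennreal (eps k / 4)"
    using wiener_integral_pair_sequence[OF X Y] by (elim exE) (rule that)
  have gr: "grid s t (N k) (q k)"
    and fc: "sqn (win s t) (\<lambda>u. f u - step_fun (N k) (q k) (c k) u) \<le> ennreal (eps k / 4)"
    and gd: "sqn (win s t) (\<lambda>u. g u - step_fun (N k) (q k) (d k) u) \<le> ennreal (eps k / 4)"
    and Xc: "sqn M (\<lambda>x. X x - step_integral B (N k) (q k) (c k) x) \<le> ennreal (eps k / 4)"
    and Yd: "sqn M (\<lambda>x. Y x - step_integral V (N k) (q k) (d k) x) \<le> ennreal (eps k / 4)" for k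
    using all by blast+
  let ?c = "\<lambda>k. step_fun (N k) (q k) (c k)" and ?d = "\<lambda>k. step_fun (N k) (q k) (d k)"
  let ?B = "\<lambda>k. step_integral B (N k) (q k) (c k)" and ?V = "\<lambda>k. step_integral V (N k) (q k) (d k)"
  have e4: "0 \<le> eps k / 4" "2 * (eps k / 4 + eps k / 4) = eps k" for k using eps(1)[of k] by simp_all
  have XM: "X \<in> borel_measurable M" and YM: "Y \<in> borel_measurable M"
    and fM: "f \<in> borel_measurable (win s t)" and gM: "g \<in> borel_measurable (win s t)"
    using wiener_integralD[OF X] wiener_integralD[OF Y] win_measurable by blast+
  have BM: "?B k \<in> borel_measurable M" and VM: "?V k \<in> borel_measurable M" for k
    by (rule step_integral_measurable_M[OF B s gr] step_integral_measurable_M[OF V s gr])+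
  have DM: "(\<lambda>x. X x - Y x) \<in> borel_measurable M" and UM: "(\<lambda>x. ?B k x - ?V k x) \<in> borel_measurable M" for k
    by (intro borel_measurable_diff XM YM BM VM)+
  have ZM: "Z \<in> borel_measurable M" by (rule lift_M[OF s Z(1)])
  have dist: "sqn M (\<lambda>x. (X x - Y x) - (?B k x - ?V k x)) \<le> ennreal (eps k)" for k
  proof -
    have "sqn M (\<lambda>x. (X x - ?B k x) + - (Y x - ?V k x)) \<le> ennreal (2 * (eps k / 4 + eps k / 4))"
      by (rule sqn_add_le[OF borel_measurable_diff[OF XM BM] borel_measurable_uminus[OF borel_measurable_diff[OF YM VM]] Xc _ e4(1) e4(1)])
        (rule Yd[of k, folded sqn_uminus[of _ "\<lambda>x. Y x - ?V k x"]])
    moreover have "(\<lambda>x. (X x - ?B k x) + - (Y x - ?V k x)) = (\<lambda>x. (X x - Y x) - (?B k x - ?V k x))"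
      by (rule ext) simp
    ultimately show ?thesis unfolding e4(2) by simp
  qed
  note pair = pair_step_integral[OF B V s gr Z]
  show "(\<integral>x. Z x * (X x - Y x) \<partial>M) = 0"
  proof -
    note L = L2_limit_first[where D="\<lambda>x. X x - Y x" and U="\<lambda>k x. ?B k x - ?V k x", OF DM UM dist]
    have U1: "integrable M (\<lambda>x. ?B k x - ?V k x)" for k
    proof -
      have "integrable M (\<lambda>x. (?B k x - ?V k x) * 1)"
        by (rule integrable_mult_squares) (use UM pair(1) in simp_all)
      then show ?thesis by simp
    qed
    have D1: "integrable M (\<lambda>x. X x - Y x)"
      using Bochner_Integration.integrable_add[OF L(1)[of 0] U1[of 0]] by simp
    have zD: "integrable M (\<lambda>x. Z x * (X x - Y x))"
      by (rule integrable_bounded_mult[OF D1 ZM Z(2)])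
    have zU: "integrable M (\<lambda>x. Z x * (?B k x - ?V k x))" for k
      by (rule integrable_bounded_mult[OF U1 ZM Z(2)])
    have K0: "\<bar>Z x\<bar> \<le> \<bar>K\<bar>" if "x \<in> space M" for x using Z(2)[OF that] by linarith
    have b: "\<bar>\<integral>x. Z x * (X x - Y x) \<partial>M\<bar> \<le> \<bar>K\<bar> * (\<integral>x. \<bar>(X x - Y x) - (?B k x - ?V k x)\<bar> \<partial>M)" for k
    proof -
      have "(\<integral>x. Z x * (X x - Y x) \<partial>M) = (\<integral>x. Z x * (X x - Y x) \<partial>M) - (\<integral>x. Z x * (?B k x - ?V k x) \<partial>M)"
        by (simp add: pair(2))
      also have "\<dots> = (\<integral>x. Z x * (X x - Y x) - Z x * (?B k x - ?V k x) \<partial>M)"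
        by (rule Bochner_Integration.integral_diff[OF zD zU, symmetric])
      finally have "\<bar>\<integral>x. Z x * (X x - Y x) \<partial>M\<bar> = \<bar>\<integral>x. Z x * (X x - Y x) - Z x * (?B k x - ?V k x) \<partial>M\<bar>"
        by (rule arg_cong)
      also have "\<dots> \<le> (\<integral>x. \<bar>K\<bar> * \<bar>(X x - Y x) - (?B k x - ?V k x)\<bar> \<partial>M)"
      proof (rule integral_abs_bound[THEN order_trans], rule integral_mono)
        show "integrable M (\<lambda>x. \<bar>Z x * (X x - Y x) - Z x * (?B k x - ?V k x)\<bar>)"
          by (rule Bochner_Integration.integrable_abs[OF Bochner_Integration.integrable_diff[OF zD zU]])
        show "integrable M (\<lambda>x. \<bar>K\<bar> * \<bar>(X x - Y x) - (?B k x - ?V k x)\<bar>)"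
          by (rule integrable_mult_right, rule Bochner_Integration.integrable_abs, rule L(1))
        fix x assume x: "x \<in> space M"
        have "\<bar>Z x * (X x - Y x) - Z x * (?B k x - ?V k x)\<bar> = \<bar>Z x\<bar> * \<bar>(X x - Y x) - (?B k x - ?V k x)\<bar>"
          by (simp only: right_diff_distrib[symmetric] abs_mult)
        also have "\<dots> \<le> \<bar>K\<bar> * \<bar>(X x - Y x) - (?B k x - ?V k x)\<bar>"
          by (rule mult_right_mono[OF K0[OF x]]) simp
        finally show "\<bar>Z x * (X x - Y x) - Z x * (?B k x - ?V k x)\<bar> \<le> \<bar>K\<bar> * \<bar>(X x - Y x) - (?B k x - ?V k x)\<bar>" .
      qed
      also have "\<dots> = \<bar>K\<bar> * (\<integral>x. \<bar>(X x - Y x) - (?B k x - ?V k x)\<bar> \<partial>M)"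
        by (rule integral_mult_right_zero)
      finally show ?thesis .
    qed
    have "\<bar>\<integral>x. Z x * (X x - Y x) \<partial>M\<bar> \<le> \<bar>K\<bar> * 0"
      by (rule LIMSEQ_le_const[OF tendsto_mult[OF tendsto_const L(2)]]) (use b in blast)
    then show ?thesis by simp
  qed
  show "(\<integral>u. (\<bar>f u\<bar> - \<bar>g u\<bar>)^2 \<partial>win s t) * (\<integral>x. Z x \<partial>M) \<le> (\<integral>x. Z x * (X x - Y x)^2 \<partial>M) \<and>
      (\<integral>x. Z x * (X x - Y x)^2 \<partial>M) \<le> (\<integral>u. (\<bar>f u\<bar> + \<bar>g u\<bar>)^2 \<partial>win s t) * (\<integral>x. Z x \<partial>M)"
    if pos: "\<And>x. x \<in> space M \<Longrightarrow> 0 \<le> Z x"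
  proof -
    have mid: "(\<lambda>k. \<integral>x. Z x * (?B k x - ?V k x)^2 \<partial>M) \<longlonglongrightarrow> (\<integral>x. Z x * (X x - Y x)^2 \<partial>M)"
      by (rule L2_limit_square(2)[where D="\<lambda>x. X x - Y x" and U="\<lambda>k x. ?B k x - ?V k x", OF DM UM ZM Z(2) pair(1) dist])
    \<comment> \<open>The signs \<open>\<sigma> = - 1\<close> and \<open>\<sigma> = 1\<close> give the lower and the upper bound.\<close>
    have edge: "(\<lambda>k. \<Sum>i<N k. (\<bar>c k i\<bar> + \<sigma> * \<bar>d k i\<bar>)^2 * (q k (Suc i) - q k i))
        \<longlonglongrightarrow> (\<integral>u. (\<bar>f u\<bar> + \<sigma> * \<bar>g u\<bar>)^2 \<partial>win s t)" if \<sigma>: "\<bar>\<sigma>\<bar> = 1" for \<sigma> :: real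
    proof -
      let ?h = "\<lambda>u. \<bar>f u\<bar> + \<sigma> * \<bar>g u\<bar>" and ?k = "\<lambda>k u. \<bar>?c k u\<bar> + \<sigma> * \<bar>?d k u\<bar>"
      have kE: "(\<lambda>u. (?k k u)^2) = step_fun (N k) (q k) (\<lambda>i. (\<bar>c k i\<bar> + \<sigma> * \<bar>d k i\<bar>)^2)" for k
        by (rule ext) (rule step_fun_comp[OF gr, of "\<lambda>a b. (\<bar>a\<bar> + \<sigma> * \<bar>b\<bar>)^2"], simp)
      have cM: "?c k \<in> borel_measurable (win s t)" and dM: "?d k \<in> borel_measurable (win s t)" for k
        by (rule win_measurable[OF step_fun_measurable])+
      have "(\<lambda>k. \<integral>u. 1 * (?k k u)^2 \<partial>win s t) \<longlonglongrightarrow> (\<integral>u. 1 * (?h u)^2 \<partial>win s t)"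
      proof (rule L2_limit_square(2)[where K=1])
        show "?h \<in> borel_measurable (win s t)" using fM gM by simp
        show "?k k \<in> borel_measurable (win s t)" for k using cM[of k] dM[of k] by simp
        show "integrable (win s t) (\<lambda>u. (?k k u)^2)" for k
          unfolding kE by (rule integral_step_fun(1)[OF gr])
        show "sqn (win s t) (\<lambda>u. ?h u - ?k k u) \<le> ennreal (eps k)" for k
        proof -
          have m: "(\<lambda>u. \<bar>f u - ?c k u\<bar>) \<in> borel_measurable (win s t)" "(\<lambda>u. \<bar>g u - ?d k u\<bar>) \<in> borel_measurable (win s t)"
            using fM gM cM[of k] dM[of k] by simp_all
          have abs: "sqn (win s t) (\<lambda>u. \<bar>j u\<bar>) = sqn (win s t) j" for j by (simp add: sqn_def)
          have "sqn (win s t) (\<lambda>u. ?h u - ?k k u) \<le> sqn (win s t) (\<lambda>u. \<bar>f u - ?c k u\<bar> + \<bar>g u - ?d k u\<bar>)"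
          proof (rule sqn_mono)
            fix u
            have "?h u - ?k k u = (\<bar>f u\<bar> - \<bar>?c k u\<bar>) + \<sigma> * (\<bar>g u\<bar> - \<bar>?d k u\<bar>)" by (simp add: algebra_simps)
            also have "\<bar>\<dots>\<bar> \<le> \<bar>\<bar>f u\<bar> - \<bar>?c k u\<bar>\<bar> + \<bar>\<sigma>\<bar> * \<bar>\<bar>g u\<bar> - \<bar>?d k u\<bar>\<bar>"
              unfolding abs_mult[symmetric] by (rule abs_triangle_ineq)
            also have "\<dots> \<le> \<bar>f u - ?c k u\<bar> + \<bar>g u - ?d k u\<bar>"
              unfolding \<sigma> by (simp add: add_mono abs_triangle_ineq3)
            finally show "\<bar>?h u - ?k k u\<bar> \<le> \<bar>\<bar>f u - ?c k u\<bar> + \<bar>g u - ?d k u\<bar>\<bar>" by simp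
          qed
          also have "\<dots> \<le> ennreal (2 * (eps k / 4 + eps k / 4))"
            by (rule sqn_add_le[OF m _ _ e4(1) e4(1)]; unfold abs; rule fc gd)
          finally show ?thesis unfolding e4(2) .
        qed
      qed simp_all
      then show ?thesis unfolding mult_1 kE integral_step_fun(2)[OF gr] .
    qed
    have lo: "(\<lambda>k. (\<Sum>i<N k. (\<bar>c k i\<bar> - \<bar>d k i\<bar>)^2 * (q k (Suc i) - q k i)) * (\<integral>x. Z x \<partial>M))
        \<longlonglongrightarrow> (\<integral>u. (\<bar>f u\<bar> - \<bar>g u\<bar>)^2 \<partial>win s t) * (\<integral>x. Z x \<partial>M)"
      using edge[of "-1"] by (intro tendsto_mult tendsto_const) simp
    have hi: "(\<lambda>k. (\<Sum>i<N k. (\<bar>c k i\<bar> + \<bar>d k i\<bar>)^2 * (q k (Suc i) - q k i)) * (\<integral>x. Z x \<partial>M))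
        \<longlonglongrightarrow> (\<integral>u. (\<bar>f u\<bar> + \<bar>g u\<bar>)^2 \<partial>win s t) * (\<integral>x. Z x \<partial>M)"
      using edge[of 1] by (intro tendsto_mult tendsto_const) simp
    have p3: "(\<Sum>i<N k. (\<bar>c k i\<bar> - \<bar>d k i\<bar>)^2 * (q k (Suc i) - q k i)) * (\<integral>x. Z x \<partial>M) \<le> (\<integral>x. Z x * (?B k x - ?V k x)^2 \<partial>M) \<and>
      (\<integral>x. Z x * (?B k x - ?V k x)^2 \<partial>M) \<le> (\<Sum>i<N k. (\<bar>c k i\<bar> + \<bar>d k i\<bar>)^2 * (q k (Suc i) - q k i)) * (\<integral>x. Z x \<partial>M)" for k
      by (rule pair(3)) (assumption, rule pos)
    show ?thesis
    proof
      show "(\<integral>u. (\<bar>f u\<bar> - \<bar>g u\<bar>)^2 \<partial>win s t) * (\<integral>x. Z x \<partial>M) \<le> (\<integral>x. Z x * (X x - Y x)^2 \<partial>M)"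
        by (rule LIMSEQ_le[OF lo mid]) (intro exI allI impI conjunct1[OF p3])
      show "(\<integral>x. Z x * (X x - Y x)^2 \<partial>M) \<le> (\<integral>u. (\<bar>f u\<bar> + \<bar>g u\<bar>)^2 \<partial>win s t) * (\<integral>x. Z x \<partial>M)"
        by (rule LIMSEQ_le[OF mid hi]) (intro exI allI impI conjunct2[OF p3])
    qed
  qed
qed

end

section \<open>Energies\<close>

definition energy :: "(real \<Rightarrow> real) \<Rightarrow> real \<Rightarrow> real" where
  "energy k t = (\<integral>u. k u \<partial>win 0 t)"

lemma win_integrable_iff: "integrable (win s t) k \<longleftrightarrow> set_integrable lborel {s<..t} k"
  for k :: "real \<Rightarrow> real"
  unfolding set_integrable_def by (rule integrable_restrict_space) simp

lemma win_integral_eq: "(\<integral>u. k u \<partial>win s t) = (LINT u:{s<..t}|lborel. k u)"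
  for k :: "real \<Rightarrow> real"
  unfolding set_lebesgue_integral_def by (rule integral_restrict_space) simp

lemma win_integrable_subset:
  fixes k :: "real \<Rightarrow> real"
  assumes "integrable (win s' t') k" "s' \<le> s" "t \<le> t'"
  shows "integrable (win s t) k"
  unfolding win_integrable_iff
  by (rule set_integrable_subset[OF assms(1)[unfolded win_integrable_iff]]) (use assms in auto)

lemma energy_increment:
  assumes k: "integrable (win 0 t) k" and st: "0 \<le> s" "s \<le> t"
  shows "energy k t - energy k s = (\<integral>u. k u \<partial>win s t)"
proof -
  have "{0<..t} = {0<..s} \<union> {s<..t}" using st by auto
  then have "(LINT u:{0<..t}|lborel. k u) = (LINT u:{0<..s}|lborel. k u) + (LINT u:{s<..t}|lborel. k u)"
    using win_integrable_subset[OF k, of 0 s] win_integrable_subset[OF k, of s t] st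
    unfolding win_integrable_iff by (simp only:) (rule set_integral_Un, auto)
  then show ?thesis unfolding energy_def win_integral_eq by simp
qed

lemma energy_continuous:
  assumes k: "\<And>t. 0 \<le> t \<Longrightarrow> integrable (win 0 t) k"
  shows "continuous_on {0..T} (energy k)"
proof (cases "0 \<le> T")
  case True
  have "energy k t = integral {0..t} k" if "t \<in> {0..T}" for t
  proof -
    have "energy k t = integral {0<..t} k"
      unfolding energy_def win_integral_eq
      by (rule set_borel_integral_eq_integral(2)) (use k[of t] that in \<open>simp add: win_integrable_iff\<close>)
    also have "\<dots> = integral {0..t} k"
      by (rule integral_subset_negligible) (use that in \<open>auto intro: negligible_subset[of "{0}"]\<close>)
    finally show ?thesis .
  qed
  moreover have "k integrable_on {0..T}"
  proof -
    have "k integrable_on {0<..T}"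
      by (rule set_borel_integral_eq_integral(1)) (use k[OF True] in \<open>simp add: win_integrable_iff\<close>)
    then show ?thesis
      by (rule integrable_spike_set) (auto intro: negligible_subset[of "{0}"])
  qed
  ultimately show ?thesis
    by (intro continuous_on_eq[OF indefinite_integral_continuous_1[of k 0 T]]) simp_all
qed simp

lemma fourth_power_diff: "(a - b)^4 \<le> 8 * a^4 + 8 * (b::real)^4"
proof -
  have "(a - b)^2 \<le> 2 * (a^2 + b^2)"
    using zero_le_power2[of "a + b"] by (simp add: power2_eq_square algebra_simps)
  then have "((a - b)^2)^2 \<le> (2 * (a^2 + b^2))^2" by (rule power_mono) simp
  also have "\<dots> \<le> 8 * ((a^2)^2 + (b^2)^2)"
    using zero_le_power2[of "a^2 - b^2"] by (simp add: power2_eq_square algebra_simps)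
  finally show ?thesis by (simp flip: power_mult)
qed

context filtered
begin

section \<open>Processes driven by two Brownian motions\<close>

text \<open>
  The conditional variance of an increment is bounded by the increments of \<open>lo\<close> and \<open>hi\<close>. If \<open>g\<close>
  vanishes, these clocks coincide and the variance is known exactly.
\<close>

lemma quartic_martingale_of_wiener_integrals:
  assumes B: "brownian_motion M F B" and V: "brownian_motion M F V"
    and X: "\<And>t. 0 \<le> t \<Longrightarrow> wiener_integral M B 0 t f (X t)"
    and Y: "\<And>t. 0 \<le> t \<Longrightarrow> wiener_integral M V 0 t g (Y t)"
    and R: "\<And>t x. 0 \<le> t \<Longrightarrow> x \<in> space M \<Longrightarrow> R t x = r + X t x - Y t x"
    and paths: "\<And>x. x \<in> space M \<Longrightarrow> continuous_on {0..} (\<lambda>t. R t x)" and r: "r \<le> 0"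
  defines "m \<equiv> energy (\<lambda>u. 2 * ((f u)^2 + (g u)^2))"
    and "lo \<equiv> energy (\<lambda>u. (\<bar>f u\<bar> - \<bar>g u\<bar>)^2)" and "hi \<equiv> energy (\<lambda>u. (\<bar>f u\<bar> + \<bar>g u\<bar>)^2)"
  shows "quartic_martingale M F R r m 24"
    and "\<And>s t. 0 \<le> s \<Longrightarrow> s \<le> t \<Longrightarrow> var_ge M (F s) (\<lambda>x. R t x - R s x) (lo t - lo s)"
    and "\<And>s t. 0 \<le> s \<Longrightarrow> s \<le> t \<Longrightarrow> var_le M (F s) (\<lambda>x. R t x - R s x) (hi t - hi s)"
    and "\<And>s t. 0 \<le> s \<Longrightarrow> s \<le> t \<Longrightarrow> 0 \<le> lo t - lo s \<and> lo t - lo s \<le> m t - m s"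
    and "\<And>s t. 0 \<le> s \<Longrightarrow> s \<le> t \<Longrightarrow> 0 \<le> hi t - hi s \<and> hi t - hi s \<le> m t - m s"
proof -
  have fM: "f \<in> borel_measurable borel" and gM: "g \<in> borel_measurable borel"
    using wiener_integralD(2)[OF X[of 0]] wiener_integralD(2)[OF Y[of 0]] by simp_all
  have f2: "integrable (win 0 t) (\<lambda>u. (f u)^2)" and g2: "integrable (win 0 t) (\<lambda>u. (g u)^2)" if "0 \<le> t" for t
    using wiener_integrand_square_integrable[OF X[OF that]] wiener_integrand_square_integrable[OF Y[OF that]] by blast+
  have mi: "integrable (win 0 t) (\<lambda>u. 2 * ((f u)^2 + (g u)^2))" if "0 \<le> t" for t
    using f2[OF that] g2[OF that] by simp
  have sq: "(\<bar>a\<bar> + \<sigma> * \<bar>b\<bar>)^2 \<le> 2 * (a^2 + b^2)" if "\<sigma>^2 = 1" for a b \<sigma> :: real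
  proof -
    have "0 \<le> (\<bar>a\<bar> - \<sigma> * \<bar>b\<bar>)^2" by simp
    then show ?thesis using that by (simp add: power2_diff power2_sum power_mult_distrib)
  qed
  have sq': "(\<bar>a\<bar> - \<bar>b\<bar>)^2 \<le> 2 * (a^2 + b^2)" "(\<bar>a\<bar> + \<bar>b\<bar>)^2 \<le> 2 * (a^2 + b^2)" for a b :: real
    using sq[of "-1" a b] sq[of 1 a b] by simp_all
  have loi: "integrable (win 0 t) (\<lambda>u. (\<bar>f u\<bar> - \<bar>g u\<bar>)^2)" and hii: "integrable (win 0 t) (\<lambda>u. (\<bar>f u\<bar> + \<bar>g u\<bar>)^2)" if "0 \<le> t" for t
  proof -
    have "f \<in> borel_measurable (win 0 t)" "g \<in> borel_measurable (win 0 t)"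
      by (rule win_measurable; fact)+
    then have m: "(\<lambda>u. (\<bar>f u\<bar> - \<bar>g u\<bar>)^2) \<in> borel_measurable (win 0 t)" "(\<lambda>u. (\<bar>f u\<bar> + \<bar>g u\<bar>)^2) \<in> borel_measurable (win 0 t)"
      by simp_all
    show "integrable (win 0 t) (\<lambda>u. (\<bar>f u\<bar> - \<bar>g u\<bar>)^2)"
      by (rule Bochner_Integration.integrable_bound[OF mi[OF that] m(1)]) (intro AE_I2, simp, use sq' in simp)
    show "integrable (win 0 t) (\<lambda>u. (\<bar>f u\<bar> + \<bar>g u\<bar>)^2)"
      by (rule Bochner_Integration.integrable_bound[OF mi[OF that] m(2)]) (intro AE_I2, simp, use sq' in simp)
  qed
  have minc: "m t - m s = (\<integral>u. 2 * ((f u)^2 + (g u)^2) \<partial>win s t)"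
    and loinc: "lo t - lo s = (\<integral>u. (\<bar>f u\<bar> - \<bar>g u\<bar>)^2 \<partial>win s t)"
    and hiinc: "hi t - hi s = (\<integral>u. (\<bar>f u\<bar> + \<bar>g u\<bar>)^2 \<partial>win s t)" if "0 \<le> s" "s \<le> t" for s t
  proof -
    have t: "0 \<le> t" using that by simp
    show "m t - m s = (\<integral>u. 2 * ((f u)^2 + (g u)^2) \<partial>win s t)"
      unfolding m_def by (rule energy_increment[OF mi[OF t] that])
    show "lo t - lo s = (\<integral>u. (\<bar>f u\<bar> - \<bar>g u\<bar>)^2 \<partial>win s t)"
      unfolding lo_def by (rule energy_increment[OF loi[OF t] that])
    show "hi t - hi s = (\<integral>u. (\<bar>f u\<bar> + \<bar>g u\<bar>)^2 \<partial>win s t)"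
      unfolding hi_def by (rule energy_increment[OF hii[OF t] that])
  qed
  show lom: "0 \<le> lo t - lo s \<and> lo t - lo s \<le> m t - m s" and him: "0 \<le> hi t - hi s \<and> hi t - hi s \<le> m t - m s"
    if st: "0 \<le> s" "s \<le> t" for s t
  proof -
    have t: "0 \<le> t" using st by simp
    note sub = win_integrable_subset[where s'=0 and s=s and t=t and t'=t, OF _ st(1) order_refl]
    show "0 \<le> lo t - lo s \<and> lo t - lo s \<le> m t - m s"
      unfolding loinc[OF st] minc[OF st]
      by (intro conjI Bochner_Integration.integral_nonneg integral_mono sub[OF loi[OF t]] sub[OF mi[OF t]] sq' zero_le_power2)
    show "0 \<le> hi t - hi s \<and> hi t - hi s \<le> m t - m s"
      unfolding hiinc[OF st] minc[OF st]
      by (intro conjI Bochner_Integration.integral_nonneg integral_mono sub[OF hii[OF t]] sub[OF mi[OF t]] sq' zero_le_power2)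
  qed
  have XM: "X t \<in> borel_measurable M" and YM: "Y t \<in> borel_measurable M" if "0 \<le> t" for t
    using wiener_integralD(1)[OF X[OF that]] wiener_integralD(1)[OF Y[OF that]] by blast+
  have RM: "R t \<in> borel_measurable M" if "0 \<le> t" for t
  proof -
    have "(\<lambda>x. r + X t x - Y t x) \<in> borel_measurable M" using XM[OF that] YM[OF that] by simp
    then show ?thesis using R[OF that] by (simp cong: measurable_cong)
  qed
  have dX: "wiener_integral M B s t f (\<lambda>x. X t x - X s x)" and dY: "wiener_integral M V s t g (\<lambda>x. Y t x - Y s x)"
    if st: "0 \<le> s" "s \<le> t" for s t
  proof -
    have t: "0 \<le> t" using st by simp
    show "wiener_integral M B s t f (\<lambda>x. X t x - X s x)"
      by (rule wiener_integral_increment[OF B st X[OF t] X[OF st(1)]])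
    show "wiener_integral M V s t g (\<lambda>x. Y t x - Y s x)"
      by (rule wiener_integral_increment[OF V st Y[OF t] Y[OF st(1)]])
  qed
  define D where "D s t x = (X t x - X s x) - (Y t x - Y s x)" for s t x
  have RD: "R t x - R s x = D s t x" if "0 \<le> s" "s \<le> t" "x \<in> space M" for s t x
    using R[of s x] R[of t x] that by (simp add: D_def)
  have swap: "(\<integral>x. G x (R t x - R s x) \<partial>M) = (\<integral>x. G x (D s t x) \<partial>M)" if "0 \<le> s" "s \<le> t" for G :: "'a \<Rightarrow> real \<Rightarrow> real" and s t
    by (rule Bochner_Integration.integral_cong) (simp_all add: RD[OF that])
  have moments: "(\<integral>x. Z x * D s t x \<partial>M) = 0"
    "(\<And>x. x \<in> space M \<Longrightarrow> 0 \<le> Z x) \<Longrightarrow> (lo t - lo s) * (\<integral>x. Z x \<partial>M) \<le> (\<integral>x. Z x * (D s t x)^2 \<partial>M) \<and>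
      (\<integral>x. Z x * (D s t x)^2 \<partial>M) \<le> (hi t - hi s) * (\<integral>x. Z x \<partial>M)"
    if st: "0 \<le> s" "s \<le> t" and Z: "Z \<in> borel_measurable (F s)" "\<forall>x\<in>space M. \<bar>Z x\<bar> \<le> K" for s t Z and K :: real
    unfolding D_def loinc[OF st] hiinc[OF st]
    by (rule wiener_integral_pair_moments[OF B V st(1) dX[OF st] dY[OF st] Z(1) Z(2)[rule_format]]; assumption)+
  have D4: "integrable M (\<lambda>x. D s t x ^ 4)" "(\<integral>x. D s t x ^ 4 \<partial>M) \<le> 24 * (m t - m s)^2" if st: "0 \<le> s" "s \<le> t" for s t
  proof -
    have t: "0 \<le> t" using st by simp
    let ?x = "\<lambda>x. X t x - X s x" and ?y = "\<lambda>x. Y t x - Y s x"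
    note x4 = wiener_integral_fourth[OF B st(1) dX[OF st]] and y4 = wiener_integral_fourth[OF V st(1) dY[OF st]]
    have i: "integrable M (\<lambda>x. 8 * ?x x ^ 4 + 8 * ?y x ^ 4)" using x4(1) y4(1) by simp
    show i4: "integrable M (\<lambda>x. D s t x ^ 4)"
    proof (rule Bochner_Integration.integrable_bound[OF i])
      have "D s t \<in> borel_measurable M"
        unfolding D_def[abs_def] by (intro borel_measurable_diff XM YM st t)
      then show "(\<lambda>x. D s t x ^ 4) \<in> borel_measurable M" by (rule borel_measurable_power)
      show "AE x in M. norm (D s t x ^ 4) \<le> norm (8 * ?x x ^ 4 + 8 * ?y x ^ 4)"
        unfolding D_def by (rule AE_I2) (use fourth_power_diff in simp)
    qed
    define a where "a = (\<integral>u. (f u)^2 \<partial>win s t)"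
    define b where "b = (\<integral>u. (g u)^2 \<partial>win s t)"
    have ab: "0 \<le> a" "0 \<le> b" unfolding a_def b_def by (rule Bochner_Integration.integral_nonneg, simp)+
    have mab: "m t - m s = 2 * (a + b)"
      unfolding minc[OF st] a_def b_def
      using win_integrable_subset[OF f2[OF t] st(1) order_refl] win_integrable_subset[OF g2[OF t] st(1) order_refl] by simp
    have "(\<integral>x. D s t x ^ 4 \<partial>M) \<le> (\<integral>x. 8 * ?x x ^ 4 + 8 * ?y x ^ 4 \<partial>M)"
      by (rule integral_mono[OF i4 i]) (use fourth_power_diff in \<open>simp add: D_def\<close>)
    also have "\<dots> = 8 * (\<integral>x. ?x x ^ 4 \<partial>M) + 8 * (\<integral>x. ?y x ^ 4 \<partial>M)" using x4(1) y4(1) by simp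
    also have "\<dots> \<le> 8 * (12 * a^2) + 8 * (12 * b^2)"
      using x4(2) y4(2) unfolding a_def b_def by (intro add_mono mult_left_mono) simp_all
    also have "\<dots> \<le> 24 * (2 * (a + b))^2"
      using mult_nonneg_nonneg[OF ab] by (simp add: power2_eq_square algebra_simps)
    finally show "(\<integral>x. D s t x ^ 4 \<partial>M) \<le> 24 * (m t - m s)^2" unfolding mab .
  qed
  have md: "martingale_diff M (F s) (\<lambda>x. R t x - R s x)" if st: "0 \<le> s" "s \<le> t" for s t
    unfolding martingale_diff_def
  proof (intro conjI allI impI)
    have t: "0 \<le> t" using st by simp
    show "(\<lambda>x. R t x - R s x) \<in> borel_measurable M" by (rule borel_measurable_diff[OF RM[OF t] RM[OF st(1)]])
    show "integrable M (\<lambda>x. (R t x - R s x)^4)"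
      using D4(1)[OF st] RD[OF st] by (simp cong: Bochner_Integration.integrable_cong)
    fix Z and K :: real assume Z: "Z \<in> borel_measurable (F s)" "\<forall>x\<in>space M. \<bar>Z x\<bar> \<le> K"
    show "(\<integral>x. Z x * (R t x - R s x) \<partial>M) = 0"
      using swap[OF st, of "\<lambda>x d. Z x * d"] moments(1)[OF st Z] by simp
  qed
  show "var_ge M (F s) (\<lambda>x. R t x - R s x) (lo t - lo s)" if st: "0 \<le> s" "s \<le> t" for s t
    unfolding var_ge_def
  proof (intro allI impI)
    fix Z and K :: real assume Z: "Z \<in> borel_measurable (F s)" "\<forall>x\<in>space M. 0 \<le> Z x \<and> Z x \<le> K"
    have Z': "\<forall>x\<in>space M. \<bar>Z x\<bar> \<le> K" and pos: "\<And>x. x \<in> space M \<Longrightarrow> 0 \<le> Z x" using Z(2) by auto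
    show "(lo t - lo s) * (\<integral>x. Z x \<partial>M) \<le> (\<integral>x. Z x * (R t x - R s x)^2 \<partial>M)"
      using swap[OF st, of "\<lambda>x d. Z x * d^2"] moments(2)[OF st Z(1) Z' pos] by simp
  qed
  show vl: "var_le M (F s) (\<lambda>x. R t x - R s x) (hi t - hi s)" if st: "0 \<le> s" "s \<le> t" for s t
    unfolding var_le_def
  proof (intro allI impI)
    fix Z and K :: real assume Z: "Z \<in> borel_measurable (F s)" "\<forall>x\<in>space M. 0 \<le> Z x \<and> Z x \<le> K"
    have Z': "\<forall>x\<in>space M. \<bar>Z x\<bar> \<le> K" and pos: "\<And>x. x \<in> space M \<Longrightarrow> 0 \<le> Z x" using Z(2) by auto
    show "(\<integral>x. Z x * (R t x - R s x)^2 \<partial>M) \<le> (hi t - hi s) * (\<integral>x. Z x \<partial>M)"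
      using swap[OF st, of "\<lambda>x d. Z x * d^2"] moments(2)[OF st Z(1) Z' pos] by simp
  qed
  have second: "(\<integral>x. (R t x - R s x)^2 \<partial>M) \<le> m t - m s" if st: "0 \<le> s" "s \<le> t" for s t
  proof -
    have "(\<integral>x. 1 * (R t x - R s x)^2 \<partial>M) \<le> (hi t - hi s) * (\<integral>x. 1 \<partial>M)"
      using vl[OF st, unfolded var_le_def, rule_format, of "\<lambda>_. 1" 1] by simp
    then show ?thesis using him[OF st] by (simp add: prob_space)
  qed
  have adapted: "\<exists>R'\<in>borel_measurable (F t). AE x in M. R t x = R' x" if t: "0 \<le> t" for t
  proof -
    obtain X' where X': "X' \<in> borel_measurable (F t)" "AE x in M. X t x = X' x"
      using wiener_integral_adapted[OF B order_refl t X[OF t]] by blast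
    obtain Y' where Y': "Y' \<in> borel_measurable (F t)" "AE x in M. Y t x = Y' x"
      using wiener_integral_adapted[OF V order_refl t Y[OF t]] by blast
    have "AE x in M. R t x = r + X' x - Y' x"
      using X'(2) Y'(2) AE_space by eventually_elim (simp add: R[OF t])
    moreover have "(\<lambda>x. r + X' x - Y' x) \<in> borel_measurable (F t)" using X'(1) Y'(1) by simp
    ultimately show ?thesis by (rule bexI)
  qed
  have initial: "AE x in M. R 0 x = r"
  proof -
    have XY0: "AE x in M. Q x = 0" if W: "brownian_motion M F W" and Q: "wiener_integral M W 0 0 h Q" for W h Q
    proof -
      have e: "(\<integral>u. (h u)^2 \<partial>win 0 0) = 0" unfolding win_integral_eq by (simp add: set_lebesgue_integral_def)
      note q4 = wiener_integral_fourth[OF W order_refl Q]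
      have "(\<integral>x. Q x ^ 4 \<partial>M) \<le> 0" using q4(2) unfolding e by simp
      moreover have "0 \<le> (\<integral>x. Q x ^ 4 \<partial>M)" by (rule Bochner_Integration.integral_nonneg) simp
      ultimately have "(\<integral>x. Q x ^ 4 \<partial>M) = 0" by simp
      then have "AE x in M. Q x ^ 4 = 0"
        using integral_nonneg_eq_0_iff_AE[OF q4(1)] by simp
      then show ?thesis by eventually_elim simp
    qed
    show ?thesis
      using XY0[OF B X[OF order_refl]] XY0[OF V Y[OF order_refl]] AE_space
      by eventually_elim (simp add: R)
  qed
  show "quartic_martingale M F R r m 24"
  proof unfold_locales
    show "(\<integral>x. (R t x - R s x)^4 \<partial>M) \<le> 24 * (m t - m s)^2" if "0 \<le> s" "s \<le> t" for s t
      using swap[OF that, of "\<lambda>x d. d^4"] D4(2)[OF that] by simp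
    show "continuous_on {0..T} m" for T unfolding m_def by (rule energy_continuous[OF mi])
  qed (fact sub filt adapted RM paths md second initial r | simp)+
qed

lemma wiener_integral_step:
  assumes B: "brownian_motion M F B"
    and H: "\<And>t. 0 \<le> t \<Longrightarrow> wiener_integral M B 0 t h (H t)" and t: "0 \<le> t" and g: "grid 0 t n p"
  shows "wiener_integral M B 0 t (\<lambda>u. h u * step_fun n p c u) (step_integral H n p c)"
  using g
proof (induction n)
  case 0
  have "(\<lambda>u. h u * step_fun 0 p c u) = (\<lambda>_. 0)" "step_integral H 0 p c = (\<lambda>_. 0)"
    by (auto simp: step_fun_def step_integral_def)
  then show ?case using wiener_integral_zero[OF t, of M B] by simp
next
  case (Suc n)
  have le: "0 \<le> p n" "p n \<le> p (Suc n)" "p (Suc n) \<le> t"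
    using grid_bounds[OF Suc.prems, of n] grid_bounds[OF Suc.prems, of "Suc n"] Suc.prems by (auto simp: grid_def)
  then have "grid 0 t n p" using Suc.prems by (auto simp: grid_def)
  note IH = Suc.IH[OF this]
  have p: "0 \<le> p (Suc n)" using le by simp
  have inc: "wiener_integral M B 0 t (\<lambda>u. h u * indicator {p n<..p (Suc n)} u) (\<lambda>x. H (p (Suc n)) x - H (p n) x)"
    by (rule wiener_integral_extend[OF wiener_integral_increment[OF B le(1,2) H[OF p] H[OF le(1)]] le(1,3)])
  have "(\<lambda>u. h u * step_fun n p c u + c n * (h u * indicator {p n<..p (Suc n)} u)) = (\<lambda>u. h u * step_fun (Suc n) p c u)"
    by (rule ext) (simp only: step_fun_Suc distrib_left mult.left_commute)
  moreover have "(\<lambda>x. step_integral H n p c x + c n * (H (p (Suc n)) x - H (p n) x)) = step_integral H (Suc n) p c"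
    by (rule ext) (simp only: step_integral_Suc)
  ultimately show ?case using wiener_integral_linear[OF B order_refl IH inc, of "c n"] by simp
qed

text \<open>
  If \<open>H\<close> is the integral of \<open>h\<close> against \<open>B\<close>, then integrating \<open>g\<close> against \<open>H\<close> amounts to integrating
  \<open>g h\<close> against \<open>B\<close>. For step functions this is linearity; the bound on \<open>h\<close> keeps the products close
  to \<open>g h\<close>.
\<close>

lemma wiener_integral_assoc:
  assumes B: "brownian_motion M F B"
    and H: "\<And>t. 0 \<le> t \<Longrightarrow> wiener_integral M B 0 t h (H t)" and t: "0 \<le> t"
    and h: "\<And>u. \<bar>h u\<bar> \<le> 1" and Y: "wiener_integral M H 0 t g Y"
  shows "wiener_integral M B 0 t (\<lambda>u. g u * h u) Y"
proof (rule wiener_integral_closed[OF B order_refl])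
  show "Y \<in> borel_measurable M" by (rule wiener_integralD(1)[OF Y])
  show "(\<lambda>u. g u * h u) \<in> borel_measurable borel"
    by (rule borel_measurable_times[OF wiener_integralD(2)[OF Y] wiener_integralD(2)[OF H[OF order_refl]]])
  fix e :: real assume "e > 0"
  then obtain n p c where p: "grid 0 t n p" and a: "sqn (win 0 t) (\<lambda>u. g u - step_fun n p c u) \<le> ennreal e"
    and b: "sqn M (\<lambda>x. Y x - step_integral H n p c x) \<le> ennreal e"
    using wiener_integralD(3)[OF Y] by blast
  have "sqn (win 0 t) (\<lambda>u. g u * h u - h u * step_fun n p c u) \<le> sqn (win 0 t) (\<lambda>u. g u - step_fun n p c u)"
  proof (rule sqn_mono)
    fix u
    have "\<bar>g u * h u - h u * step_fun n p c u\<bar> = \<bar>h u\<bar> * \<bar>g u - step_fun n p c u\<bar>"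
      by (simp add: right_diff_distrib mult.commute flip: abs_mult)
    also have "\<dots> \<le> 1 * \<bar>g u - step_fun n p c u\<bar>" by (rule mult_right_mono[OF h]) simp
    finally show "\<bar>g u * h u - h u * step_fun n p c u\<bar> \<le> \<bar>g u - step_fun n p c u\<bar>" by simp
  qed
  then have "sqn (win 0 t) (\<lambda>u. g u * h u - h u * step_fun n p c u) \<le> ennreal e" using a by (rule order_trans)
  then show "\<exists>g' Y'. wiener_integral M B 0 t g' Y' \<and> sqn (win 0 t) (\<lambda>u. g u * h u - g' u) \<le> ennreal e \<and>
      sqn M (\<lambda>x. Y x - Y' x) \<le> ennreal e"
    using wiener_integral_step[OF B H t p] b by blast
qed

end

section \<open>The comparison theorem\<close>

text \<open>
  With the driver \<open>V\<^sup>I\<close> or \<open>V\<^sup>I\<^sup>I\<close> the volatility of \<open>R\<close> is the left-hand side, so the extremal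
  clocks are attained.
\<close>

lemma sgn_coupling:
  fixes a b :: real
  assumes "a \<noteq> 0" "b \<noteq> 0"
  shows "(a - b * sgn (a * b))^2 = (\<bar>a\<bar> - \<bar>b\<bar>)^2" "(a - b * - sgn (a * b))^2 = (\<bar>a\<bar> + \<bar>b\<bar>)^2"
proof -
  have e: "b * sgn (a * b) = sgn a * \<bar>b\<bar>"
    unfolding sgn_mult abs_sgn[of b] by (rule mult.left_commute)
  have one: "(sgn a)^2 = 1" using assms(1) by (simp add: sgn_if)
  have "a - b * sgn (a * b) = sgn a * (\<bar>a\<bar> - \<bar>b\<bar>)"
    unfolding e right_diff_distrib mult_sgn_abs ..
  then show "(a - b * sgn (a * b))^2 = (\<bar>a\<bar> - \<bar>b\<bar>)^2"
    by (simp only: power_mult_distrib one mult_1)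
  have "a - b * - sgn (a * b) = sgn a * (\<bar>a\<bar> + \<bar>b\<bar>)"
    unfolding mult_minus_right e distrib_left mult_sgn_abs by simp
  then show "(a - b * - sgn (a * b))^2 = (\<bar>a\<bar> + \<bar>b\<bar>)^2"
    by (simp only: power_mult_distrib one mult_1)
qed

theorem proposition4p5:
  fixes M :: "'a measure" and F :: "real \<Rightarrow> 'a measure"
    and B V VI VII R RI RII :: "real \<Rightarrow> 'a \<Rightarrow> real"
    and S1 S2 :: "real \<Rightarrow> real" and r T :: real
  assumes "filtered_prob_space M F"
    and "brownian_motion M F B"
    and "S1 \<in> borel_measurable (restrict_space borel {0..})"
    and "S2 \<in> borel_measurable (restrict_space borel {0..})"
    and "\<And>t. t \<ge> 0 \<Longrightarrow> (\<integral>\<^sup>+s\<in>{0..t}. ennreal ((S1 s)\<^sup>2) \<partial>lborel) < \<infinity>"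
    and "\<And>t. t \<ge> 0 \<Longrightarrow> (\<integral>\<^sup>+s\<in>{0..t}. ennreal ((S2 s)\<^sup>2) \<partial>lborel) < \<infinity>"
    and "\<And>s. s \<ge> 0 \<Longrightarrow> \<bar>S1 s\<bar> > 0"
    and "\<And>s. s \<ge> 0 \<Longrightarrow> \<bar>S2 s\<bar> > 0"
    and "filterlim (\<lambda>t. LINT s:{0..t}|lborel. (\<bar>S1 s\<bar> - \<bar>S2 s\<bar>)\<^sup>2) at_top at_top"
    and "filterlim (\<lambda>t. LINT s:{0..t}|lborel. (\<bar>S1 s\<bar> + \<bar>S2 s\<bar>)\<^sup>2) at_top at_top"
    and "r \<le> 0"
    and "stochastic_integral M B (\<lambda>s. sgn (S1 s * S2 s)) VI"
    and "VII = (\<lambda>t x. - VI t x)"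
    and "brownian_motion M F V"
    and "is_R M B S1 S2 r V R"
    and "is_R M B S1 S2 r VI RI"
    and "is_R M B S1 S2 r VII RII"
    and "T > 0"
  shows "measure M {x \<in> space M. tau0plus RII x > ereal T}
           \<le> measure M {x \<in> space M. tau0plus R x > ereal T}
       \<and> measure M {x \<in> space M. tau0plus R x > ereal T}
           \<le> measure M {x \<in> space M. tau0plus RI x > ereal T}"
proof -
  interpret filtered M F
    using assms(1) unfolding filtered_prob_space_def
    by (intro filtered.intro filtered_axioms.intro) blast+
  note B = assms(2) and V = assms(14)
  \<comment> \<open>Measurability is given only on the half-line, so the integrands are extended by zero.\<close>
  define f where "f = (\<lambda>u. indicator {0..} u * S1 u)"
  define g where "g = (\<lambda>u. indicator {0..} u * S2 u)"
  define h where "h = (\<lambda>u. sgn (f u * g u))"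
  have fM: "f \<in> borel_measurable borel" and gM: "g \<in> borel_measurable borel"
    using assms(3,4) unfolding f_def g_def by (simp_all add: borel_measurable_restrict_space_iff)
  have hM: "h \<in> borel_measurable borel" using fM gM unfolding h_def by simp
  have f: "f u = S1 u" and g: "g u = S2 u" and h: "h u = sgn (S1 u * S2 u)" if "0 \<le> u" for u
    using that by (simp_all add: f_def g_def h_def)
  have h1: "\<bar>h u\<bar> \<le> 1" "\<bar>- h u\<bar> \<le> 1" for u by (simp_all add: h_def abs_sgn_eq)
  obtain X Y where X: "stochastic_integral M B S1 X" and Y: "stochastic_integral M V S2 Y"
    and R: "\<And>t x. 0 \<le> t \<Longrightarrow> x \<in> space M \<Longrightarrow> R t x = r + X t x - Y t x"
    using assms(15) unfolding is_R_def by blast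
  obtain X1 Y1 where X1: "stochastic_integral M B S1 X1" and Y1: "stochastic_integral M VI S2 Y1"
    and R1: "\<And>t x. 0 \<le> t \<Longrightarrow> x \<in> space M \<Longrightarrow> RI t x = r + X1 t x - Y1 t x"
    using assms(16) unfolding is_R_def by blast
  obtain X2 Y2 where X2: "stochastic_integral M B S1 X2" and Y2: "stochastic_integral M VII S2 Y2"
    and R2: "\<And>t x. 0 \<le> t \<Longrightarrow> x \<in> space M \<Longrightarrow> RII t x = r + X2 t x - Y2 t x"
    using assms(17) unfolding is_R_def by blast
  have paths: "continuous_on {0..} (\<lambda>t. P t x)"
    if "stochastic_integral M W q J" "stochastic_integral M W' q' J'"
      "\<And>t x. 0 \<le> t \<Longrightarrow> x \<in> space M \<Longrightarrow> P t x = r + J t x - J' t x" "x \<in> space M" for W W' q q' J J' P x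
  proof -
    have "continuous_on {0..} (\<lambda>t. J t x)" "continuous_on {0..} (\<lambda>t. J' t x)"
      using that unfolding stochastic_integral_def by blast+
    then have "continuous_on {0..} (\<lambda>t. r + J t x - J' t x)" by (intro continuous_intros)
    then show ?thesis by (rule continuous_on_eq) (simp add: that(3,4))
  qed
  have wf: "wiener_integral M W 0 t f (J t)" if "stochastic_integral M W S1 J" "0 \<le> t" for W J t
    by (rule wiener_integral_of_stochastic_integral[OF that(1) fM f that(2)])
  have wg: "wiener_integral M W 0 t g (J t)" if "stochastic_integral M W S2 J" "0 \<le> t" for W J t
    by (rule wiener_integral_of_stochastic_integral[OF that(1) gM g that(2)])
  have wVI: "wiener_integral M B 0 t h (VI t)" if "0 \<le> t" for t
    by (rule wiener_integral_of_stochastic_integral[OF assms(12) hM h that])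
  have wVII: "wiener_integral M B 0 t (\<lambda>u. - h u) (VII t)" if "0 \<le> t" for t
    using wiener_integral_linear[OF B order_refl wiener_integral_zero[OF that, of M B] wVI[OF that], of "- 1"]
    unfolding assms(13) by simp
  \<comment> \<open>Both extremal processes are integrals against \<open>B\<close> alone: the second driver carries the zero integrand.\<close>
  have coupled: "wiener_integral M B 0 t (\<lambda>u. f u - g u * k u) (\<lambda>x. J t x - J' t x)"
    if H: "\<And>t. 0 \<le> t \<Longrightarrow> wiener_integral M B 0 t k (H t)" and k: "\<And>u. \<bar>k u\<bar> \<le> 1"
      and J: "stochastic_integral M B S1 J" and J': "stochastic_integral M H S2 J'" and t: "0 \<le> t"
    for k H J J' t
    using wiener_integral_linear[OF B order_refl wf[OF J t] wiener_integral_assoc[OF B H t k wg[OF J' t]], of "- 1"]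
    by simp
  have zero: "wiener_integral M B 0 t (\<lambda>_. 0) (\<lambda>_. 0)" if "0 \<le> t" for t
    by (rule wiener_integral_zero[OF that])
  have "RI t x = r + (X1 t x - Y1 t x) - 0" if "0 \<le> t" "x \<in> space M" for t x using R1[OF that] by simp
  note QI = quartic_martingale_of_wiener_integrals[OF B B coupled[OF wVI h1(1) X1 Y1] zero this
      paths[OF X1 Y1 R1] assms(11)]
  have "RII t x = r + (X2 t x - Y2 t x) - 0" if "0 \<le> t" "x \<in> space M" for t x using R2[OF that] by simp
  note QII = quartic_martingale_of_wiener_integrals[OF B B coupled[OF wVII h1(2) X2 Y2] zero this
      paths[OF X2 Y2 R2] assms(11)]
  note Q = quartic_martingale_of_wiener_integrals[OF B V wf[OF X] wg[OF Y] R paths[OF X Y R] assms(11)]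
  have eI: "energy (\<lambda>u. (\<bar>f u - g u * h u\<bar> + \<bar>0\<bar>)^2) = energy (\<lambda>u. (\<bar>f u\<bar> - \<bar>g u\<bar>)^2)"
  proof (rule ext, unfold energy_def, rule Bochner_Integration.integral_cong[OF refl])
    fix t u assume "u \<in> space (win 0 t)"
    then have u: "0 \<le> u" by (simp add: space_restrict_space)
    show "(\<bar>f u - g u * h u\<bar> + \<bar>0\<bar>)^2 = (\<bar>f u\<bar> - \<bar>g u\<bar>)^2"
      using sgn_coupling(1)[of "f u" "g u"] assms(7,8)[OF u] by (simp add: f[OF u] g[OF u] h_def)
  qed
  have eII: "energy (\<lambda>u. (\<bar>f u - g u * - h u\<bar> - \<bar>0\<bar>)^2) = energy (\<lambda>u. (\<bar>f u\<bar> + \<bar>g u\<bar>)^2)"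
  proof (rule ext, unfold energy_def, rule Bochner_Integration.integral_cong[OF refl])
    fix t u assume "u \<in> space (win 0 t)"
    then have u: "0 \<le> u" by (simp add: space_restrict_space)
    show "(\<bar>f u - g u * - h u\<bar> - \<bar>0\<bar>)^2 = (\<bar>f u\<bar> + \<bar>g u\<bar>)^2"
      using sgn_coupling(2)[of "f u" "g u"] assms(7,8)[OF u] by (simp add: f[OF u] g[OF u] h_def)
  qed
  show ?thesis
  proof
    show "measure M {x \<in> space M. tau0plus RII x > ereal T} \<le> measure M {x \<in> space M. tau0plus R x > ereal T}"
      by (rule tau0plus_comparison[OF QII(1) Q(1) assms(18) QII(4)[unfolded eII] Q(5) QII(2)[unfolded eII] Q(3)])
    show "measure M {x \<in> space M. tau0plus R x > ereal T} \<le> measure M {x \<in> space M. tau0plus RI x > ereal T}"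
      by (rule tau0plus_comparison[OF Q(1) QI(1) assms(18) Q(4) QI(5)[unfolded eI] Q(2) QI(3)[unfolded eI]])
  qed
qed

end
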